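(* Assume that $K<+\infty$, that $J\subset(0,\infty)^2$, and that there exists $(\tilde\theta,\tilde\sigma^2)\in J$ such that $\tilde\theta\tilde\sigma^2=\theta_0\sigma_0^2$. Then, for fixed $0<a\le b<+\infty$ and $0<c\le d<+\infty$, the following hold as $n\to\infty$. (i) If $J=[a,b]\times[c,d]$ with $ad>\theta_0\sigma_0^2$ or $bc<\theta_0\sigma_0^2$, then $\hat\theta_{p\ell}\hat\sigma^2_{p\ell}$ does not converge in probability to $\theta_0\sigma_0^2$. (ii) If $J=[a,b]\times[c,d]$ with $ad\le\theta_0\sigma_0^2$ and $bc\ge\theta_0\sigma_0^2$, then $\hat\theta_{p\ell}\hat\sigma^2_{p\ell}$ converges to $\theta_0\sigma_0^2$ almost surely. (iii) If $J=[a,b]\times(0,\infty)$, then $\hat\theta_{p\ell}\hat\sigma^2_{p\ell}$ does not converge in probability to $\theta_0\sigma_0^2$. (iv) If $J=(0,\infty)\times[c,d]$, then $\hat\theta_{p\ell}\hat\sigma^2_{p\ell}$ converges to $\theta_0\sigma_0^2$ almost surely.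
   Context: $Z=\{Z(s),s\in[0,1]\}$ is a stationary zero-mean Gaussian process (the stationary Ornstein-Uhlenbeck process, with almost surely continuous sample paths) with covariance $\mathrm{cov}\{Z(s),Z(t)\}=\sigma_0^2e^{-\theta_0|s-t|}$, for fixed (true) $\theta_0,\sigma_0^2\in(0,\infty)$. For each $n$, the observation points are $s_1<\dots<s_n$ in $[0,1]$, where $s_i=s_i^{(n)}$ is a (deterministic) triangular array; the observations are $Z(s_1),\dots,Z(s_n)$. Weights: $(w_k)_{k\ge1}$ is a fixed sequence of non-negative numbers, not all zero (not depending on $n$), and $K=\max\{k\ge 1: w_k\ne0\}$ (with $K=+\infty$ if infinitely many $w_k$ are non-zero). For $\psi=(\theta,\sigma^2)^\top\in(0,\infty)^2$ and $s\neq t\in[0,1]$ let $$\ell_{s,t}(\psi)=2\ln(\sigma^2)+\ln(1-e^{-2\theta|s-t|})+\frac{1}{\sigma^2}Z(s)^2+\frac{\{Z(t)-e^{-\theta|s-t|}Z(s)\}^2}{\sigma^2(1-e^{-2\theta|s-t|})}.$$ The weighted pairwise log-likelihood is $$p\ell_n(\psi)=\sum_{i=1}^{n-1}\sum_{j=i+1}^n w_{j-i}\,\ell_{s_i,s_j}(\psi),$$ and the weighted pairwise maximum likelihood estimator over $J$ is $\hat\psi_{p\ell}=(\hat\theta_{p\ell},\hat\sigma^2_{p\ell})^\top=\mathrm{argmin}_{\psi\in J}\,p\ell_n(\psi)$ (a minimizer of $p\ell_n$ over $J$). *)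

theory Defs
  imports "HOL-Probability.Probability" "HOL-Library.Extended_Nat"
begin

(* The second disjunct is the degenerate normal law with variance 0. *)
definition gaussian_rv :: "'w measure \<Rightarrow> ('w \<Rightarrow> real) \<Rightarrow> bool" where
  "gaussian_rv M X \<longleftrightarrow> X \<in> borel_measurable M \<and>
     ((\<exists>\<mu> \<sigma>. 0 < \<sigma> \<and> distributed M lborel X (\<lambda>x. ennreal (normal_density \<mu> \<sigma> x))) \<or>
      (\<exists>\<mu>. AE \<omega> in M. X \<omega> = \<mu>))"

definition gaussian_process_on :: "'w measure \<Rightarrow> 't set \<Rightarrow> ('t \<Rightarrow> 'w \<Rightarrow> real) \<Rightarrow> bool" where
  "gaussian_process_on M T Z \<longleftrightarrow>
     (\<forall>F c. finite F \<and> F \<subseteq> T \<longrightarrow> gaussian_rv M (\<lambda>\<omega>. \<Sum>t\<in>F. c t * Z t \<omega>))"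

definition covar :: "'w measure \<Rightarrow> ('w \<Rightarrow> real) \<Rightarrow> ('w \<Rightarrow> real) \<Rightarrow> real" where
  "covar M X Y = (\<integral>\<omega>. (X \<omega> - (\<integral>\<omega>'. X \<omega>' \<partial>M)) * (Y \<omega> - (\<integral>\<omega>'. Y \<omega>' \<partial>M)) \<partial>M)"

(* The parameter v is the variance sigma^2.  Stationarity needs no separate clause:
   the mean is constant, the covariance depends on s - t only, and the
   finite-dimensional laws of a Gaussian process are determined by the two. *)
definition ou_process :: "'w measure \<Rightarrow> real \<Rightarrow> real \<Rightarrow> (real \<Rightarrow> 'w \<Rightarrow> real) \<Rightarrow> bool" where
  "ou_process M \<theta> v Z \<longleftrightarrow>
     gaussian_process_on M {0..1} Z \<and>
     (\<forall>s\<in>{0..1}. (\<integral>\<omega>. Z s \<omega> \<partial>M) = 0) \<and>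
     (\<forall>s\<in>{0..1}. \<forall>t\<in>{0..1}. covar M (Z s) (Z t) = v * exp (- \<theta> * \<bar>s - t\<bar>)) \<and>
     (AE \<omega> in M. continuous_on {0..1} (\<lambda>s. Z s \<omega>))"

(* s n i is the i-th of the n observation points, 1 \<le> i \<le> n. *)
definition observation_points :: "(nat \<Rightarrow> nat \<Rightarrow> real) \<Rightarrow> bool" where
  "observation_points s \<longleftrightarrow>
     (\<forall>n. s n ` {1..n} \<subseteq> {0..1} \<and> strict_mono_on {1..n} (s n))"

(* The supremum in enat is the maximum if finitely many weights are non-zero
   (and at least one is), and infinity if infinitely many are. *)
definition max_lag :: "(nat \<Rightarrow> real) \<Rightarrow> enat" where
  "max_lag w = Sup {enat k |k. 1 \<le> k \<and> w k \<noteq> 0}"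

(* Minus twice the log-density of (z(s), z(t)), up to an additive constant.
   The second component of psi is sigma^2. *)
definition pair_loglik :: "(real \<Rightarrow> real) \<Rightarrow> real \<Rightarrow> real \<Rightarrow> real \<times> real \<Rightarrow> real" where
  "pair_loglik z s t = (\<lambda>(\<theta>, v).
     2 * ln v + ln (1 - exp (- 2 * \<theta> * \<bar>s - t\<bar>)) + 1 / v * (z s)\<^sup>2
       + (z t - exp (- \<theta> * \<bar>s - t\<bar>) * z s)\<^sup>2 / (v * (1 - exp (- 2 * \<theta> * \<bar>s - t\<bar>))))"

definition weighted_pair_loglik ::
  "(nat \<Rightarrow> real) \<Rightarrow> (nat \<Rightarrow> nat \<Rightarrow> real) \<Rightarrow> nat \<Rightarrow> (real \<Rightarrow> real) \<Rightarrow> real \<times> real \<Rightarrow> real" where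
  "weighted_pair_loglik w s n z \<psi> =
     (\<Sum>i = 1..n - 1. \<Sum>j = i + 1..n. w (j - i) * pair_loglik z (s n i) (s n j) \<psi>)"

(* A measurable selection of the argmin.  On events where the infimum over J is not
   attained (possible for small n when J is not compact) the value is arbitrary. *)
definition pairwise_mle ::
  "'w measure \<Rightarrow> (real \<Rightarrow> 'w \<Rightarrow> real) \<Rightarrow> (nat \<Rightarrow> real) \<Rightarrow> (nat \<Rightarrow> nat \<Rightarrow> real) \<Rightarrow> (real \<times> real) set
    \<Rightarrow> (nat \<Rightarrow> 'w \<Rightarrow> real \<times> real) \<Rightarrow> bool" where
  "pairwise_mle M Z w s J est \<longleftrightarrow>
     (\<forall>n. est n \<in> borel_measurable M \<and>
       (AE \<omega> in M.
          (\<exists>\<psi>. is_arg_min (weighted_pair_loglik w s n (\<lambda>t. Z t \<omega>)) (\<lambda>\<psi>. \<psi> \<in> J) \<psi>) \<longrightarrow>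
          is_arg_min (weighted_pair_loglik w s n (\<lambda>t. Z t \<omega>)) (\<lambda>\<psi>. \<psi> \<in> J) (est n \<omega>)))"

definition conv_in_prob :: "'w measure \<Rightarrow> (nat \<Rightarrow> 'w \<Rightarrow> real) \<Rightarrow> real \<Rightarrow> bool" where
  "conv_in_prob M X x \<longleftrightarrow>
     (\<forall>\<epsilon>>0. (\<lambda>n. measure M {\<omega> \<in> space M. \<bar>X n \<omega> - x\<bar> > \<epsilon>}) \<longlonglongrightarrow> 0)"

definition conv_almost_surely :: "'w measure \<Rightarrow> (nat \<Rightarrow> 'w \<Rightarrow> real) \<Rightarrow> real \<Rightarrow> bool" where
  "conv_almost_surely M X x \<longleftrightarrow> (AE \<omega> in M. (\<lambda>n. X n \<omega>) \<longlonglongrightarrow> x)"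

end

theory Submission
  imports Defs "HOL-Real_Asymp.Real_Asymp"
begin

text \<open>Divided by \<open>n\<close>, the log-likelihood is
  \<open>2 m\<^sub>n ln \<sigma>\<^sup>2 + L\<^sub>n(\<theta>) + (A\<^sub>n + T\<^sub>n(\<theta>)) / \<sigma>\<^sup>2\<close>, where \<open>m\<^sub>n\<close> is the mean weight and \<open>A\<^sub>n\<close> the weighted mean
  of \<open>Z(s\<^sub>i)\<^sup>2\<close>. For pairs of lag \<open>k\<close>, the innovations at \<open>\<theta>\<^sub>0\<close> with indices in one residue class
  modulo \<open>k\<close> are independent standard normals, and the gaps of lag \<open>k\<close> add up to at most \<open>k\<close>. By
  exponential \<open>\<chi>\<^sup>2\<close> tails and Borel--Cantelli, almost surely \<open>T\<^sub>n(\<theta>) \<rightarrow> m \<theta>\<^sub>0\<sigma>\<^sub>0\<^sup>2 / \<theta>\<close> and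
  \<open>L\<^sub>n(\<theta>) - L\<^sub>n(\<theta>\<^sub>0) \<rightarrow> m ln(\<theta> / \<theta>\<^sub>0)\<close>, uniformly on compact sets of \<open>\<theta>\<close>.

  If \<open>(\<theta>\<^sub>0\<sigma>\<^sub>0\<^sup>2 / \<sigma>\<^sup>2, \<sigma>\<^sup>2)\<close> lies in \<open>J\<close> for every admissible \<open>\<sigma>\<^sup>2\<close>, comparing the estimator with this
  point at equal \<open>\<sigma>\<^sup>2\<close> eliminates the random term \<open>A\<^sub>n\<close> and forces \<open>\<theta>\<sigma>\<^sup>2\<close> to \<open>\<theta>\<^sub>0\<sigma>\<^sub>0\<^sup>2\<close>. Otherwise, the optimal
  \<open>\<sigma>\<^sup>2\<close> given \<open>\<theta>\<close> is \<open>(A\<^sub>n + T\<^sub>n(\<theta>)) / (2 m\<^sub>n)\<close>, truncated to \<open>[c, d]\<close> if necessary, and \<open>A\<^sub>n\<close> is arbitrarily large, and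
  also arbitrarily small, with probability bounded away from \<open>0\<close>; on such events the product stays away
  from \<open>\<theta>\<^sub>0\<sigma>\<^sub>0\<^sup>2\<close>.\<close>

section \<open>Gaussian random variables and exponential moments of quadratic forms\<close>

text \<open>The design is an arbitrary triangular array: it need not become dense, single gaps need
  not become small, and the rows are unrelated. Only the weighted average of the gaps tends to 0, so
  every error has to be made linear in the gap. For the same reason the marginal mean need not
  converge in law; the probabilities of its large and small values are bounded below uniformly over
  all probability weights on points of [0,1], the large ones through the variance of the weighted
  mean of the process, the small ones through a ball of paths of positive probability. The process
  is given by the laws of its finite linear combinations. Sums of squares are therefore reached
  through exponential moments: an auxiliary Gaussian vector turns these into moments of linear
  combinations, and independence of the innovations is replaced by their orthonormality. A small
  marginal mean spoils the product because a pair pays for the logarithm of the variance twice while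
  only one of its two normalised squares survives; the unconstrained product then drops to about
  half the true one. The estimator is arbitrary where no minimum exists, so attainment is proved in
  each case.\<close>

lemma nn_integral_std_normal_exp_linear:
  "(\<integral>\<^sup>+x. ennreal (exp (a * x)) \<partial>std_normal_distribution) = ennreal (exp (a\<^sup>2 / 2))"
proof -
  have eq: "std_normal_density x * exp (a * x) = exp (a\<^sup>2 / 2) * normal_density a 1 x" for x
    by (simp add: normal_density_def exp_add[symmetric]) (simp add: field_simps power2_eq_square)
  have "(\<integral>\<^sup>+x. ennreal (exp (a * x)) \<partial>std_normal_distribution)
      = (\<integral>\<^sup>+x. ennreal (std_normal_density x * exp (a * x)) \<partial>lborel)"
    by (subst nn_integral_density) (auto simp: ennreal_mult)
  also have "\<dots> = (\<integral>\<^sup>+x. ennreal (exp (a\<^sup>2 / 2)) * ennreal (normal_density a 1 x) \<partial>lborel)"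
    by (simp add: eq ennreal_mult)
  also have "\<dots> = ennreal (exp (a\<^sup>2 / 2))"
    by (subst nn_integral_cmult) (auto simp: nn_integral_eq_integral)
  finally show ?thesis .
qed

lemma nn_integral_std_normal_exp_square:
  assumes "a < 1"
  shows "(\<integral>\<^sup>+x. ennreal (exp (a * x\<^sup>2 / 2)) \<partial>std_normal_distribution) = ennreal (1 / sqrt (1 - a))"
proof -
  have eq: "std_normal_density x * exp (a * x\<^sup>2 / 2)
      = 1 / sqrt (1 - a) * normal_density 0 (1 / sqrt (1 - a)) x" for x
  proof -
    have "std_normal_density x * exp (a * x\<^sup>2 / 2) = 1 / sqrt (2 * pi) * exp (- x\<^sup>2 * (1 - a) / 2)"
      by (simp add: normal_density_def exp_add[symmetric]) (simp add: field_simps)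
    moreover have "normal_density 0 (1 / sqrt (1 - a)) x
        = sqrt (1 - a) / sqrt (2 * pi) * exp (- x\<^sup>2 * (1 - a) / 2)"
      using assms by (simp add: normal_density_def real_sqrt_divide power_divide)
    ultimately show ?thesis using assms by simp
  qed
  have "(\<integral>\<^sup>+x. ennreal (exp (a * x\<^sup>2 / 2)) \<partial>std_normal_distribution)
      = (\<integral>\<^sup>+x. ennreal (std_normal_density x * exp (a * x\<^sup>2 / 2)) \<partial>lborel)"
    by (subst nn_integral_density) (auto simp: ennreal_mult)
  also have "\<dots> = (\<integral>\<^sup>+x. ennreal (1 / sqrt (1 - a)) * ennreal (normal_density 0 (1 / sqrt (1 - a)) x) \<partial>lborel)"
    using assms by (simp only: eq) (simp add: ennreal_mult[symmetric])
  also have "\<dots> = ennreal (1 / sqrt (1 - a))"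
    using assms by (subst nn_integral_cmult) (auto simp: nn_integral_eq_integral)
  finally show ?thesis .
qed

section \<open>Centred Gaussian variables, degenerate ones included\<close>

context prob_space
begin

text \<open>A combination of process values may have variance 0, for instance if all coefficients
  vanish. Point masses therefore count as Gaussian, and facts about centred Gaussian variables are
  proved in two cases.\<close>

lemma centered_gaussian_rv_cases:
  assumes "gaussian_rv M X" "expectation X = 0"
  obtains (degenerate) "AE \<omega> in M. X \<omega> = 0"
  | (density) \<sigma> where "0 < \<sigma>" "distributed M lborel X (normal_density 0 \<sigma>)"
proof -
  have [measurable]: "X \<in> borel_measurable M"
    using assms by (simp add: gaussian_rv_def)
  consider (1) \<mu> \<sigma> where "0 < \<sigma>" "distributed M lborel X (normal_density \<mu> \<sigma>)"
    | (2) \<mu> where "AE \<omega> in M. X \<omega> = \<mu>"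
    using assms(1) by (auto simp: gaussian_rv_def)
  then show ?thesis
  proof cases
    case 1
    then show ?thesis using normal_distributed_expectation[OF 1] assms(2) density by auto
  next
    case 2
    then have "expectation X = expectation (\<lambda>_. \<mu>)"
      by (intro integral_cong_AE) auto
    then show ?thesis using 2 assms(2) degenerate by (simp add: prob_space)
  qed
qed

lemma centered_gaussian_rv_square_integrable:
  assumes "gaussian_rv M X" "expectation X = 0"
  shows "integrable M (\<lambda>\<omega>. (X \<omega>)\<^sup>2)"
  using assms
proof (cases rule: centered_gaussian_rv_cases)
  case degenerate
  have [measurable]: "X \<in> borel_measurable M"
    using assms by (simp add: gaussian_rv_def)
  have "integrable M (\<lambda>\<omega>. (X \<omega>)\<^sup>2) \<longleftrightarrow> integrable M (\<lambda>_. 0::real)"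
    using degenerate by (intro integrable_cong_AE) auto
  then show ?thesis by simp
next
  case (density \<sigma>)
  have "integrable M (\<lambda>\<omega>. (X \<omega>)\<^sup>2) \<longleftrightarrow> integrable lborel (\<lambda>x. normal_density 0 \<sigma> x * x\<^sup>2)"
    by (rule distributed_integrable[OF density(2), symmetric]) auto
  then show ?thesis
    using integrable_normal_moment[OF density(1), of 0 2] by simp
qed

lemma centered_gaussian_rv_integrable:
  assumes "gaussian_rv M X" "expectation X = 0"
  shows "integrable M X"
  by (rule square_integrable_imp_integrable[OF _ centered_gaussian_rv_square_integrable[OF assms]])
    (use assms(1) in \<open>simp add: gaussian_rv_def\<close>)

lemma centered_gaussian_rv_char:
  assumes "gaussian_rv M X" "expectation X = 0"
  shows "(CLINT \<omega>|M. iexp (X \<omega>)) = complex_of_real (exp (- expectation (\<lambda>\<omega>. (X \<omega>)\<^sup>2) / 2))"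
  using assms
proof (cases rule: centered_gaussian_rv_cases)
  case degenerate
  have [measurable]: "X \<in> borel_measurable M"
    using assms by (simp add: gaussian_rv_def)
  have "(CLINT \<omega>|M. iexp (X \<omega>)) = (CLINT \<omega>|M. 1)"
    using degenerate by (intro integral_cong_AE) auto
  moreover have "expectation (\<lambda>\<omega>. (X \<omega>)\<^sup>2) = expectation (\<lambda>_. 0)"
    using degenerate by (intro integral_cong_AE) auto
  ultimately show ?thesis by (simp add: prob_space)
next
  case (density \<sigma>)
  have [measurable]: "X \<in> borel_measurable M"
    using assms by (simp add: gaussian_rv_def)
  have Y: "distributed M lborel (\<lambda>\<omega>. X \<omega> / \<sigma>) std_normal_density"
    using normal_standard_normal_convert[OF density(1), of X 0] density(2) by simp
  then have d: "distr M borel (\<lambda>\<omega>. X \<omega> / \<sigma>) = std_normal_distribution"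
    by (simp add: distributed_def cong: distr_cong)
  have "(CLINT \<omega>|M. iexp (X \<omega>)) = (CLINT x|distr M borel (\<lambda>\<omega>. X \<omega> / \<sigma>). iexp (\<sigma> * x))"
    using density(1) by (subst integral_distr) simp_all
  also have "\<dots> = complex_of_real (exp (- (\<sigma>\<^sup>2) / 2))"
    using char_std_normal_distribution unfolding d char_def by metis
  finally show ?thesis
    using normal_distributed_variance[OF density] assms(2) by simp
qed

lemma centered_gaussian_rv_nn_integral_exp:
  assumes "gaussian_rv M X" "expectation X = 0"
  shows "(\<integral>\<^sup>+\<omega>. ennreal (exp (X \<omega>)) \<partial>M) = ennreal (exp (expectation (\<lambda>\<omega>. (X \<omega>)\<^sup>2) / 2))"
  using assms
proof (cases rule: centered_gaussian_rv_cases)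
  case degenerate
  have [measurable]: "X \<in> borel_measurable M"
    using assms by (simp add: gaussian_rv_def)
  have "(\<integral>\<^sup>+\<omega>. ennreal (exp (X \<omega>)) \<partial>M) = (\<integral>\<^sup>+\<omega>. 1 \<partial>M)"
    using degenerate by (intro nn_integral_cong_AE) auto
  moreover have "expectation (\<lambda>\<omega>. (X \<omega>)\<^sup>2) = expectation (\<lambda>_. 0)"
    using degenerate by (intro integral_cong_AE) auto
  ultimately show ?thesis by (simp add: emeasure_space_1)
next
  case (density \<sigma>)
  have [measurable]: "X \<in> borel_measurable M"
    using assms by (simp add: gaussian_rv_def)
  have Y: "distributed M lborel (\<lambda>\<omega>. X \<omega> / \<sigma>) std_normal_density"
    using normal_standard_normal_convert[OF density(1), of X 0] density(2) by simp
  then have d: "distr M borel (\<lambda>\<omega>. X \<omega> / \<sigma>) = std_normal_distribution"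
    by (simp add: distributed_def cong: distr_cong)
  have "(\<integral>\<^sup>+\<omega>. ennreal (exp (X \<omega>)) \<partial>M)
      = (\<integral>\<^sup>+x. ennreal (exp (\<sigma> * x)) \<partial>distr M borel (\<lambda>\<omega>. X \<omega> / \<sigma>))"
    using density(1) by (subst nn_integral_distr) auto
  also have "\<dots> = ennreal (exp (\<sigma>\<^sup>2 / 2))"
    unfolding d by (rule nn_integral_std_normal_exp_linear)
  finally show ?thesis
    using normal_distributed_variance[OF density] assms(2) by simp
qed

text \<open>A larger variance only makes large values more likely, so a lower bound \<open>v\<close>
  of the variance suffices. Applied with a \<open>v\<close> common to all designs, it gives a bound
  uniform in \<open>n\<close>.\<close>

lemma centered_gaussian_rv_tail_ge:
  assumes "gaussian_rv M X" "expectation X = 0"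
    and "0 < v" "v \<le> expectation (\<lambda>\<omega>. (X \<omega>)\<^sup>2)"
    and "0 \<le> R"
  shows "measure std_normal_distribution {R / sqrt v<..} \<le> prob {\<omega> \<in> space M. R < \<bar>X \<omega>\<bar>}"
  using assms(1,2)
proof (cases rule: centered_gaussian_rv_cases)
  case degenerate
  have [measurable]: "X \<in> borel_measurable M"
    using assms by (simp add: gaussian_rv_def)
  have "expectation (\<lambda>\<omega>. (X \<omega>)\<^sup>2) = expectation (\<lambda>_. 0)"
    using degenerate by (intro integral_cong_AE) auto
  then show ?thesis using assms by simp
next
  case (density \<sigma>)
  have [measurable]: "X \<in> borel_measurable M"
    using assms by (simp add: gaussian_rv_def)
  have Y: "distributed M lborel (\<lambda>\<omega>. X \<omega> / \<sigma>) std_normal_density"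
    using normal_standard_normal_convert[OF density(1), of X 0] density(2) by simp
  then have d: "distr M borel (\<lambda>\<omega>. X \<omega> / \<sigma>) = std_normal_distribution"
    by (simp add: distributed_def cong: distr_cong)
  have "v \<le> \<sigma>\<^sup>2"
    using normal_distributed_variance[OF density] assms by simp
  then have le: "sqrt v \<le> \<sigma>"
    using density(1) by (intro real_le_lsqrt) (use assms in auto)
  have "measure std_normal_distribution {R / sqrt v<..}
      = prob ((\<lambda>\<omega>. X \<omega> / \<sigma>) -` {R / sqrt v<..} \<inter> space M)"
    unfolding d[symmetric] by (subst measure_distr) auto
  also have "\<dots> \<le> prob {\<omega> \<in> space M. R < \<bar>X \<omega>\<bar>}"
  proof (rule finite_measure_mono)
    have "R < \<bar>X \<omega>\<bar>" if "R / sqrt v < X \<omega> / \<sigma>" for \<omega>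
    proof -
      have "R / \<sigma> \<le> R / sqrt v"
        using le assms by (intro divide_left_mono) (auto simp: density(1))
      then have "R / \<sigma> < X \<omega> / \<sigma>" using that by simp
      then show ?thesis using density(1) by (simp add: divide_less_cancel)
    qed
    then show "(\<lambda>\<omega>. X \<omega> / \<sigma>) -` {R / sqrt v<..} \<inter> space M \<subseteq> {\<omega> \<in> space M. R < \<bar>X \<omega>\<bar>}"
      by auto
  qed measurable
  finally show ?thesis .
qed

end

lemma std_normal_distribution_greaterThan_pos:
  "0 < measure std_normal_distribution {r<..}"
proof -
  interpret real_distribution std_normal_distribution
    by (rule real_dist_normal_dist)
  have "emeasure std_normal_distribution {r<..} \<noteq> 0"
  proof
    assume "emeasure std_normal_distribution {r<..} = 0"
    then have "AE x in lborel. x \<in> {r<..} \<longrightarrow> ennreal (std_normal_density x) = 0"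
      by (subst (asm) emeasure_density)
        (auto simp: nn_integral_0_iff_AE indicator_def split: if_splits)
    then have "AE x in lborel. x \<notin> {r<..}"
      by eventually_elim (use normal_density_pos[of 1 0] in \<open>auto simp: less_le\<close>)
    then have "emeasure lborel {r<..} = 0"
      by (subst (asm) AE_iff_measurable[of "{r<..}"]) auto
    moreover have "emeasure lborel {r<..r+1} \<le> emeasure lborel {r<..}"
      by (intro emeasure_mono) auto
    ultimately show False by simp
  qed
  then show ?thesis by (simp add: emeasure_eq_measure zero_less_measure_iff)
qed

text \<open>The Hubbard--Stratonovich transform: mixing over an independent standard Gaussian vector
  \<open>g\<close> linearises the quadratic form \<open>\<Sum>Y\<^sub>i\<^sup>2\<close>, so that its exponential moments depend on the law of
  the linear combinations of the \<open>Y\<^sub>i\<close> only.\<close>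

abbreviation std_normal_vector :: "'i set \<Rightarrow> ('i \<Rightarrow> real) measure" where
  "std_normal_vector I \<equiv> PiM I (\<lambda>_. std_normal_distribution)"

lemma product_prob_space_std_normal: "product_prob_space (\<lambda>_::'i. std_normal_distribution)"
proof -
  interpret prob_space "std_normal_distribution"
    using real_dist_normal_dist by (simp add: real_distribution_def)
  show ?thesis by standard
qed

lemma nn_integral_std_normal_vector_exp_linear:
  assumes "finite I"
  shows "(\<integral>\<^sup>+g. ennreal (exp (\<Sum>i\<in>I. a i * g i)) \<partial>std_normal_vector I) = ennreal (exp ((\<Sum>i\<in>I. (a i)\<^sup>2) / 2))"
proof -
  interpret product_prob_space "\<lambda>_::'a. std_normal_distribution" I
    by (rule product_prob_space_std_normal)
  have "(\<integral>\<^sup>+g. ennreal (exp (\<Sum>i\<in>I. a i * g i)) \<partial>std_normal_vector I)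
      = (\<integral>\<^sup>+g. (\<Prod>i\<in>I. ennreal (exp (a i * g i))) \<partial>std_normal_vector I)"
    using assms by (simp add: exp_sum prod_ennreal)
  also have "\<dots> = (\<Prod>i\<in>I. ennreal (exp ((a i)\<^sup>2 / 2)))"
    using assms by (subst product_nn_integral_prod) (auto simp: nn_integral_std_normal_exp_linear)
  finally show ?thesis using assms by (simp add: exp_sum prod_ennreal sum_divide_distrib)
qed

lemma nn_integral_std_normal_vector_exp_square:
  assumes "finite I" "a < 1"
  shows "(\<integral>\<^sup>+g. ennreal (exp (a * (\<Sum>i\<in>I. (g i)\<^sup>2) / 2)) \<partial>std_normal_vector I)
    = ennreal ((1 / sqrt (1 - a)) ^ card I)"
proof -
  interpret product_prob_space "\<lambda>_::'a. std_normal_distribution" I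
    by (rule product_prob_space_std_normal)
  have "(\<integral>\<^sup>+g. ennreal (exp (a * (\<Sum>i\<in>I. (g i)\<^sup>2) / 2)) \<partial>std_normal_vector I)
      = (\<integral>\<^sup>+g. (\<Prod>i\<in>I. ennreal (exp (a * (g i)\<^sup>2 / 2))) \<partial>std_normal_vector I)"
    using assms by (simp add: exp_sum prod_ennreal sum_divide_distrib sum_distrib_left)
  also have "\<dots> = (\<Prod>i\<in>I. ennreal (1 / sqrt (1 - a)))"
    using assms by (subst product_nn_integral_prod) (auto simp: nn_integral_std_normal_exp_square)
  finally show ?thesis using assms by (simp add: prod_ennreal ennreal_power)
qed

lemma integral_std_normal_vector_iexp:
  assumes "finite I"
  shows "(CLINT g|std_normal_vector I. iexp (\<Sum>i\<in>I. a i * g i))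
    = complex_of_real (exp (- (\<Sum>i\<in>I. (a i)\<^sup>2) / 2))"
proof -
  interpret product_prob_space "\<lambda>_::'a. std_normal_distribution" I
    by (rule product_prob_space_std_normal)
  have N: "prob_space std_normal_distribution"
    using real_dist_normal_dist by (simp add: real_distribution_def)
  have "(CLINT g|std_normal_vector I. iexp (\<Sum>i\<in>I. a i * g i))
      = (CLINT g|std_normal_vector I. (\<Prod>i\<in>I. iexp (a i * g i)))"
    using assms by (simp add: exp_sum sum_distrib_left)
  also have "\<dots> = (\<Prod>i\<in>I. CLINT x|std_normal_distribution. iexp (a i * x))"
    using assms by (subst product_integral_prod) (auto intro!: prob_space.integrable_iexp[OF N])
  also have "\<dots> = (\<Prod>i\<in>I. complex_of_real (exp (- ((a i)\<^sup>2) / 2)))"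
    using char_std_normal_distribution unfolding char_def by (intro prod.cong refl) metis
  finally show ?thesis
    using assms by (simp add: exp_sum sum_divide_distrib sum_negf[symmetric] del: of_real_exp)
qed

context prob_space
begin

text \<open>Integrating \<open>iexp (\<Sum>i\<in>I. Y i \<omega> * g i)\<close> over
  \<open>g\<close> first gives the left side, over \<open>\<omega>\<close> first the right side. The
  integrand has modulus 1, so Fubini applies.\<close>

lemma laplace_sum_squares:
  assumes I: "finite I" and Y: "\<And>i. i \<in> I \<Longrightarrow> Y i \<in> borel_measurable M"
    and char: "\<And>g. (CLINT \<omega>|M. iexp (\<Sum>i\<in>I. g i * Y i \<omega>)) = complex_of_real (exp (- Q g / 2))"
  shows "expectation (\<lambda>\<omega>. exp (- (\<Sum>i\<in>I. (Y i \<omega>)\<^sup>2) / 2)) = (\<integral>g. exp (- Q g / 2) \<partial>std_normal_vector I)"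
proof -
  interpret G: product_prob_space "\<lambda>_. std_normal_distribution" I
    by (rule product_prob_space_std_normal)
  interpret pair_prob_space M "std_normal_vector I" ..
  note Y[measurable] I[simp]
  have int: "integrable (M \<Otimes>\<^sub>M std_normal_vector I) (\<lambda>(\<omega>, g). iexp (\<Sum>i\<in>I. Y i \<omega> * g i))"
    by (rule P.integrable_const_bound[where B=1]) (auto simp: split_beta)
  have "complex_of_real (\<integral>\<omega>. exp (- (\<Sum>i\<in>I. (Y i \<omega>)\<^sup>2) / 2) \<partial>M)
      = (CLINT \<omega>|M. CLINT g|std_normal_vector I. iexp (\<Sum>i\<in>I. Y i \<omega> * g i))"
    unfolding integral_std_normal_vector_iexp[OF I] by (simp del: of_real_exp)
  also have "\<dots> = (CLINT g|std_normal_vector I. CLINT \<omega>|M. iexp (\<Sum>i\<in>I. Y i \<omega> * g i))"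
    using Fubini_integral[OF int] by simp
  also have "\<dots> = (CLINT g|std_normal_vector I. complex_of_real (exp (- Q g / 2)))"
    using char by (simp add: mult.commute)
  also have "\<dots> = complex_of_real (\<integral>g. exp (- Q g / 2) \<partial>std_normal_vector I)"
    by (rule integral_complex_of_real)
  finally show ?thesis by (simp only: of_real_eq_iff)
qed

text \<open>The same exchange with a real exponential. It is stated for the extended non-negative
  integral because finiteness is not known beforehand.\<close>

lemma nn_integral_exp_sum_squares:
  assumes I: "finite I" and Y: "\<And>i. i \<in> I \<Longrightarrow> Y i \<in> borel_measurable M"
    and mgf: "\<And>g. (\<integral>\<^sup>+\<omega>. ennreal (exp (\<Sum>i\<in>I. g i * Y i \<omega>)) \<partial>M) = ennreal (exp (Q g / 2))"
  shows "(\<integral>\<^sup>+\<omega>. ennreal (exp ((\<Sum>i\<in>I. (Y i \<omega>)\<^sup>2) / 2)) \<partial>M)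
    = (\<integral>\<^sup>+g. ennreal (exp (Q g / 2)) \<partial>std_normal_vector I)"
proof -
  interpret G: product_prob_space "\<lambda>_. std_normal_distribution" I
    by (rule product_prob_space_std_normal)
  interpret pair_prob_space M "std_normal_vector I" ..
  note Y[measurable] I[simp]
  have "(\<integral>\<^sup>+\<omega>. ennreal (exp ((\<Sum>i\<in>I. (Y i \<omega>)\<^sup>2) / 2)) \<partial>M)
      = (\<integral>\<^sup>+\<omega>. \<integral>\<^sup>+g. ennreal (exp (\<Sum>i\<in>I. Y i \<omega> * g i)) \<partial>std_normal_vector I \<partial>M)"
    unfolding nn_integral_std_normal_vector_exp_linear[OF I] ..
  also have "\<dots> = (\<integral>\<^sup>+g. \<integral>\<^sup>+\<omega>. ennreal (exp (\<Sum>i\<in>I. Y i \<omega> * g i)) \<partial>M \<partial>std_normal_vector I)"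
    by (rule Fubini'[symmetric]) simp
  also have "\<dots> = (\<integral>\<^sup>+g. ennreal (exp (Q g / 2)) \<partial>std_normal_vector I)"
    using mgf by (simp add: mult.commute)
  finally show ?thesis .
qed

end

section \<open>Finite linear combinations of a centred Gaussian process\<close>

lemma (in prob_space) centered_gaussian_process_component:
  assumes gp: "gaussian_process_on M T Y" and mean: "\<And>t. t \<in> T \<Longrightarrow> expectation (Y t) = 0"
    and t: "t \<in> T"
  shows "gaussian_rv M (Y t)" "Y t \<in> borel_measurable M" "integrable M (Y t)"
    "integrable M (\<lambda>\<omega>. (Y t \<omega>)\<^sup>2)"
proof -
  show rv: "gaussian_rv M (Y t)"
    using gp[unfolded gaussian_process_on_def, rule_format, of "{t}" "\<lambda>_. 1"] t by simp
  then show "Y t \<in> borel_measurable M"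
    by (simp add: gaussian_rv_def)
  show "integrable M (Y t)" "integrable M (\<lambda>\<omega>. (Y t \<omega>)\<^sup>2)"
    using centered_gaussian_rv_integrable[OF rv] centered_gaussian_rv_square_integrable[OF rv] mean t
    by auto
qed

lemma (in prob_space) centered_gaussian_process_mult_integrable:
  assumes gp: "gaussian_process_on M T Y" and mean: "\<And>t. t \<in> T \<Longrightarrow> expectation (Y t) = 0"
    and t: "t \<in> T" "u \<in> T"
  shows "integrable M (\<lambda>\<omega>. Y t \<omega> * Y u \<omega>)"
proof (rule Bochner_Integration.integrable_bound)
  note comp = centered_gaussian_process_component[OF gp mean]
  note [measurable] = comp(2)[OF _ t(1)] comp(2)[OF _ t(2)]
  show "integrable M (\<lambda>\<omega>. (Y t \<omega>)\<^sup>2 + (Y u \<omega>)\<^sup>2)"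
    using comp(4) t by simp
  have "\<bar>x * y\<bar> \<le> x\<^sup>2 + y\<^sup>2" for x y :: real
    using sum_squares_bound[of "\<bar>x\<bar>" "\<bar>y\<bar>"] abs_ge_zero[of "x * y"]
    unfolding power2_abs abs_mult by linarith
  then show "AE \<omega> in M. norm (Y t \<omega> * Y u \<omega>) \<le> norm ((Y t \<omega>)\<^sup>2 + (Y u \<omega>)\<^sup>2)"
    by simp
  show "(\<lambda>\<omega>. Y t \<omega> * Y u \<omega>) \<in> borel_measurable M" by simp
qed

lemma (in prob_space) centered_gaussian_process_sum:
  assumes gp: "gaussian_process_on M T Y" and mean: "\<And>t. t \<in> T \<Longrightarrow> expectation (Y t) = 0"
    and F: "finite F" "F \<subseteq> T"
  shows "gaussian_rv M (\<lambda>\<omega>. \<Sum>t\<in>F. c t * Y t \<omega>)"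
    and "expectation (\<lambda>\<omega>. \<Sum>t\<in>F. c t * Y t \<omega>) = 0"
    and "expectation (\<lambda>\<omega>. (\<Sum>t\<in>F. c t * Y t \<omega>)\<^sup>2)
      = (\<Sum>t\<in>F. \<Sum>u\<in>F. c t * c u * expectation (\<lambda>\<omega>. Y t \<omega> * Y u \<omega>))"
proof -
  show "gaussian_rv M (\<lambda>\<omega>. \<Sum>t\<in>F. c t * Y t \<omega>)"
    using gp F by (simp add: gaussian_process_on_def)
  note int = centered_gaussian_process_component(3)[OF gp mean]
  note prod = centered_gaussian_process_mult_integrable[OF gp mean]
  show "expectation (\<lambda>\<omega>. \<Sum>t\<in>F. c t * Y t \<omega>) = 0"
    using F int mean by (subst Bochner_Integration.integral_sum) (auto simp: subset_iff)
  have "expectation (\<lambda>\<omega>. (\<Sum>t\<in>F. c t * Y t \<omega>)\<^sup>2)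
      = expectation (\<lambda>\<omega>. \<Sum>t\<in>F. \<Sum>u\<in>F. c t * c u * (Y t \<omega> * Y u \<omega>))"
    by (simp add: power2_eq_square sum_product algebra_simps)
  also have "\<dots> = (\<Sum>t\<in>F. \<Sum>u\<in>F. c t * c u * expectation (\<lambda>\<omega>. Y t \<omega> * Y u \<omega>))"
  proof -
    have "integrable M (\<lambda>\<omega>. c t * c u * (Y t \<omega> * Y u \<omega>))" if "t \<in> F" "u \<in> F" for t u
      using prod[of t u] F that by auto
    then show ?thesis
      by (simp add: Bochner_Integration.integral_sum)
  qed
  finally show "expectation (\<lambda>\<omega>. (\<Sum>t\<in>F. c t * Y t \<omega>)\<^sup>2)
      = (\<Sum>t\<in>F. \<Sum>u\<in>F. c t * c u * expectation (\<lambda>\<omega>. Y t \<omega> * Y u \<omega>))" .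
qed

section \<open>Concentration of sums of squares of orthonormal Gaussian families\<close>

lemma inverse_sqrt_power:
  assumes "0 < (x::real)"
  shows "(1 / sqrt x) ^ k = exp (- ln x * k / 2)"
proof -
  have "1 / sqrt x = exp (- ln x / 2)"
    using assms by (simp add: exp_minus inverse_eq_divide flip: ln_sqrt)
  then show ?thesis
    by (simp add: exp_of_nat_mult[symmetric] mult.commute)
qed

text \<open>Such a family consists of independent standard normals, but independence is never
  derived: only the variances of linear combinations enter.\<close>

locale orthonormal_gaussian = prob_space +
  fixes I :: "'i set" and Y :: "'i \<Rightarrow> 'a \<Rightarrow> real"
  assumes finite_index: "finite I"
    and gaussian: "gaussian_process_on M I Y"
    and mean: "\<And>i. i \<in> I \<Longrightarrow> expectation (Y i) = 0"
    and orthonormal: "\<And>i j. i \<in> I \<Longrightarrow> j \<in> I \<Longrightarrow>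
      expectation (\<lambda>\<omega>. Y i \<omega> * Y j \<omega>) = (if i = j then 1 else 0)"
begin

lemma measurable_component [measurable]: "i \<in> I \<Longrightarrow> Y i \<in> borel_measurable M"
  using gaussian[unfolded gaussian_process_on_def, rule_format, of "{i}" "\<lambda>_. 1"]
  by (simp add: gaussian_rv_def)

lemma combination:
  shows "gaussian_rv M (\<lambda>\<omega>. \<Sum>i\<in>I. g i * Y i \<omega>)"
    and "expectation (\<lambda>\<omega>. \<Sum>i\<in>I. g i * Y i \<omega>) = 0"
    and expectation_combination_square:
      "expectation (\<lambda>\<omega>. (\<Sum>i\<in>I. g i * Y i \<omega>)\<^sup>2) = (\<Sum>i\<in>I. (g i)\<^sup>2)"
proof -
  note * = centered_gaussian_process_sum[of I Y I g, OF gaussian _ finite_index order_refl]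
  show "gaussian_rv M (\<lambda>\<omega>. \<Sum>i\<in>I. g i * Y i \<omega>)"
    and "expectation (\<lambda>\<omega>. \<Sum>i\<in>I. g i * Y i \<omega>) = 0"
    using *(1,2) mean by blast+
  have "expectation (\<lambda>\<omega>. (\<Sum>i\<in>I. g i * Y i \<omega>)\<^sup>2)
      = (\<Sum>i\<in>I. \<Sum>j\<in>I. if i = j then (g i)\<^sup>2 else 0)"
    by (subst *(3)) (auto intro!: sum.cong simp: mean orthonormal power2_eq_square)
  then show "expectation (\<lambda>\<omega>. (\<Sum>i\<in>I. g i * Y i \<omega>)\<^sup>2) = (\<Sum>i\<in>I. (g i)\<^sup>2)"
    by (simp add: finite_index)
qed

text \<open>After scaling by \<open>sqrt l\<close>, the combination with coefficients
  \<open>g\<close> has variance \<open>l\<close> times the squared length of \<open>g\<close>, so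
  the integral over \<open>g\<close> factorises into one-dimensional Gaussian integrals.\<close>

lemma nn_integral_exp_chi_square:
  assumes "0 \<le> l" "l < 1"
  shows "(\<integral>\<^sup>+\<omega>. ennreal (exp (l * (\<Sum>i\<in>I. (Y i \<omega>)\<^sup>2) / 2)) \<partial>M) = ennreal ((1 / sqrt (1 - l)) ^ card I)"
proof -
  have "(\<integral>\<^sup>+\<omega>. ennreal (exp (\<Sum>i\<in>I. g i * (sqrt l * Y i \<omega>))) \<partial>M)
      = ennreal (exp (l * (\<Sum>i\<in>I. (g i)\<^sup>2) / 2))" for g
  proof -
    have "(\<integral>\<^sup>+\<omega>. ennreal (exp (\<Sum>i\<in>I. (g i * sqrt l) * Y i \<omega>)) \<partial>M)
      = ennreal (exp ((\<Sum>i\<in>I. (g i * sqrt l)\<^sup>2) / 2))"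
      using centered_gaussian_rv_nn_integral_exp[OF combination(1,2)]
      unfolding expectation_combination_square .
    moreover have "(\<Sum>i\<in>I. (g i * sqrt l)\<^sup>2) = l * (\<Sum>i\<in>I. (g i)\<^sup>2)"
      using assms by (simp add: power_mult_distrib sum_distrib_left mult.commute)
    ultimately show ?thesis by (simp add: mult.assoc)
  qed
  from nn_integral_exp_sum_squares[OF finite_index _ this]
  have "(\<integral>\<^sup>+\<omega>. ennreal (exp ((\<Sum>i\<in>I. (sqrt l * Y i \<omega>)\<^sup>2) / 2)) \<partial>M)
      = ennreal ((1 / sqrt (1 - l)) ^ card I)"
    using assms by (simp add: nn_integral_std_normal_vector_exp_square[OF finite_index])
  moreover have "(\<Sum>i\<in>I. (sqrt l * Y i \<omega>)\<^sup>2) = l * (\<Sum>i\<in>I. (Y i \<omega>)\<^sup>2)" for \<omega>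
    using assms by (simp add: power_mult_distrib sum_distrib_left)
  ultimately show ?thesis by simp
qed

lemma laplace_chi_square:
  assumes "0 \<le> l"
  shows "expectation (\<lambda>\<omega>. exp (- l * (\<Sum>i\<in>I. (Y i \<omega>)\<^sup>2) / 2)) = (1 / sqrt (1 + l)) ^ card I"
proof -
  have "(CLINT \<omega>|M. iexp (\<Sum>i\<in>I. g i * (sqrt l * Y i \<omega>)))
      = complex_of_real (exp (- (l * (\<Sum>i\<in>I. (g i)\<^sup>2)) / 2))" for g
  proof -
    have "(CLINT \<omega>|M. iexp (\<Sum>i\<in>I. (g i * sqrt l) * Y i \<omega>))
      = complex_of_real (exp (- (\<Sum>i\<in>I. (g i * sqrt l)\<^sup>2) / 2))"
      using centered_gaussian_rv_char[OF combination(1,2)]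
      unfolding expectation_combination_square .
    moreover have "(\<Sum>i\<in>I. (g i * sqrt l)\<^sup>2) = l * (\<Sum>i\<in>I. (g i)\<^sup>2)"
      using assms by (simp add: power_mult_distrib sum_distrib_left mult.commute)
    ultimately show ?thesis by (simp add: mult.assoc)
  qed
  from laplace_sum_squares[OF finite_index _ this]
  have "expectation (\<lambda>\<omega>. exp (- (\<Sum>i\<in>I. (sqrt l * Y i \<omega>)\<^sup>2) / 2))
      = (\<integral>g. exp (- (l * (\<Sum>i\<in>I. (g i)\<^sup>2)) / 2) \<partial>std_normal_vector I)"
    by simp
  moreover have "(\<Sum>i\<in>I. (sqrt l * Y i \<omega>)\<^sup>2) = l * (\<Sum>i\<in>I. (Y i \<omega>)\<^sup>2)" for \<omega>
    using assms by (simp add: power_mult_distrib sum_distrib_left)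
  moreover have "(\<integral>g. exp (- (l * (\<Sum>i\<in>I. (g i)\<^sup>2)) / 2) \<partial>std_normal_vector I)
      = (1 / sqrt (1 + l)) ^ card I"
    using assms nn_integral_std_normal_vector_exp_square[OF finite_index, of "- l"]
    by (subst integral_eq_nn_integral) (auto simp: finite_index)
  ultimately show ?thesis by simp
qed

text \<open>A Chernoff bound. The deviation is a multiple of \<open>n\<close>, not of
  \<open>card I\<close>, so that the bound is summable in \<open>n\<close> however small the index
  sets are.\<close>

lemma chi_square_upper_tail:
  fixes e :: real
  assumes "0 < e" "e \<le> 1" "card I \<le> n"
  shows "prob {\<omega> \<in> space M. card I + e * n \<le> (\<Sum>i\<in>I. (Y i \<omega>)\<^sup>2)} \<le> exp (- (e\<^sup>2 / 12)) ^ n"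
proof -
  \<comment> \<open>The first-order terms in \<open>l\<close> cancel up to the gain
    \<open>l * e * n / 2\<close>. With this \<open>l\<close> the exponent is at most
    \<open>n\<close> times \<open>e\<^sup>2 / 24 - e\<^sup>2 / 8\<close>, which equals
    \<open>- (e\<^sup>2 / 12)\<close>.\<close>
  define l where "l = e / 4"
  have l: "0 < l" "l \<le> 1/4" using assms by (auto simp: l_def)
  define S where "S \<omega> = (\<Sum>i\<in>I. (Y i \<omega>)\<^sup>2)" for \<omega>
  have [measurable]: "S \<in> borel_measurable M" unfolding S_def by simp
  have "ennreal (prob {\<omega> \<in> space M. card I + e * n \<le> S \<omega>})
      = emeasure M {\<omega> \<in> space M. 1 \<le> ennreal (exp (- l * (card I + e * n) / 2)) * ennreal (exp (l * S \<omega> / 2))}"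
  proof -
    have "1 \<le> ennreal (exp (- l * (card I + e * n) / 2)) * ennreal (exp (l * S \<omega> / 2)) \<longleftrightarrow> card I + e * n \<le> S \<omega>" for \<omega>
    proof -
      have "1 \<le> ennreal (exp (- l * (card I + e * n) / 2)) * ennreal (exp (l * S \<omega> / 2))
        \<longleftrightarrow> 1 \<le> exp (- l * (card I + e * n) / 2 + l * S \<omega> / 2)"
        unfolding exp_add by (simp add: ennreal_mult[symmetric])
      also have "\<dots> \<longleftrightarrow> 0 \<le> l * (S \<omega> - (card I + e * n))"
      proof -
        have "- l * (card I + e * n) / 2 + l * S \<omega> / 2 = l * (S \<omega> - (card I + e * n)) / 2"
          by (simp add: field_simps)
        then show ?thesis by (simp only: one_le_exp_iff) linarith
      qed
      finally show ?thesis using l by (simp add: zero_le_mult_iff)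
    qed
    then show ?thesis by (simp add: emeasure_eq_measure Int_def conj_commute)
  qed
  also have "\<dots> \<le> ennreal (exp (- l * (card I + e * n) / 2)) * (\<integral>\<^sup>+\<omega>. ennreal (exp (l * S \<omega> / 2)) * indicator (space M) \<omega> \<partial>M)"
    by (rule nn_integral_Markov_inequality) simp_all
  also have "(\<integral>\<^sup>+\<omega>. ennreal (exp (l * S \<omega> / 2)) * indicator (space M) \<omega> \<partial>M) = ennreal ((1 / sqrt (1 - l)) ^ card I)"
  proof -
    have "(\<integral>\<^sup>+\<omega>. ennreal (exp (l * S \<omega> / 2)) * indicator (space M) \<omega> \<partial>M) = (\<integral>\<^sup>+\<omega>. ennreal (exp (l * S \<omega> / 2)) \<partial>M)"
      by (intro nn_integral_cong) simp
    then show ?thesis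
      using nn_integral_exp_chi_square[of l] l by (simp add: S_def)
  qed
  also have "(1 / sqrt (1 - l)) ^ card I = exp (- ln (1 - l) * card I / 2)"
    using l by (intro inverse_sqrt_power) simp
  also have "ennreal (exp (- l * (card I + e * n) / 2)) * ennreal (exp (- ln (1 - l) * card I / 2))
      = ennreal (exp ((- l - ln (1 - l)) * card I / 2 - l * e * n / 2))"
    by (simp add: ennreal_mult[symmetric] exp_add[symmetric] field_simps)
  also have "\<dots> \<le> ennreal (exp (- (e\<^sup>2 / 12)) ^ n)"
  proof -
    have "- ln (1 - l) \<le> l / (1 - l)"
      using ln_le_minus_one[of "1 / (1 - l)"] l by (simp add: ln_div field_simps)
    then have "- l - ln (1 - l) \<le> l / (1 - l) - l" by simp
    also have "\<dots> = l\<^sup>2 / (1 - l)" using l by (simp add: field_simps power2_eq_square)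
    also have "\<dots> \<le> l\<^sup>2 / (3/4)" using l by (intro divide_left_mono) auto
    finally have A: "- l - ln (1 - l) \<le> e\<^sup>2 / 12" by (simp add: l_def power_divide)
    have "(- l - ln (1 - l)) * card I \<le> e\<^sup>2 / 12 * n"
      using A assms(3) by (intro mult_mono) auto
    moreover have "l * e * n / 2 = (e\<^sup>2 * n) / 8" "n * (- (e\<^sup>2 / 12)) = - (e\<^sup>2 * n) / 12"
      "e\<^sup>2 / 12 * n = (e\<^sup>2 * n) / 12"
      by (simp_all add: l_def power2_eq_square)
    ultimately have "(- l - ln (1 - l)) * card I / 2 - l * e * n / 2 \<le> n * (- (e\<^sup>2 / 12))"
      by linarith
    then show ?thesis by (simp add: exp_of_nat_mult[symmetric])
  qed
  finally show ?thesis by (simp add: S_def ennreal_le_iff)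
qed

lemma chi_square_lower_tail:
  fixes e :: real
  assumes "0 < e" "e \<le> 1" "card I \<le> n"
  shows "prob {\<omega> \<in> space M. (\<Sum>i\<in>I. (Y i \<omega>)\<^sup>2) \<le> card I - e * n} \<le> exp (- (e\<^sup>2 / 12)) ^ n"
proof -
  \<comment> \<open>The Laplace transform has no singularity for positive \<open>l\<close>, so
    \<open>l\<close> can be twice as large as for the upper tail. The resulting rate
    \<open>e\<^sup>2 / 8\<close> is weakened to that of the upper tail.\<close>
  define l where "l = e / 2"
  have l: "0 < l" "l \<le> 1/2" using assms by (auto simp: l_def)
  define S where "S \<omega> = (\<Sum>i\<in>I. (Y i \<omega>)\<^sup>2)" for \<omega>
  have [measurable]: "S \<in> borel_measurable M" unfolding S_def by simp
  have S0: "0 \<le> S \<omega>" for \<omega> by (simp add: S_def sum_nonneg)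
  have int: "integrable M (\<lambda>\<omega>. exp (- l * S \<omega> / 2))"
    by (rule integrable_const_bound[where B=1]) (use l S0 in auto)
  define c where "c = exp (- l * (card I - e * n) / 2)"
  have "c > 0" by (simp add: c_def)
  have "{\<omega> \<in> space M. S \<omega> \<le> card I - e * n} = {\<omega> \<in> space M. c \<le> exp (- l * S \<omega> / 2)}"
    using l by (auto simp: c_def)
  then have "prob {\<omega> \<in> space M. S \<omega> \<le> card I - e * n} \<le> expectation (\<lambda>\<omega>. exp (- l * S \<omega> / 2)) / c"
    using integral_Markov_inequality_measure[OF int, of "{}" c] \<open>c > 0\<close> by simp
  also have "expectation (\<lambda>\<omega>. exp (- l * S \<omega> / 2)) = (1 / sqrt (1 + l)) ^ card I"
    using laplace_chi_square[of l] l unfolding S_def by simp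
  also have "(1 / sqrt (1 + l)) ^ card I = exp (- ln (1 + l) * card I / 2)"
    using l by (intro inverse_sqrt_power) simp
  also have "exp (- ln (1 + l) * card I / 2) / c
      = exp ((l - ln (1 + l)) * card I / 2 - l * e * n / 2)"
    by (simp add: c_def exp_diff[symmetric] field_simps)
  also have "\<dots> \<le> exp (- (e\<^sup>2 / 12)) ^ n"
  proof -
    have "- ln (1 + l) \<le> 1 / (1 + l) - 1"
      using ln_le_minus_one[of "1 / (1 + l)"] l by (simp add: ln_div)
    then have "l - ln (1 + l) \<le> l\<^sup>2 / (1 + l)"
      using l by (simp add: field_simps power2_eq_square)
    also have "\<dots> \<le> l\<^sup>2 / 1" using l by (intro divide_left_mono) auto
    finally have A: "l - ln (1 + l) \<le> e\<^sup>2 / 4" by (simp add: l_def power_divide)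
    have "(l - ln (1 + l)) * card I \<le> e\<^sup>2 / 4 * n"
      using A assms(3) by (intro mult_mono) auto
    then have "(l - ln (1 + l)) * card I / 2 - l * e * n / 2 \<le> e\<^sup>2 * n / 8 - e\<^sup>2 * n / 4"
      by (simp add: l_def power2_eq_square)
    also have "\<dots> \<le> n * (- (e\<^sup>2 / 12))" by (simp add: field_simps)
    finally show ?thesis by (simp add: exp_of_nat_mult[symmetric])
  qed
  finally show ?thesis by (simp add: S_def)
qed

end

section \<open>The Ornstein--Uhlenbeck process and its innovations\<close>

text \<open>The error of predicting \<open>z q\<close> from \<open>z p\<close>, divided by its
  conditional standard deviation under the parameters \<open>\<theta>\<close> and
  \<open>v\<close>.\<close>

definition innovation :: "real \<Rightarrow> real \<Rightarrow> (real \<Rightarrow> real) \<Rightarrow> real \<Rightarrow> real \<Rightarrow> real" where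
  "innovation \<theta> v z p q = (z q - exp (- \<theta> * (q - p)) * z p) / sqrt (v * (1 - exp (- 2 * \<theta> * (q - p))))"

locale ornstein_uhlenbeck = prob_space +
  fixes \<theta>\<^sub>0 v\<^sub>0 :: real and Z :: "real \<Rightarrow> 'a \<Rightarrow> real"
  assumes rate_pos: "0 < \<theta>\<^sub>0" and variance_pos: "0 < v\<^sub>0"
    and ou: "ou_process M \<theta>\<^sub>0 v\<^sub>0 Z"
begin

lemma gaussian_process: "gaussian_process_on M {0..1} Z"
  using ou by (simp add: ou_process_def)

lemma mean_zero: "t \<in> {0..1} \<Longrightarrow> expectation (Z t) = 0"
  using ou by (simp add: ou_process_def)

lemma measurable_Z [measurable]: "t \<in> {0..1} \<Longrightarrow> Z t \<in> borel_measurable M"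
  using centered_gaussian_process_component(2)[OF gaussian_process mean_zero] by blast

lemma integrable_mult_Z: "p \<in> {0..1} \<Longrightarrow> q \<in> {0..1} \<Longrightarrow> integrable M (\<lambda>\<omega>. Z p \<omega> * Z q \<omega>)"
  using centered_gaussian_process_mult_integrable[OF gaussian_process mean_zero] by blast

lemma expectation_mult:
  assumes "p \<in> {0..1}" "q \<in> {0..1}"
  shows "expectation (\<lambda>\<omega>. Z p \<omega> * Z q \<omega>) = v\<^sub>0 * exp (- \<theta>\<^sub>0 * \<bar>p - q\<bar>)"
proof -
  have "covar M (Z p) (Z q) = v\<^sub>0 * exp (- \<theta>\<^sub>0 * \<bar>p - q\<bar>)"
    using ou assms unfolding ou_process_def by blast
  then show ?thesis using mean_zero assms by (simp add: covar_def)
qed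

lemma expectation_mult_le:
  assumes "p \<in> {0..1}" "q \<in> {0..1}" "p \<le> q"
  shows "expectation (\<lambda>\<omega>. Z p \<omega> * Z q \<omega>) = v\<^sub>0 * exp (- \<theta>\<^sub>0 * (q - p))"
  using expectation_mult[of p q] assms by (simp add: abs_if algebra_simps)

text \<open>The points \<open>x i\<close> may coincide, as the end points of adjacent intervals do,
  whereas \<open>gaussian_process_on\<close> speaks of sums over sets of times. Coefficients
  belonging to the same time are collected in \<open>C\<close>.\<close>

lemma centered_combination:
  fixes x :: "'i \<Rightarrow> real"
  assumes "finite I" and "x ` I \<subseteq> {0..1}"
  shows "gaussian_rv M (\<lambda>\<omega>. \<Sum>i\<in>I. c i * Z (x i) \<omega>)" (is ?g)
    and "expectation (\<lambda>\<omega>. \<Sum>i\<in>I. c i * Z (x i) \<omega>) = 0" (is ?e)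
    and "expectation (\<lambda>\<omega>. (\<Sum>i\<in>I. c i * Z (x i) \<omega>)\<^sup>2)
      = (\<Sum>i\<in>I. \<Sum>j\<in>I. c i * c j * (v\<^sub>0 * exp (- \<theta>\<^sub>0 * \<bar>x i - x j\<bar>)))" (is ?q)
proof -
  define C where "C t = (\<Sum>i | i \<in> I \<and> x i = t. c i)" for t
  have sum_eq: "(\<Sum>i\<in>I. c i * Z (x i) \<omega>) = (\<Sum>t\<in>x ` I. C t * Z t \<omega>)" for \<omega>
    unfolding C_def sum_distrib_right using assms(1)
    by (subst sum.image_gen[of I _ x]) (auto intro!: sum.cong)
  have "finite (x ` I)" using assms by simp
  from centered_gaussian_process_sum[of "{0..1}" Z "x ` I" C, OF gaussian_process mean_zero this assms(2)]
  show ?g ?e unfolding sum_eq by auto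
  have int: "integrable M (\<lambda>\<omega>. c i * c j * (Z (x i) \<omega> * Z (x j) \<omega>))" if "i \<in> I" "j \<in> I" for i j
    using that assms(2) by (intro integrable_mult_right integrable_mult_Z) auto
  have "expectation (\<lambda>\<omega>. (\<Sum>i\<in>I. c i * Z (x i) \<omega>)\<^sup>2)
      = expectation (\<lambda>\<omega>. \<Sum>i\<in>I. \<Sum>j\<in>I. c i * c j * (Z (x i) \<omega> * Z (x j) \<omega>))"
    by (simp add: power2_eq_square sum_product algebra_simps)
  also have "\<dots> = (\<Sum>i\<in>I. \<Sum>j\<in>I. c i * c j * expectation (\<lambda>\<omega>. Z (x i) \<omega> * Z (x j) \<omega>))"
    using int by (simp add: Bochner_Integration.integral_sum)
  also have "\<dots> = (\<Sum>i\<in>I. \<Sum>j\<in>I. c i * c j * (v\<^sub>0 * exp (- \<theta>\<^sub>0 * \<bar>x i - x j\<bar>)))"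
    using assms by (intro sum.cong refl arg_cong2[where f="(*)"] expectation_mult) auto
  finally show ?q .
qed

lemma innovation_variance_pos:
  "p < q \<Longrightarrow> 0 < v\<^sub>0 * (1 - exp (- 2 * \<theta>\<^sub>0 * (q - p)))"
  using rate_pos variance_pos by simp

lemma innovations_orthonormal:
  assumes "p \<in> {0..1}" "q \<in> {0..1}" "p' \<in> {0..1}" "q' \<in> {0..1}" "p < q" "p' < q'"
    and sep: "(p = p' \<and> q = q') \<or> q \<le> p'"
  shows "expectation (\<lambda>\<omega>. innovation \<theta>\<^sub>0 v\<^sub>0 (\<lambda>t. Z t \<omega>) p q * innovation \<theta>\<^sub>0 v\<^sub>0 (\<lambda>t. Z t \<omega>) p' q')
    = (if p = p' \<and> q = q' then 1 else 0)"
proof -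
  define r where "r = exp (- \<theta>\<^sub>0 * (q - p))"
  define r' where "r' = exp (- \<theta>\<^sub>0 * (q' - p'))"
  define V where "V = v\<^sub>0 * (1 - exp (- 2 * \<theta>\<^sub>0 * (q - p)))"
  define V' where "V' = v\<^sub>0 * (1 - exp (- 2 * \<theta>\<^sub>0 * (q' - p')))"
  note I = integrable_mult_Z[OF assms(2,4)] integrable_mult_Z[OF assms(2,3)]
    integrable_mult_Z[OF assms(1,4)] integrable_mult_Z[OF assms(1,3)]
  have "expectation (\<lambda>\<omega>. innovation \<theta>\<^sub>0 v\<^sub>0 (\<lambda>t. Z t \<omega>) p q * innovation \<theta>\<^sub>0 v\<^sub>0 (\<lambda>t. Z t \<omega>) p' q')
      = expectation (\<lambda>\<omega>. (Z q \<omega> * Z q' \<omega> - r' * (Z q \<omega> * Z p' \<omega>) - r * (Z p \<omega> * Z q' \<omega>) + r * r' * (Z p \<omega> * Z p' \<omega>))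
        / (sqrt V * sqrt V'))"
    by (simp add: innovation_def r_def r'_def V_def V'_def algebra_simps)
  also have "\<dots> = (expectation (\<lambda>\<omega>. Z q \<omega> * Z q' \<omega>) - r' * expectation (\<lambda>\<omega>. Z q \<omega> * Z p' \<omega>)
      - r * expectation (\<lambda>\<omega>. Z p \<omega> * Z q' \<omega>) + r * r' * expectation (\<lambda>\<omega>. Z p \<omega> * Z p' \<omega>)) / (sqrt V * sqrt V')"
    using I by simp
  also have "\<dots> = (if p = p' \<and> q = q' then 1 else 0)"
  proof (cases "p = p' \<and> q = q'")
    case True
    have e: "exp (- 2 * \<theta>\<^sub>0 * (q - p)) = r * r"
      by (simp add: r_def exp_add[symmetric])
    have E: "expectation (\<lambda>\<omega>. Z q \<omega> * Z p \<omega>) = v\<^sub>0 * r" "expectation (\<lambda>\<omega>. Z p \<omega> * Z q \<omega>) = v\<^sub>0 * r"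
      "expectation (\<lambda>\<omega>. Z p \<omega> * Z p \<omega>) = v\<^sub>0" "expectation (\<lambda>\<omega>. Z q \<omega> * Z q \<omega>) = v\<^sub>0"
      using expectation_mult_le[of p q] expectation_mult_le[of p p] expectation_mult_le[of q q] assms
      by (simp_all add: r_def mult.commute)
    have T: "p' = p" "q' = q" "r' = r" "V' = V"
      using True by (simp_all add: r_def r'_def V_def V'_def)
    have pos: "0 < V"
      using innovation_variance_pos[OF \<open>p < q\<close>] by (simp add: V_def)
    then have den: "sqrt V * sqrt V = V" by simp
    have num: "v\<^sub>0 - r * (v\<^sub>0 * r) - r * (v\<^sub>0 * r) + r * r * v\<^sub>0 = V"
      unfolding V_def e by (simp add: algebra_simps)
    show ?thesis unfolding T E num den using pos by simp
  next
    case False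
    then have le: "q \<le> p'" using sep by blast
    \<comment> \<open>The Markov property in terms of covariances: the prediction error over the
      later interval is orthogonal to \<open>Z x\<close> for each \<open>x \<le> p'\<close>, in
      particular for \<open>p\<close> and \<open>q\<close>.\<close>
    have "exp (- \<theta>\<^sub>0 * (q' - x)) = r' * exp (- \<theta>\<^sub>0 * (p' - x))" for x
      by (simp add: r'_def exp_add[symmetric] algebra_simps)
    then have "expectation (\<lambda>\<omega>. Z q \<omega> * Z q' \<omega>) = r' * expectation (\<lambda>\<omega>. Z q \<omega> * Z p' \<omega>)"
      "expectation (\<lambda>\<omega>. Z p \<omega> * Z q' \<omega>) = r' * expectation (\<lambda>\<omega>. Z p \<omega> * Z p' \<omega>)"
      using assms le by (simp_all add: expectation_mult_le)
    then show ?thesis using False by auto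
  qed
  finally show ?thesis .
qed

lemma orthonormal_innovations:
  fixes p q :: "'i \<Rightarrow> real"
  assumes I: "finite I" and pq: "\<And>i. i \<in> I \<Longrightarrow> p i \<in> {0..1} \<and> q i \<in> {0..1} \<and> p i < q i"
    and disj: "\<And>i j. i \<in> I \<Longrightarrow> j \<in> I \<Longrightarrow> i \<noteq> j \<Longrightarrow> q i \<le> p j \<or> q j \<le> p i"
  shows "orthonormal_gaussian M I (\<lambda>i \<omega>. innovation \<theta>\<^sub>0 v\<^sub>0 (\<lambda>t. Z t \<omega>) (p i) (q i))"
proof
  let ?Y = "\<lambda>i \<omega>. innovation \<theta>\<^sub>0 v\<^sub>0 (\<lambda>t. Z t \<omega>) (p i) (q i)"
  let ?s = "\<lambda>i. sqrt (v\<^sub>0 * (1 - exp (- 2 * \<theta>\<^sub>0 * (q i - p i))))"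
  let ?r = "\<lambda>i. exp (- \<theta>\<^sub>0 * (q i - p i))"
  \<comment> \<open>An innovation involves two values of the process. The Boolean selects the right
    or the left end point, which makes the sum a single combination indexed by
    \<open>UNIV \<times> F\<close>.\<close>
  have rep: "(\<Sum>i\<in>F. c i * ?Y i \<omega>)
      = (\<Sum>(b, i)\<in>UNIV \<times> F. (if b then c i / ?s i else - c i * ?r i / ?s i) * Z (if b then q i else p i) \<omega>)"
    if "finite F" for F c \<omega>
    using that
    by (simp add: sum.cartesian_product[symmetric] UNIV_bool innovation_def sum.distrib[symmetric])
      (intro sum.cong, auto simp: right_diff_distrib diff_divide_distrib)
  note * = centered_combination[of "UNIV \<times> F" "\<lambda>(b, i). if b then q i else p i"
      "\<lambda>(b, i). if b then c i / ?s i else - c i * ?r i / ?s i" for F c]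
  have **: "gaussian_rv M (\<lambda>\<omega>. \<Sum>i\<in>F. c i * ?Y i \<omega>)"
    "expectation (\<lambda>\<omega>. \<Sum>i\<in>F. c i * ?Y i \<omega>) = 0" if F: "F \<subseteq> I" for F c
  proof -
    have fin: "finite F" using F I finite_subset by auto
    have sub: "(\<lambda>(b, i). if b then q i else p i) ` (UNIV \<times> F) \<subseteq> {0..1}"
      using F pq by (auto split: if_splits)
    show "gaussian_rv M (\<lambda>\<omega>. \<Sum>i\<in>F. c i * ?Y i \<omega>)"
      "expectation (\<lambda>\<omega>. \<Sum>i\<in>F. c i * ?Y i \<omega>) = 0"
      using *(1,2)[OF _ sub] fin by (simp_all add: rep[OF fin] split_beta)
  qed
  show "finite I" by fact
  show "gaussian_process_on M I ?Y"
    using ** by (simp add: gaussian_process_on_def)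
  show "expectation (?Y i) = 0" if "i \<in> I" for i
    using **(2)[of "{i}" "\<lambda>_. 1"] that by simp
  show "expectation (\<lambda>\<omega>. ?Y i \<omega> * ?Y j \<omega>) = (if i = j then 1 else 0)" if "i \<in> I" "j \<in> I" for i j
  proof (cases "i = j \<or> q i \<le> p j")
    case True
    then show ?thesis
      using innovations_orthonormal[of "p i" "q i" "p j" "q j"] pq[OF that(1)] pq[OF that(2)] by force
  next
    case False
    then show ?thesis
      using innovations_orthonormal[of "p j" "q j" "p i" "q i"] pq[OF that(1)] pq[OF that(2)]
        disj[OF that] by (auto simp: mult.commute)
  qed
qed

end

section \<open>A strong law for the triangular array of innovations\<close>

lemma observation_pointsD:
  assumes "observation_points s" "1 \<le> i" "i < j" "j \<le> n"
  shows "s n i \<in> {0..1}" "s n j \<in> {0..1}" "s n i < s n j"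
proof -
  have "s n ` {1..n} \<subseteq> {0..1}" "strict_mono_on {1..n} (s n)"
    using assms(1) unfolding observation_points_def by blast+
  then show "s n i \<in> {0..1}" "s n j \<in> {0..1}" "s n i < s n j"
    using assms by (auto simp: strict_mono_on_def image_subset_iff)
qed

text \<open>Intervals of lag \<open>k\<close> overlap, but those whose indices agree modulo
  \<open>k\<close> do not. As the rows of the array are unrelated, almost sure convergence comes
  from tails summable in \<open>n\<close>, with all \<open>k\<close> classes measured on the common
  scale \<open>n\<close>.\<close>

lemma (in ornstein_uhlenbeck) innovations_strong_law:
  assumes obs: "observation_points s" and k: "1 \<le> k"
  shows "AE \<omega> in M. (\<lambda>n. ((\<Sum>i = 1..n - k. (innovation \<theta>\<^sub>0 v\<^sub>0 (\<lambda>t. Z t \<omega>) (s n i) (s n (i + k)))\<^sup>2)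
    - real (n - k)) / n) \<longlonglongrightarrow> 0"
proof -
  define Y where "Y n i \<omega> = innovation \<theta>\<^sub>0 v\<^sub>0 (\<lambda>t. Z t \<omega>) (s n i) (s n (i + k))" for n i \<omega>
  define I where "I n r = {i \<in> {1..n - k}. i mod k = r}" for n r
  define S where "S n r \<omega> = (\<Sum>i\<in>I n r. (Y n i \<omega>)\<^sup>2)" for n r \<omega>
  have fin: "finite (I n r)" for n r by (simp add: I_def)
  have cardI: "card (I n r) \<le> n" for n r
  proof -
    have "card (I n r) \<le> card {1..n - k}" by (intro card_mono) (auto simp: I_def)
    then show ?thesis by simp
  qed
  have orth: "orthonormal_gaussian M (I n r) (Y n)" for n r
    unfolding Y_def
  proof (rule orthonormal_innovations)
    show "finite (I n r)" by fact
    show "s n i \<in> {0..1} \<and> s n (i + k) \<in> {0..1} \<and> s n i < s n (i + k)" if "i \<in> I n r" for i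
      using observation_pointsD[OF obs, of i "i + k" n] that k by (auto simp: I_def)
    have le: "s n (i + k) \<le> s n j" if "i \<in> I n r" "j \<in> I n r" "i < j" for i j
    proof -
      have "k dvd j - i"
        using that by (auto simp: I_def mod_eq_dvd_iff_nat)
      then have "i + k \<le> j"
        using that by (auto dest!: dvd_imp_le)
      moreover have "j \<le> n" using that by (auto simp: I_def)
      ultimately show ?thesis
        using observation_pointsD(3)[OF obs, of "i + k" j n] that by (cases "i + k = j") (auto simp: I_def)
    qed
    show "s n (i + k) \<le> s n j \<or> s n (j + k) \<le> s n i" if "i \<in> I n r" "j \<in> I n r" "i \<noteq> j" for i j
      using le[of i j] le[of j i] that by (cases "i < j") auto
  qed
  have ev: "AE \<omega> in M. \<forall>\<^sub>F n in sequentially. \<bar>S n r \<omega> - card (I n r)\<bar> < e * n"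
    if e: "0 < e" "e \<le> 1" for e :: real and r
  proof -
    define q where "q = exp (- (e\<^sup>2 / 12))"
    have q: "0 < q" "q < 1" using e by (auto simp: q_def)
    have meas [measurable]: "S n r \<in> borel_measurable M" for n
      unfolding S_def using orthonormal_gaussian.measurable_component[OF orth, of _ n r] by measurable
    have "AE \<omega> in M. eventually (\<lambda>n. \<omega> \<in> space M - {\<omega> \<in> space M. e * n \<le> \<bar>S n r \<omega> - card (I n r)\<bar>}) sequentially"
    proof (rule borel_cantelli_AE1)
      have "prob {\<omega> \<in> space M. e * n \<le> \<bar>S n r \<omega> - card (I n r)\<bar>} \<le> 2 * q ^ n" for n
      proof -
        have "prob {\<omega> \<in> space M. e * n \<le> \<bar>S n r \<omega> - card (I n r)\<bar>}
            \<le> prob ({\<omega> \<in> space M. card (I n r) + e * n \<le> S n r \<omega>} \<union> {\<omega> \<in> space M. S n r \<omega> \<le> card (I n r) - e * n})"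
          by (intro finite_measure_mono) auto
        also have "\<dots> \<le> prob {\<omega> \<in> space M. card (I n r) + e * n \<le> S n r \<omega>} + prob {\<omega> \<in> space M. S n r \<omega> \<le> card (I n r) - e * n}"
          by (intro measure_Un_le) measurable
        also have "\<dots> \<le> q ^ n + q ^ n"
          unfolding S_def q_def
          using orthonormal_gaussian.chi_square_upper_tail[OF orth e cardI, of n r]
            orthonormal_gaussian.chi_square_lower_tail[OF orth e cardI, of n r]
          by (intro add_mono)
        finally show ?thesis by simp
      qed
      then show "summable (\<lambda>n. prob {\<omega> \<in> space M. e * n \<le> \<bar>S n r \<omega> - card (I n r)\<bar>})"
        using q by (intro summable_comparison_test[OF _ summable_mult[OF summable_geometric[of q]]])
          (auto intro!: exI[of _ 0])
    qed (auto simp: emeasure_eq_measure)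
    then show ?thesis
      by eventually_elim (auto elim!: eventually_mono simp: not_le)
  qed
  have "AE \<omega> in M. \<forall>m. \<forall>r\<in>{..<k}. \<forall>\<^sub>F n in sequentially. \<bar>S n r \<omega> - card (I n r)\<bar> < 1 / Suc m * n"
    by (simp only: AE_all_countable AE_finite_all finite_lessThan) (intro allI ballI ev, simp_all)
  then show ?thesis
  proof eventually_elim
    case (elim \<omega>)
    have decomp: "(\<Sum>i = 1..n - k. (Y n i \<omega>)\<^sup>2) - real (n - k) = (\<Sum>r<k. S n r \<omega> - card (I n r))" for n
    proof -
      have "sum f {1..n - k} = (\<Sum>r<k. sum f (I n r))" for f :: "nat \<Rightarrow> real"
        unfolding I_def using k by (subst sum.group) auto
      from this[of "\<lambda>i. (Y n i \<omega>)\<^sup>2 - 1"] show ?thesis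
        by (simp add: S_def sum_subtractf)
    qed
    show ?case
      unfolding Y_def[symmetric]
    proof (rule LIMSEQ_I)
      fix x :: real assume "0 < x"
      obtain m where m: "k / x < Suc m"
        using reals_Archimedean2[of "k / x"] by (meson less_trans of_nat_less_iff lessI)
      then have m: "k / real (Suc m) < x" using \<open>0 < x\<close> by (simp add: field_simps)
      have "\<forall>\<^sub>F n in sequentially. \<forall>r\<in>{..<k}. \<bar>S n r \<omega> - card (I n r)\<bar> < 1 / Suc m * n"
        using elim by (subst eventually_ball_finite_distrib) auto
      then have "\<forall>\<^sub>F n in sequentially. \<bar>((\<Sum>i = 1..n - k. (Y n i \<omega>)\<^sup>2) - real (n - k)) / n\<bar> < x"
        using eventually_gt_at_top[of 0]
      proof eventually_elim
        case (elim n)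
        have "\<bar>(\<Sum>r<k. S n r \<omega> - card (I n r))\<bar> \<le> (\<Sum>r<k. 1 / Suc m * n)"
          using elim(1) by (intro order_trans[OF sum_abs] sum_mono) (auto intro: less_imp_le)
        also have "\<dots> = k / Suc m * n" by simp
        also have "\<dots> < x * n" using m elim(2) by (intro mult_strict_right_mono) auto
        finally show ?case using elim(2) unfolding decomp by (simp add: abs_divide field_simps)
      qed
      then show "\<exists>no. \<forall>n\<ge>no. norm (((\<Sum>i = 1..n - k. (Y n i \<omega>)\<^sup>2) - real (n - k)) / n - 0) < x"
        by (simp add: eventually_sequentially)
    qed
  qed
qed

section \<open>Elementary estimates for the pair contributions\<close>

text \<open>This is \<open>x \<le> sinh x\<close>, multiplied by \<open>exp (- x)\<close>.\<close>

lemma exp_uminus_lower: "x * exp (- x) \<le> (1 - exp (- 2 * x)) / 2" if "0 \<le> x" for x :: real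
proof -
  have "x \<le> (exp x - inverse (exp x)) / 2"
    using that by (rule real_le_x_sinh)
  then have "x * exp (- x) \<le> (exp x - inverse (exp x)) / 2 * exp (- x)"
    by (intro mult_right_mono) auto
  also have "\<dots> = (1 - exp (- 2 * x)) / 2"
    by (simp add: exp_minus[symmetric] left_diff_distrib exp_add[symmetric])
  finally show ?thesis .
qed

lemma exp_diff_le:
  fixes x y :: real
  assumes "0 \<le> x" "0 \<le> y"
  shows "\<bar>exp (- x) - exp (- y)\<bar> \<le> \<bar>x - y\<bar>"
proof -
  have *: "exp (- x) - exp (- y) \<le> y - x" if "0 \<le> x" "x \<le> y" for x y :: real
  proof -
    have "exp (- x) - exp (- y) = exp (- x) * (1 - exp (x - y))"
      by (simp add: algebra_simps exp_add[symmetric])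
    also have "\<dots> \<le> 1 * (1 - exp (x - y))"
      using that by (intro mult_right_mono) auto
    also have "\<dots> \<le> y - x"
    proof -
      have "1 * (1 - e) \<le> y - x" if "1 + (x - y) \<le> e" for e
        using that by simp
      then show ?thesis using exp_ge_add_one_self by blast
    qed
    finally show ?thesis .
  qed
  show ?thesis
    using *[of x y] *[of y x] assms by (cases "x \<le> y") (auto simp: abs_if)
qed

lemma one_minus_exp_bounds:
  fixes x :: real
  assumes "0 < x"
  shows "2 * x * exp (- x) \<le> 1 - exp (- 2 * x)" "1 - exp (- 2 * x) \<le> 2 * x" "0 < 1 - exp (- 2 * x)"
  using exp_uminus_lower[of x] exp_ge_add_one_self[of "- 2 * x"] assms by auto

text \<open>Each logarithm lies between \<open>ln (2 * x) - x\<close> and \<open>ln (2 * x)\<close>.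
  The error is linear in the gap once \<open>x\<close> and \<open>y\<close> are rates times a
  gap.\<close>

lemma ln_one_minus_exp_ratio:
  fixes x y :: real
  assumes "0 < x" "0 < y"
  shows "\<bar>ln (1 - exp (- 2 * x)) - ln (1 - exp (- 2 * y)) - ln (x / y)\<bar> \<le> x + y"
proof -
  have *: "ln (2 * x) - x \<le> ln (1 - exp (- 2 * x))" "ln (1 - exp (- 2 * x)) \<le> ln (2 * x)" if "0 < x" for x :: real
  proof -
    have "ln (2 * x * exp (- x)) \<le> ln (1 - exp (- 2 * x))"
      using one_minus_exp_bounds[OF that] that by (intro ln_mono) auto
    then show "ln (2 * x) - x \<le> ln (1 - exp (- 2 * x))"
      using that by (simp add: ln_mult)
    show "ln (1 - exp (- 2 * x)) \<le> ln (2 * x)"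
      using one_minus_exp_bounds[OF that] that by (intro ln_mono) auto
  qed
  have "ln (x / y) = ln (2 * x) - ln (2 * y)" using assms by (simp add: ln_div ln_mult)
  then show ?thesis using *[OF assms(1)] *[OF assms(2)] assms by linarith
qed

text \<open>The bounds \<open>2 * x * exp (- x) \<le> 1 - exp (- 2 * x) \<le> 2 * x\<close> confine
  the ratio between \<open>\<theta>\<^sub>0 / \<theta>\<close> times
  \<open>exp (- \<theta>\<^sub>0 * D)\<close> and \<open>\<theta>\<^sub>0 / \<theta>\<close> times
  \<open>exp (\<theta> * D)\<close>; both exponentials differ from 1 by a multiple of
  \<open>D\<close>.\<close>

lemma variance_ratio_bound:
  fixes \<theta> \<theta>\<^sub>0 D :: real
  assumes "0 < \<theta>" "0 < \<theta>\<^sub>0" "0 < D"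
  shows "\<bar>(1 - exp (- 2 * \<theta>\<^sub>0 * D)) / (1 - exp (- 2 * \<theta> * D)) - \<theta>\<^sub>0 / \<theta>\<bar>
    \<le> \<theta>\<^sub>0 / \<theta> * ((\<theta>\<^sub>0 + \<theta> * exp (\<theta> * D)) * D)" (is "\<bar>?q - _\<bar> \<le> _")
proof -
  let ?E = "\<lambda>\<theta>. 1 - exp (- 2 * \<theta> * D)"
  have E0: "2 * (\<theta>\<^sub>0 * D) * exp (- (\<theta>\<^sub>0 * D)) \<le> ?E \<theta>\<^sub>0" "?E \<theta>\<^sub>0 \<le> 2 * (\<theta>\<^sub>0 * D)" "0 < ?E \<theta>\<^sub>0"
    using one_minus_exp_bounds[of "\<theta>\<^sub>0 * D"] assms by (simp_all add: mult.assoc)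
  have E: "2 * (\<theta> * D) * exp (- (\<theta> * D)) \<le> ?E \<theta>" "?E \<theta> \<le> 2 * (\<theta> * D)" "0 < ?E \<theta>"
    using one_minus_exp_bounds[of "\<theta> * D"] assms by (simp_all add: mult.assoc)
  have lower: "\<theta>\<^sub>0 / \<theta> * exp (- (\<theta>\<^sub>0 * D)) \<le> ?q"
  proof -
    have "\<theta>\<^sub>0 / \<theta> * exp (- (\<theta>\<^sub>0 * D)) = (2 * (\<theta>\<^sub>0 * D) * exp (- (\<theta>\<^sub>0 * D))) / (2 * (\<theta> * D))"
      using assms by simp
    also have "\<dots> \<le> ?q" using E0 E assms by (intro frac_le) auto
    finally show ?thesis .
  qed
  have upper: "?q \<le> \<theta>\<^sub>0 / \<theta> * exp (\<theta> * D)"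
  proof -
    have "?q \<le> (2 * (\<theta>\<^sub>0 * D)) / (2 * (\<theta> * D) * exp (- (\<theta> * D)))"
      using E0 E assms by (intro frac_le) auto
    also have "\<dots> = \<theta>\<^sub>0 / \<theta> * exp (\<theta> * D)" using assms by (simp add: exp_minus field_simps)
    finally show ?thesis .
  qed
  have "1 - \<theta>\<^sub>0 * D \<le> exp (- (\<theta>\<^sub>0 * D))" using exp_ge_add_one_self[of "- (\<theta>\<^sub>0 * D)"] by simp
  then have l: "\<theta>\<^sub>0 / \<theta> - \<theta>\<^sub>0 / \<theta> * (\<theta>\<^sub>0 * D) \<le> ?q"
    using lower assms mult_left_mono[of "1 - \<theta>\<^sub>0 * D" "exp (- (\<theta>\<^sub>0 * D))" "\<theta>\<^sub>0 / \<theta>"]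
    by (simp add: right_diff_distrib)
  have "exp (\<theta> * D) * (1 - \<theta> * D) \<le> exp (\<theta> * D) * exp (- (\<theta> * D))"
    using exp_ge_add_one_self[of "- (\<theta> * D)"] by (intro mult_left_mono) auto
  then have "exp (\<theta> * D) \<le> 1 + \<theta> * exp (\<theta> * D) * D"
    by (simp add: exp_minus algebra_simps)
  then have u: "?q \<le> \<theta>\<^sub>0 / \<theta> + \<theta>\<^sub>0 / \<theta> * (\<theta> * exp (\<theta> * D) * D)"
    using upper assms mult_left_mono[of "exp (\<theta> * D)" "1 + \<theta> * exp (\<theta> * D) * D" "\<theta>\<^sub>0 / \<theta>"]
    by (simp add: distrib_left)
  have "0 \<le> \<theta>\<^sub>0 / \<theta> * (\<theta>\<^sub>0 * D)" "0 \<le> \<theta>\<^sub>0 / \<theta> * (\<theta> * exp (\<theta> * D) * D)"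
    using assms by auto
  then show ?thesis
    using l u by (simp add: abs_le_iff distrib_left distrib_right)
qed

text \<open>The last summand of \<open>pair_loglik\<close> times the variance parameter, as a
  function of the gap. At the true rate, divided by the true variance, it is the squared
  innovation.\<close>

definition normalized_residual :: "real \<Rightarrow> real \<Rightarrow> real \<Rightarrow> real \<Rightarrow> real" where
  "normalized_residual \<theta> D x y = (y - exp (- \<theta> * D) * x)\<^sup>2 / (1 - exp (- 2 * \<theta> * D))"

lemma normalized_residual_nonneg:
  "0 < \<theta> \<Longrightarrow> 0 < D \<Longrightarrow> 0 \<le> normalized_residual \<theta> D x y"
  by (simp add: normalized_residual_def)

text \<open>Predicting with the wrong rate shifts the residual by a quantity of order
  \<open>D\<close>. Its square is of order \<open>D\<^sup>2\<close>, and division by a variance of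
  order \<open>D\<close> leaves an error linear in the gap.\<close>

lemma residual_remainder_bound:
  fixes \<theta> \<theta>\<^sub>0 D x B :: real
  assumes "0 < \<theta>" "0 < \<theta>\<^sub>0" "0 < D" "\<bar>x\<bar> \<le> B"
  shows "((exp (- \<theta>\<^sub>0 * D) - exp (- \<theta> * D)) * x)\<^sup>2 / (1 - exp (- 2 * \<theta> * D))
    \<le> B\<^sup>2 * (\<theta>\<^sub>0 - \<theta>)\<^sup>2 * exp (\<theta> * D) * D / (2 * \<theta>)"
proof -
  let ?E = "1 - exp (- 2 * \<theta> * D)"
  have E: "2 * (\<theta> * D) * exp (- (\<theta> * D)) \<le> ?E" "0 < ?E"
    using one_minus_exp_bounds[of "\<theta> * D"] assms by (simp_all add: mult.assoc)
  have "\<bar>exp (- \<theta>\<^sub>0 * D) - exp (- \<theta> * D)\<bar> \<le> \<bar>(\<theta>\<^sub>0 - \<theta>) * D\<bar>"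
    using exp_diff_le[of "\<theta>\<^sub>0 * D" "\<theta> * D"] assms by (simp add: left_diff_distrib)
  then have "\<bar>(exp (- \<theta>\<^sub>0 * D) - exp (- \<theta> * D)) * x\<bar> \<le> \<bar>(\<theta>\<^sub>0 - \<theta>) * D * B\<bar>"
    unfolding abs_mult using assms(4) by (intro mult_mono) (auto simp: abs_mult)
  then have "((exp (- \<theta>\<^sub>0 * D) - exp (- \<theta> * D)) * x)\<^sup>2 \<le> ((\<theta>\<^sub>0 - \<theta>) * D * B)\<^sup>2"
    by (simp only: abs_le_square_iff)
  then have "((exp (- \<theta>\<^sub>0 * D) - exp (- \<theta> * D)) * x)\<^sup>2 / ?E
      \<le> ((\<theta>\<^sub>0 - \<theta>) * D * B)\<^sup>2 / (2 * (\<theta> * D) * exp (- (\<theta> * D)))"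
    using E assms by (intro frac_le) auto
  also have "\<dots> = B\<^sup>2 * (\<theta>\<^sub>0 - \<theta>)\<^sup>2 * exp (\<theta> * D) * D / (2 * \<theta>)"
    using assms by (simp add: exp_minus field_simps power2_eq_square)
  finally show ?thesis .
qed

text \<open>The comparison on compact sets of rates degenerates near 0. There a lower bound of the
  right order \<open>1 / \<theta>\<close> is enough, as it serves only to exclude small rates from
  an unbounded parameter set.\<close>

lemma normalized_residual_lower:
  fixes \<theta> \<theta>\<^sub>0 v\<^sub>0 D x B :: real
  assumes "0 < \<theta>" "\<theta> \<le> \<theta>\<^sub>0" "0 < v\<^sub>0" "0 < D" "D \<le> 1" "\<bar>x\<bar> \<le> B"
  shows "(\<theta>\<^sub>0 * v\<^sub>0 * exp (- \<theta>\<^sub>0) / 2 * (normalized_residual \<theta>\<^sub>0 D x y / v\<^sub>0) - B\<^sup>2 * \<theta>\<^sub>0\<^sup>2 * exp \<theta>\<^sub>0 / 2 * D) / \<theta>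
    \<le> normalized_residual \<theta> D x y"
proof -
  let ?E = "\<lambda>\<theta>. 1 - exp (- 2 * \<theta> * D)"
  define e where "e = y - exp (- \<theta>\<^sub>0 * D) * x"
  define r where "r = (exp (- \<theta>\<^sub>0 * D) - exp (- \<theta> * D)) * x"
  define N where "N = normalized_residual \<theta>\<^sub>0 D x y"
  have E0: "2 * (\<theta>\<^sub>0 * D) * exp (- (\<theta>\<^sub>0 * D)) \<le> ?E \<theta>\<^sub>0" "0 < ?E \<theta>\<^sub>0"
    using one_minus_exp_bounds[of "\<theta>\<^sub>0 * D"] assms by (simp_all add: mult.assoc)
  have E: "?E \<theta> \<le> 2 * (\<theta> * D)" "0 < ?E \<theta>"
    using one_minus_exp_bounds[of "\<theta> * D"] assms by (simp_all add: mult.assoc)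
  have "N \<ge> 0" using assms by (simp add: N_def normalized_residual_nonneg)
  have e2: "e\<^sup>2 = N * ?E \<theta>\<^sub>0"
    using E0(2) unfolding N_def normalized_residual_def e_def by (metis less_irrefl nonzero_eq_divide_eq)
  \<comment> \<open>The residual at \<open>\<theta>\<close> is \<open>e + r\<close>; half of
    \<open>e\<^sup>2\<close> is sacrificed to absorb the cross term.\<close>
  have sq: "(y - exp (- \<theta> * D) * x)\<^sup>2 \<ge> e\<^sup>2 / 2 - r\<^sup>2"
  proof -
    have "(y - exp (- \<theta> * D) * x)\<^sup>2 - (e\<^sup>2 / 2 - r\<^sup>2) = (e + 2 * r)\<^sup>2 / 2"
      by (simp add: e_def r_def power2_eq_square field_simps)
    then show ?thesis by (smt (verit) zero_le_power2 divide_nonneg_nonneg)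
  qed
  have "normalized_residual \<theta> D x y \<ge> e\<^sup>2 / ?E \<theta> / 2 - r\<^sup>2 / ?E \<theta>"
  proof -
    have "e\<^sup>2 / ?E \<theta> / 2 - r\<^sup>2 / ?E \<theta> = (e\<^sup>2 / 2 - r\<^sup>2) / ?E \<theta>"
      by (simp only: diff_divide_distrib divide_divide_eq_left mult.commute)
    also have "\<dots> \<le> (y - exp (- \<theta> * D) * x)\<^sup>2 / ?E \<theta>"
      using E sq by (intro divide_right_mono) auto
    finally show ?thesis by (simp only: normalized_residual_def)
  qed
  moreover have "r\<^sup>2 / ?E \<theta> \<le> B\<^sup>2 * \<theta>\<^sub>0\<^sup>2 * exp \<theta>\<^sub>0 / 2 * D / \<theta>"
  proof -
    have "r\<^sup>2 / ?E \<theta> \<le> B\<^sup>2 * (\<theta>\<^sub>0 - \<theta>)\<^sup>2 * exp (\<theta> * D) * D / (2 * \<theta>)"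
      unfolding r_def using assms by (intro residual_remainder_bound) auto
    also have "\<dots> \<le> B\<^sup>2 * \<theta>\<^sub>0\<^sup>2 * exp \<theta>\<^sub>0 * D / (2 * \<theta>)"
    proof -
      have "\<theta> * D \<le> \<theta>\<^sub>0 * 1" using assms by (intro mult_mono) auto
      then show ?thesis
        using assms by (intro divide_right_mono mult_right_mono mult_mono power_mono) auto
    qed
    finally show ?thesis by simp
  qed
  moreover have "e\<^sup>2 / ?E \<theta> \<ge> \<theta>\<^sub>0 * exp (- \<theta>\<^sub>0) * N / \<theta>"
  proof -
    have "\<theta>\<^sub>0 * exp (- \<theta>\<^sub>0) * N / \<theta> = N * (2 * (\<theta>\<^sub>0 * D) * exp (- \<theta>\<^sub>0)) / (2 * (\<theta> * D))"
      using assms by simp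
    also have "\<dots> \<le> N * ?E \<theta>\<^sub>0 / ?E \<theta>"
    proof (intro frac_le mult_left_mono)
      have "exp (- \<theta>\<^sub>0) \<le> exp (- (\<theta>\<^sub>0 * D))" using assms by simp
      then have "2 * (\<theta>\<^sub>0 * D) * exp (- \<theta>\<^sub>0) \<le> 2 * (\<theta>\<^sub>0 * D) * exp (- (\<theta>\<^sub>0 * D))"
        using assms by (intro mult_left_mono) auto
      then show "2 * (\<theta>\<^sub>0 * D) * exp (- \<theta>\<^sub>0) \<le> ?E \<theta>\<^sub>0" using E0 by linarith
    qed (use \<open>N \<ge> 0\<close> E E0 in auto)
    finally show ?thesis unfolding e2 .
  qed
  moreover have "t / 2 - u \<le> n" if "p / 2 - q \<le> n" "q \<le> u" "t \<le> p" for n p q t u :: real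
    using that by linarith
  ultimately have "\<theta>\<^sub>0 * exp (- \<theta>\<^sub>0) * N / \<theta> / 2 - B\<^sup>2 * \<theta>\<^sub>0\<^sup>2 * exp \<theta>\<^sub>0 / 2 * D / \<theta> \<le> normalized_residual \<theta> D x y"
    by blast
  moreover have "(\<theta>\<^sub>0 * v\<^sub>0 * exp (- \<theta>\<^sub>0) / 2 * (N / v\<^sub>0) - B\<^sup>2 * \<theta>\<^sub>0\<^sup>2 * exp \<theta>\<^sub>0 / 2 * D) / \<theta>
      = \<theta>\<^sub>0 * exp (- \<theta>\<^sub>0) * N / \<theta> / 2 - B\<^sup>2 * \<theta>\<^sub>0\<^sup>2 * exp \<theta>\<^sub>0 / 2 * D / \<theta>"
    using assms by (simp add: field_simps)
  ultimately show ?thesis by (simp add: N_def)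
qed

text \<open>The constant \<open>C\<close> does not depend on \<open>\<eta>\<close>. On averaging,
  the first error stays of order \<open>\<eta>\<close> since the mean squared innovation converges,
  and the second vanishes with the mean gap. So \<open>\<eta>\<close> is fixed first, and then
  \<open>n\<close> grows.\<close>

lemma normalized_residual_approx:
  fixes \<theta>\<^sub>0 v\<^sub>0 a b B :: real
  assumes "0 < \<theta>\<^sub>0" "0 < v\<^sub>0" "0 < a" "a \<le> b"
  obtains C where "0 \<le> C"
    and "\<And>\<theta> D x y \<eta>. a \<le> \<theta> \<Longrightarrow> \<theta> \<le> b \<Longrightarrow> 0 < D \<Longrightarrow> D \<le> 1 \<Longrightarrow> \<bar>x\<bar> \<le> B \<Longrightarrow> \<bar>y\<bar> \<le> B \<Longrightarrow> 0 < \<eta> \<Longrightarrow> \<eta> \<le> 1 \<Longrightarrow>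
      \<bar>normalized_residual \<theta> D x y - \<theta>\<^sub>0 * v\<^sub>0 / \<theta> * (normalized_residual \<theta>\<^sub>0 D x y / v\<^sub>0)\<bar>
        \<le> C * (\<eta> * (normalized_residual \<theta>\<^sub>0 D x y / v\<^sub>0) + D / \<eta>)"
proof
  define C1 where "C1 = v\<^sub>0 * (\<theta>\<^sub>0 / a * (\<theta>\<^sub>0 + b * exp b))"
  define C2 where "C2 = \<theta>\<^sub>0 * v\<^sub>0 / a + C1"
  define C3 where "C3 = B\<^sup>2 * (\<theta>\<^sub>0 + b)\<^sup>2 * exp b / (2 * a)"
  define CB where "CB = 4 * B\<^sup>2 * exp \<theta>\<^sub>0 / (2 * \<theta>\<^sub>0 * v\<^sub>0)"
  have nn: "0 \<le> C1" "0 \<le> C2" "0 \<le> C3" "0 \<le> CB"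
    using assms by (auto simp: C1_def C2_def C3_def CB_def)
  define C where "C = C1 + C2 + C1 * CB + 2 * C3"
  show "0 \<le> C" using nn by (simp add: C_def)
  fix \<theta> D x y \<eta> :: real
  assume \<theta>: "a \<le> \<theta>" "\<theta> \<le> b" and D: "0 < D" "D \<le> 1" and xy: "\<bar>x\<bar> \<le> B" "\<bar>y\<bar> \<le> B" and \<eta>: "0 < \<eta>" "\<eta> \<le> 1"
  let ?E = "\<lambda>\<theta>. 1 - exp (- 2 * \<theta> * D)"
  define e where "e = y - exp (- \<theta>\<^sub>0 * D) * x"
  define r where "r = (exp (- \<theta>\<^sub>0 * D) - exp (- \<theta> * D)) * x"
  define Y where "Y = normalized_residual \<theta>\<^sub>0 D x y / v\<^sub>0"
  have tpos: "0 < \<theta>" using assms \<theta> by simp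
  have E0: "2 * (\<theta>\<^sub>0 * D) * exp (- (\<theta>\<^sub>0 * D)) \<le> ?E \<theta>\<^sub>0" "0 < ?E \<theta>\<^sub>0"
    using one_minus_exp_bounds[of "\<theta>\<^sub>0 * D"] assms D by (simp_all add: mult.assoc)
  have E: "0 < ?E \<theta>"
    using one_minus_exp_bounds[of "\<theta> * D"] tpos D by (simp_all add: mult.assoc)
  have Y0: "0 \<le> Y" using assms D by (simp add: Y_def normalized_residual_nonneg)
  have e2: "e\<^sup>2 = v\<^sub>0 * ?E \<theta>\<^sub>0 * Y"
  proof -
    have "e\<^sup>2 = v\<^sub>0 * Y * ?E \<theta>\<^sub>0"
      using E0(2) assms(2) unfolding Y_def normalized_residual_def e_def
      by (simp only: times_divide_eq_right times_divide_eq_left nonzero_mult_div_cancel_left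
        nonzero_mult_div_cancel_right less_irrefl mult.commute[of v\<^sub>0] nonzero_divide_eq_eq)
    then show ?thesis by (simp add: algebra_simps)
  qed
  have tD: "\<theta> * D \<le> b * 1" using \<theta> D tpos by (intro mult_mono) auto
  have main: "\<bar>e\<^sup>2 / ?E \<theta> - \<theta>\<^sub>0 * v\<^sub>0 / \<theta> * Y\<bar> \<le> C1 * (D * Y)"
  proof -
    have "\<bar>?E \<theta>\<^sub>0 / ?E \<theta> - \<theta>\<^sub>0 / \<theta>\<bar> \<le> \<theta>\<^sub>0 / \<theta> * ((\<theta>\<^sub>0 + \<theta> * exp (\<theta> * D)) * D)"
      using tpos assms D by (intro variance_ratio_bound)
    also have "\<dots> \<le> \<theta>\<^sub>0 / a * ((\<theta>\<^sub>0 + b * exp b) * D)"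
      using tD \<theta> D assms by (intro mult_mono divide_left_mono add_mono) auto
    finally have "v\<^sub>0 * Y * \<bar>?E \<theta>\<^sub>0 / ?E \<theta> - \<theta>\<^sub>0 / \<theta>\<bar> \<le> v\<^sub>0 * Y * (\<theta>\<^sub>0 / a * ((\<theta>\<^sub>0 + b * exp b) * D))"
      using Y0 assms by (intro mult_left_mono) auto
    moreover have "e\<^sup>2 / ?E \<theta> - \<theta>\<^sub>0 * v\<^sub>0 / \<theta> * Y = v\<^sub>0 * Y * (?E \<theta>\<^sub>0 / ?E \<theta> - \<theta>\<^sub>0 / \<theta>)"
      unfolding e2 by (simp add: algebra_simps)
    moreover have "\<bar>v\<^sub>0 * Y * t\<bar> = v\<^sub>0 * Y * \<bar>t\<bar>" for t
      using Y0 assms(2) by (simp add: abs_mult)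
    moreover have "v\<^sub>0 * Y * (\<theta>\<^sub>0 / a * ((\<theta>\<^sub>0 + b * exp b) * D)) = C1 * (D * Y)"
      by (simp add: C1_def)
    ultimately show ?thesis by metis
  qed
  \<comment> \<open>A gap need not be small. If it exceeds \<open>\<eta>\<close>, boundedness of the
    path helps: \<open>e\<^sup>2\<close> is at most \<open>4 * B\<^sup>2\<close> and at least a
    multiple of \<open>D * Y\<close>, so \<open>D * Y\<close> is at most \<open>CB\<close>, while
    \<open>D / \<eta>\<close> exceeds 1.\<close>
  have DY: "D * Y \<le> \<eta> * Y + CB * (D / \<eta>)"
  proof (cases "D \<le> \<eta>")
    case True
    then have "D * Y \<le> \<eta> * Y" using Y0 by (intro mult_right_mono)
    moreover have "0 \<le> CB * (D / \<eta>)" using nn D \<eta> by simp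
    ultimately show ?thesis by linarith
  next
    case False
    have "\<bar>exp (- \<theta>\<^sub>0 * D) * x\<bar> \<le> 1 * B"
      unfolding abs_mult using xy D assms by (intro mult_mono) auto
    then have "\<bar>e\<bar> \<le> \<bar>2 * B\<bar>" unfolding e_def using xy by linarith
    then have "e\<^sup>2 \<le> 4 * B\<^sup>2" unfolding abs_le_square_iff by (simp add: power2_eq_square)
    moreover have "e\<^sup>2 \<ge> v\<^sub>0 * (2 * (\<theta>\<^sub>0 * D) * exp (- \<theta>\<^sub>0)) * Y"
    proof -
      have "exp (- \<theta>\<^sub>0) \<le> exp (- (\<theta>\<^sub>0 * D))" using assms D by simp
      then have "2 * (\<theta>\<^sub>0 * D) * exp (- \<theta>\<^sub>0) \<le> 2 * (\<theta>\<^sub>0 * D) * exp (- (\<theta>\<^sub>0 * D))"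
        using assms D by (intro mult_left_mono) auto
      from order.trans[OF this E0(1)] show ?thesis
        unfolding e2 using assms Y0 by (intro mult_right_mono mult_left_mono) auto
    qed
    ultimately have "v\<^sub>0 * (2 * (\<theta>\<^sub>0 * D) * exp (- \<theta>\<^sub>0)) * Y \<le> 4 * B\<^sup>2" by linarith
    then have "D * Y \<le> CB"
      using assms by (simp add: CB_def exp_minus field_simps)
    also have "CB * 1 \<le> CB * (D / \<eta>)" using False nn \<eta> by (intro mult_left_mono) auto
    finally show ?thesis using mult_nonneg_nonneg[OF _ Y0, of \<eta>] \<eta> by simp
  qed
  have r2: "r\<^sup>2 / ?E \<theta> \<le> C3 * D"
  proof -
    have "r\<^sup>2 / ?E \<theta> \<le> B\<^sup>2 * (\<theta>\<^sub>0 - \<theta>)\<^sup>2 * exp (\<theta> * D) * D / (2 * \<theta>)"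
      unfolding r_def using assms tpos D xy by (intro residual_remainder_bound) auto
    also have "\<dots> \<le> B\<^sup>2 * (\<theta>\<^sub>0 + b)\<^sup>2 * exp b * D / (2 * a)"
    proof -
      have "\<bar>\<theta>\<^sub>0 - \<theta>\<bar> \<le> \<bar>\<theta>\<^sub>0 + b\<bar>" using assms \<theta> by auto
      then have "(\<theta>\<^sub>0 - \<theta>)\<^sup>2 \<le> (\<theta>\<^sub>0 + b)\<^sup>2" by (simp only: abs_le_square_iff)
      then show ?thesis
        using assms tD D \<theta> by (intro frac_le mult_right_mono mult_mono) auto
    qed
    finally show ?thesis by (simp add: C3_def)
  qed
  have e2E: "e\<^sup>2 / ?E \<theta> \<le> C2 * Y"
  proof -
    have "\<theta>\<^sub>0 * v\<^sub>0 / \<theta> * Y \<le> \<theta>\<^sub>0 * v\<^sub>0 / a * Y"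
      using \<theta> assms Y0 by (intro mult_right_mono divide_left_mono) auto
    moreover have "C1 * (D * Y) \<le> C1 * (1 * Y)"
      using D Y0 nn by (intro mult_left_mono mult_right_mono) auto
    ultimately show ?thesis using main by (simp add: C2_def distrib_right)
  qed
  \<comment> \<open>The weighted inequality between \<open>2 * e * r\<close> and
    \<open>\<eta> * e\<^sup>2 + r\<^sup>2 / \<eta>\<close>. Since \<open>\<eta> \<le> 1\<close>, the
    remaining \<open>r\<^sup>2\<close> is also at most \<open>r\<^sup>2 / \<eta>\<close>, whence the
    factor 2.\<close>
  have cross: "\<bar>normalized_residual \<theta> D x y - e\<^sup>2 / ?E \<theta>\<bar> \<le> \<eta> * (e\<^sup>2 / ?E \<theta>) + 2 / \<eta> * (r\<^sup>2 / ?E \<theta>)"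
  proof -
    have "(y - exp (- \<theta> * D) * x)\<^sup>2 = (e + r)\<^sup>2"
      by (simp add: e_def r_def algebra_simps)
    then have "(y - exp (- \<theta> * D) * x)\<^sup>2 - e\<^sup>2 = 2 * (e * r) + r\<^sup>2"
      by (simp add: power2_sum)
    moreover have "\<bar>2 * (e * r)\<bar> \<le> \<eta> * e\<^sup>2 + r\<^sup>2 / \<eta>"
    proof -
      have "0 \<le> (\<eta> * \<bar>e\<bar> - \<bar>r\<bar>)\<^sup>2 / \<eta>" using \<eta> by simp
      also have "\<dots> = \<eta> * e\<^sup>2 + r\<^sup>2 / \<eta> - \<bar>2 * (e * r)\<bar>"
        using \<eta> by (simp add: power2_diff abs_mult power_mult_distrib diff_divide_distrib add_divide_distrib)
          (simp add: power2_eq_square field_simps)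
      finally show ?thesis by linarith
    qed
    moreover have "r\<^sup>2 \<le> r\<^sup>2 / \<eta>" using \<eta> by (simp add: le_divide_eq mult_left_le)
    moreover have "\<bar>t\<bar> \<le> A + 2 * Q"
      if "t = c + R" "\<bar>c\<bar> \<le> A + Q" "R \<le> Q" "0 \<le> R" for t c R A Q :: real
      using that by linarith
    ultimately have "\<bar>(y - exp (- \<theta> * D) * x)\<^sup>2 - e\<^sup>2\<bar> \<le> \<eta> * e\<^sup>2 + 2 * (r\<^sup>2 / \<eta>)"
      using zero_le_power2 by blast
    then have "\<bar>(y - exp (- \<theta> * D) * x)\<^sup>2 - e\<^sup>2\<bar> \<le> \<eta> * e\<^sup>2 + 2 / \<eta> * r\<^sup>2"
      by simp
    then have "\<bar>(y - exp (- \<theta> * D) * x)\<^sup>2 - e\<^sup>2\<bar> / ?E \<theta> \<le> (\<eta> * e\<^sup>2 + 2 / \<eta> * r\<^sup>2) / ?E \<theta>"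
      using E by (intro divide_right_mono) auto
    then show ?thesis
      using E unfolding normalized_residual_def diff_divide_distrib[symmetric] abs_divide
      by (simp add: add_divide_distrib)
  qed
  have "\<bar>normalized_residual \<theta> D x y - \<theta>\<^sub>0 * v\<^sub>0 / \<theta> * Y\<bar>
      \<le> \<eta> * (e\<^sup>2 / ?E \<theta>) + 2 / \<eta> * (r\<^sup>2 / ?E \<theta>) + C1 * (D * Y)"
    using cross main by linarith
  also have "\<dots> \<le> \<eta> * (C2 * Y) + 2 / \<eta> * (C3 * D) + C1 * (\<eta> * Y + CB * (D / \<eta>))"
    using e2E r2 DY \<eta> nn by (intro add_mono mult_left_mono) auto
  also have "\<dots> = (C1 + C2) * (\<eta> * Y) + (C1 * CB + 2 * C3) * (D / \<eta>)"
    by (simp add: algebra_simps)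
  also have "\<dots> \<le> C * (\<eta> * Y) + C * (D / \<eta>)"
    using nn Y0 \<eta> D by (intro add_mono mult_right_mono) (auto simp: C_def)
  finally show "\<bar>normalized_residual \<theta> D x y - \<theta>\<^sub>0 * v\<^sub>0 / \<theta> * (normalized_residual \<theta>\<^sub>0 D x y / v\<^sub>0)\<bar>
        \<le> C * (\<eta> * (normalized_residual \<theta>\<^sub>0 D x y / v\<^sub>0) + D / \<eta>)"
    by (simp add: Y_def distrib_left)
qed

text \<open>For a fixed rate this is the criterion as a function of the variance; it decreases up to
  its minimum at \<open>q / (2 * m)\<close>. Strictness comes from \<open>ln x < x - 1\<close> for
  \<open>x\<close> other than 1.\<close>

lemma log_plus_inverse_antimono:
  fixes m q u v :: real
  assumes "0 < m" "0 < u" "u < v" "2 * m * v \<le> q"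
  shows "2 * m * ln v + q / v < 2 * m * ln u + q / u"
proof -
  have "ln (v / u) < v / u - 1"
    using assms ln_le_minus_one[of "v / u"] ln_eq_minus_one[of "v / u"] by fastforce
  then have "2 * m * ln (v / u) < 2 * m * (v / u - 1)" using assms by simp
  also have "\<dots> = 2 * m * v * ((v - u) / (u * v))" using assms by (simp add: field_simps)
  also have "\<dots> \<le> q * ((v - u) / (u * v))" using assms by (intro mult_right_mono) auto
  also have "\<dots> = q / u - q / v" using assms by (simp add: field_simps)
  finally show ?thesis using assms by (simp add: ln_div algebra_simps)
qed

lemma log_plus_inverse_mono:
  fixes m q u v :: real
  assumes "0 < m" "0 < u" "u < v" "q \<le> 2 * m * u"
  shows "2 * m * ln u + q / u < 2 * m * ln v + q / v"
proof -
  have "ln (u / v) < u / v - 1"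
    using assms ln_le_minus_one[of "u / v"] ln_eq_minus_one[of "u / v"] by fastforce
  then have "2 * m * ln (u / v) < 2 * m * (u / v - 1)" using assms by simp
  also have "\<dots> = - (2 * m * u * ((v - u) / (u * v)))" using assms by (simp add: field_simps)
  also have "\<dots> \<le> - (q * ((v - u) / (u * v)))" using assms by (intro le_imp_neg_le mult_right_mono) auto
  also have "\<dots> = q / v - q / u" using assms by (simp add: field_simps)
  finally show ?thesis using assms by (simp add: ln_div algebra_simps)
qed

section \<open>The criterion along a fixed path\<close>

lemma sum_pairs_by_lag:
  fixes w :: "nat \<Rightarrow> 'a::semiring_0"
  assumes "\<And>k. K < k \<Longrightarrow> w k = 0"
  shows "(\<Sum>i = 1..n - 1. \<Sum>j = i + 1..n. w (j - i) * F i j)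
    = (\<Sum>k = 1..K. w k * (\<Sum>i = 1..n - k. F i (i + k)))"
proof -
  let ?S = "SIGMA i:{1..n - 1}. {i + 1..n}" and ?T = "SIGMA k:{1..K}. {1..n - k}"
  have "(\<Sum>i = 1..n - 1. \<Sum>j = i + 1..n. w (j - i) * F i j) = (\<Sum>(i, j)\<in>?S. w (j - i) * F i j)"
    by (simp add: sum.Sigma)
  also have "\<dots> = (\<Sum>(k, i)\<in>?T. w k * F i (i + k))"
    \<comment> \<open>Pairs of lag above \<open>K\<close> have no partner on the right, but their
      weight is zero.\<close>
    by (rule sum.reindex_bij_witness_not_neutral[where S' = "{(i, j) \<in> ?S. K < j - i}" and T' = "{}"
          and j = "\<lambda>(i, j). (j - i, i)" and i = "\<lambda>(k, i). (i, i + k)"])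
      (auto simp: assms intro: finite_subset[of _ ?S])
  also have "\<dots> = (\<Sum>k = 1..K. w k * (\<Sum>i = 1..n - k. F i (i + k)))"
    by (simp add: sum.Sigma sum_distrib_left)
  finally show ?thesis .
qed

text \<open>A difference of lag \<open>k\<close> is a sum of \<open>k\<close> consecutive
  differences. Each of the \<open>k\<close> layers telescopes to a difference of two numbers in
  [0,1].\<close>

lemma sum_lag_differences_le:
  fixes f :: "nat \<Rightarrow> real"
  assumes "\<And>i. 1 \<le> i \<Longrightarrow> i \<le> m + k \<Longrightarrow> f i \<in> {0..1}"
  shows "(\<Sum>i = 1..m. f (i + k) - f i) \<le> k"
  using assms
proof (induction k)
  case (Suc k)
  have "(\<Sum>i = 1..m. f (i + Suc k) - f i)
      = (\<Sum>i = 1..m. f (i + k) - f i) + (\<Sum>i = 1..m. f (Suc (i + k)) - f (i + k))"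
    by (simp add: sum.distrib[symmetric])
  also have "(\<Sum>i = 1..m. f (Suc (i + k)) - f (i + k)) = f (Suc m + k) - f (1 + k)"
    using sum_Suc_diff[of 1 m "\<lambda>i. f (i + k)"] by simp
  also have "f (Suc m + k) - f (1 + k) \<le> 1"
    using Suc.prems[of "Suc m + k"] Suc.prems[of "1 + k"] by auto
  finally show ?case using Suc.IH Suc.prems by fastforce
qed simp

text \<open>One outcome is fixed. Probability enters only through the bound on the path and the law
  of its innovations, both of which hold almost surely, so the analysis of the criterion is
  deterministic.\<close>

locale observed_path =
  fixes \<theta>\<^sub>0 v\<^sub>0 :: real and s :: "nat \<Rightarrow> nat \<Rightarrow> real" and w :: "nat \<Rightarrow> real" and K :: nat
    and z :: "real \<Rightarrow> real" and B :: real
  assumes rate_pos: "0 < \<theta>\<^sub>0" and variance_pos: "0 < v\<^sub>0"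
    and obs: "observation_points s"
    and w_nonneg: "\<And>k. 1 \<le> k \<Longrightarrow> 0 \<le> w k"
    and w_zero: "\<And>k. K < k \<Longrightarrow> w k = 0"
    and w_sum_pos: "0 < (\<Sum>k = 1..K. w k)"
    and path_bounded: "\<And>t. t \<in> {0..1} \<Longrightarrow> \<bar>z t\<bar> \<le> B"
    and innovations_law: "\<And>k. 1 \<le> k \<Longrightarrow>
      (\<lambda>n. ((\<Sum>i = 1..n - k. (innovation \<theta>\<^sub>0 v\<^sub>0 z (s n i) (s n (i + k)))\<^sup>2) - real (n - k)) / n) \<longlonglongrightarrow> 0"
begin

definition wbar :: real where "wbar = (\<Sum>k = 1..K. w k)"

definition avg :: "nat \<Rightarrow> (nat \<Rightarrow> nat \<Rightarrow> real) \<Rightarrow> real" where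
  "avg n F = (\<Sum>i = 1..n - 1. \<Sum>j = i + 1..n. w (j - i) * F i j) / n"

definition gap :: "nat \<Rightarrow> nat \<Rightarrow> nat \<Rightarrow> real" where "gap n i j = s n j - s n i"

definition residual :: "real \<Rightarrow> nat \<Rightarrow> nat \<Rightarrow> nat \<Rightarrow> real" where
  "residual \<theta> n i j = normalized_residual \<theta> (gap n i j) (z (s n i)) (z (s n j))"

text \<open>In the notation of the overview, \<open>total_weight\<close>,
  \<open>marginal_term\<close>, \<open>residual_term\<close> and \<open>log_term\<close> are m, A, T
  and L with index n, and \<open>wbar\<close> is the limit m.\<close>

definition total_weight :: "nat \<Rightarrow> real" where "total_weight n = avg n (\<lambda>_ _. 1)"

definition marginal_term :: "nat \<Rightarrow> real" where "marginal_term n = avg n (\<lambda>i j. (z (s n i))\<^sup>2)"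

definition residual_term :: "nat \<Rightarrow> real \<Rightarrow> real" where
  "residual_term n \<theta> = avg n (residual \<theta> n)"

definition log_term :: "nat \<Rightarrow> real \<Rightarrow> real" where
  "log_term n \<theta> = avg n (\<lambda>i j. ln (1 - exp (- 2 * \<theta> * gap n i j)))"

lemma wbar_pos: "0 < wbar"
  using w_sum_pos by (simp add: wbar_def)

lemma gap_bounds:
  assumes "1 \<le> i" "i < j" "j \<le> n"
  shows "0 < gap n i j" "gap n i j \<le> 1"
  using observation_pointsD[OF obs assms] by (auto simp: gap_def)

lemma avg_mono:
  assumes "\<And>i j. 1 \<le> i \<Longrightarrow> i < j \<Longrightarrow> j \<le> n \<Longrightarrow> F i j \<le> G i j"
  shows "avg n F \<le> avg n G"
  unfolding avg_def by (intro divide_right_mono sum_mono mult_left_mono assms w_nonneg) auto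

lemma avg_cong:
  assumes "\<And>i j. 1 \<le> i \<Longrightarrow> i < j \<Longrightarrow> j \<le> n \<Longrightarrow> F i j = G i j"
  shows "avg n F = avg n G"
  by (intro antisym avg_mono) (simp_all add: assms)

lemma avg_add: "avg n (\<lambda>i j. F i j + G i j) = avg n F + avg n G"
  by (simp add: avg_def distrib_left sum.distrib add_divide_distrib)

lemma avg_cmult: "avg n (\<lambda>i j. c * F i j) = c * avg n F"
  by (simp add: avg_def sum_distrib_left mult.left_commute)

lemma avg_const: "avg n (\<lambda>i j. c) = c * total_weight n"
  using avg_cmult[of n c "\<lambda>_ _. 1"] by (simp add: total_weight_def)

lemma avg_diff: "avg n (\<lambda>i j. F i j - G i j) = avg n F - avg n G"
  using avg_add[of n F "\<lambda>i j. (- 1) * G i j"] avg_cmult[of n "- 1" G] by simp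

lemma avg_nonneg:
  assumes "\<And>i j. 1 \<le> i \<Longrightarrow> i < j \<Longrightarrow> j \<le> n \<Longrightarrow> 0 \<le> F i j"
  shows "0 \<le> avg n F"
  using avg_mono[of n "\<lambda>_ _. 0" F] assms by (simp add: avg_def)

lemma avg_abs_le:
  assumes "\<And>i j. 1 \<le> i \<Longrightarrow> i < j \<Longrightarrow> j \<le> n \<Longrightarrow> \<bar>F i j\<bar> \<le> G i j"
  shows "\<bar>avg n F\<bar> \<le> avg n G"
proof -
  have "avg n F \<le> avg n G" "avg n (\<lambda>i j. (- 1) * F i j) \<le> avg n G"
    by (intro avg_mono; use assms in fastforce)+
  then show ?thesis unfolding avg_cmult by linarith
qed

lemma avg_by_lag: "avg n F = (\<Sum>k = 1..K. w k * ((\<Sum>i = 1..n - k. F i (i + k)) / n))"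
  unfolding avg_def times_divide_eq_right sum_divide_distrib[symmetric]
  by (subst sum_pairs_by_lag[of K]) (auto simp: w_zero)

lemma lag_count_tendsto: "(\<lambda>n. real (n - k) / n) \<longlonglongrightarrow> 1"
proof (rule Lim_transform_eventually)
  show "(\<lambda>n. 1 - real k / n) \<longlonglongrightarrow> 1"
    by real_asymp
  show "\<forall>\<^sub>F n in sequentially. 1 - real k / n = real (n - k) / n"
    using eventually_ge_at_top[of "k + 1"]
    by eventually_elim (simp add: of_nat_diff field_simps)
qed

lemma total_weight_tendsto: "total_weight \<longlonglongrightarrow> wbar"
proof -
  have "(\<lambda>n. \<Sum>k = 1..K. w k * (real (n - k) / n)) \<longlonglongrightarrow> (\<Sum>k = 1..K. w k * 1)"
    by (intro tendsto_sum tendsto_mult tendsto_const lag_count_tendsto)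
  then show ?thesis
    unfolding total_weight_def avg_by_lag by (simp add: wbar_def)
qed

lemma avg_gap_nonneg: "0 \<le> avg n (gap n)"
  by (rule avg_nonneg) (use gap_bounds in \<open>auto intro: less_imp_le\<close>)

text \<open>This takes the place of a mesh condition on the design: the gaps of lag \<open>k\<close>
  in [0,1] add up to at most \<open>k\<close>, and finitely many lags carry weight.\<close>

lemma gap_tendsto: "(\<lambda>n. avg n (gap n)) \<longlonglongrightarrow> 0"
proof (rule tendsto_sandwich)
  show "\<forall>\<^sub>F n in sequentially. 0 \<le> avg n (gap n)"
    by (simp add: avg_gap_nonneg)
  have "avg n (gap n) \<le> (\<Sum>k = 1..K. w k * k) / n" for n
  proof -
    have "(\<Sum>i = 1..n - k. gap n i (i + k)) \<le> k" if "1 \<le> k" for k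
    proof (cases "k < n")
      case True
      have "s n i \<in> {0..1}" if "1 \<le> i" "i \<le> n - k + k" for i
      proof -
        have "s n ` {1..n} \<subseteq> {0..1}" using obs unfolding observation_points_def by blast
        then show ?thesis using that True by (auto simp: image_subset_iff)
      qed
      then show ?thesis
        unfolding gap_def by (rule sum_lag_differences_le)
    qed simp
    then show ?thesis
      unfolding avg_by_lag times_divide_eq_right sum_divide_distrib[symmetric]
      by (intro divide_right_mono sum_mono mult_left_mono w_nonneg) auto
  qed
  then show "\<forall>\<^sub>F n in sequentially. avg n (gap n) \<le> (\<Sum>k = 1..K. w k * k) / n"
    by simp
  show "(\<lambda>n. (\<Sum>k = 1..K. w k * k) / n) \<longlonglongrightarrow> 0"
    by (rule lim_const_over_n)
qed auto

lemma innovation_square: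
  assumes "1 \<le> i" "i < j" "j \<le> n"
  shows "(innovation \<theta>\<^sub>0 v\<^sub>0 z (s n i) (s n j))\<^sup>2 = residual \<theta>\<^sub>0 n i j / v\<^sub>0"
proof -
  have "0 \<le> v\<^sub>0 * (1 - exp (- 2 * \<theta>\<^sub>0 * gap n i j))"
    using rate_pos variance_pos gap_bounds[OF assms] by simp
  then show ?thesis
    by (simp add: innovation_def residual_def normalized_residual_def power_divide gap_def mult.commute)
qed

lemma innovations_tendsto: "(\<lambda>n. avg n (\<lambda>i j. residual \<theta>\<^sub>0 n i j / v\<^sub>0)) \<longlonglongrightarrow> wbar"
proof -
  let ?S = "\<lambda>n k. (\<Sum>i = 1..n - k. (innovation \<theta>\<^sub>0 v\<^sub>0 z (s n i) (s n (i + k)))\<^sup>2)"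
  have "(\<lambda>n. ?S n k / n) \<longlonglongrightarrow> 1" if "1 \<le> k" for k
    using tendsto_add[OF innovations_law[OF that] lag_count_tendsto[of k]]
    by (simp add: add_divide_distrib[symmetric])
  then have "(\<lambda>n. \<Sum>k = 1..K. w k * (?S n k / n)) \<longlonglongrightarrow> (\<Sum>k = 1..K. w k * 1)"
    by (intro tendsto_sum tendsto_mult tendsto_const) auto
  moreover have "avg n (\<lambda>i j. residual \<theta>\<^sub>0 n i j / v\<^sub>0) = (\<Sum>k = 1..K. w k * (?S n k / n))" for n
  proof -
    have "avg n (\<lambda>i j. residual \<theta>\<^sub>0 n i j / v\<^sub>0) = avg n (\<lambda>i j. (innovation \<theta>\<^sub>0 v\<^sub>0 z (s n i) (s n j))\<^sup>2)"
      by (intro avg_cong innovation_square[symmetric])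
    then show ?thesis unfolding avg_by_lag .
  qed
  ultimately show ?thesis by (simp add: wbar_def)
qed

lemma loglik_decomposition:
  "weighted_pair_loglik w s n z (\<theta>, v)
    = n * (2 * total_weight n * ln v + log_term n \<theta> + (marginal_term n + residual_term n \<theta>) / v)"
proof (cases "n = 0")
  case False
  have "weighted_pair_loglik w s n z (\<theta>, v) = n * avg n (\<lambda>i j. pair_loglik z (s n i) (s n j) (\<theta>, v))"
    using False by (simp add: weighted_pair_loglik_def avg_def)
  also have "avg n (\<lambda>i j. pair_loglik z (s n i) (s n j) (\<theta>, v))
    = avg n (\<lambda>i j. 2 * ln v + ln (1 - exp (- 2 * \<theta> * gap n i j)) + (1 / v * (z (s n i))\<^sup>2 + 1 / v * residual \<theta> n i j))"
  proof (rule avg_cong)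
    fix i j assume "1 \<le> i" "i < j" "j \<le> n"
    then have "\<bar>s n i - s n j\<bar> = gap n i j" using gap_bounds[of i j n] by (simp add: gap_def)
    then show "pair_loglik z (s n i) (s n j) (\<theta>, v)
      = 2 * ln v + ln (1 - exp (- 2 * \<theta> * gap n i j)) + (1 / v * (z (s n i))\<^sup>2 + 1 / v * residual \<theta> n i j)"
      by (simp add: pair_loglik_def residual_def normalized_residual_def)
  qed
  also have "\<dots> = 2 * total_weight n * ln v + log_term n \<theta> + (marginal_term n + residual_term n \<theta>) / v"
    unfolding avg_add avg_cmult avg_const log_term_def marginal_term_def residual_term_def
    by (simp add: add_divide_distrib)
  finally show ?thesis .
qed (simp add: weighted_pair_loglik_def)

lemma residual_nonneg:
  assumes "0 < \<theta>" "1 \<le> i" "i < j" "j \<le> n"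
  shows "0 \<le> residual \<theta> n i j"
  using assms gap_bounds by (simp add: residual_def normalized_residual_nonneg)

lemma residual_term_nonneg: "0 < \<theta> \<Longrightarrow> 0 \<le> residual_term n \<theta>"
  unfolding residual_term_def by (intro avg_nonneg residual_nonneg)

lemma marginal_term_nonneg: "0 \<le> marginal_term n"
  unfolding marginal_term_def by (intro avg_nonneg) auto

lemma z_bound:
  assumes "1 \<le> i" "i < j" "j \<le> n"
  shows "\<bar>z (s n i)\<bar> \<le> B" "\<bar>z (s n j)\<bar> \<le> B"
  using observation_pointsD[OF obs assms] path_bounded by auto

lemma residual_term_uniform:
  assumes "0 < a" "a \<le> b" "0 < e"
  shows "\<forall>\<^sub>F n in sequentially. \<forall>\<theta>\<in>{a..b}. \<bar>residual_term n \<theta> - wbar * (\<theta>\<^sub>0 * v\<^sub>0) / \<theta>\<bar> \<le> e"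
proof -
  obtain C where C: "0 \<le> C"
    "\<And>\<theta> D x y \<eta>. a \<le> \<theta> \<Longrightarrow> \<theta> \<le> b \<Longrightarrow> 0 < D \<Longrightarrow> D \<le> 1 \<Longrightarrow> \<bar>x\<bar> \<le> B \<Longrightarrow> \<bar>y\<bar> \<le> B \<Longrightarrow> 0 < \<eta> \<Longrightarrow> \<eta> \<le> 1 \<Longrightarrow>
      \<bar>normalized_residual \<theta> D x y - \<theta>\<^sub>0 * v\<^sub>0 / \<theta> * (normalized_residual \<theta>\<^sub>0 D x y / v\<^sub>0)\<bar>
        \<le> C * (\<eta> * (normalized_residual \<theta>\<^sub>0 D x y / v\<^sub>0) + D / \<eta>)"
    using normalized_residual_approx[OF rate_pos variance_pos assms(1,2)] by metis
  \<comment> \<open>Makes the part of the error that survives in the limit at most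
    \<open>e / 2\<close>. Writing \<open>C + 1\<close> keeps the denominator positive when
    \<open>C\<close> is 0.\<close>
  define \<eta> where "\<eta> = min 1 (e / (2 * (C + 1) * wbar))"
  have \<eta>: "0 < \<eta>" "\<eta> \<le> 1" using assms C wbar_pos by (auto simp: \<eta>_def)
  have "\<eta> \<le> e / (2 * (C + 1) * wbar)" by (simp add: \<eta>_def)
  moreover have "0 < 2 * (C + 1) * wbar" using C(1) wbar_pos by simp
  ultimately have "\<eta> * (2 * (C + 1) * wbar) \<le> e" by (simp only: pos_le_divide_eq)
  then have "(C + 1) * \<eta> * wbar \<le> e / 2" by (simp add: algebra_simps)
  moreover have "C * \<eta> * wbar \<le> (C + 1) * \<eta> * wbar"
    using \<eta> wbar_pos by (intro mult_right_mono) auto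
  ultimately have small: "C * (\<eta> * wbar + 0 / \<eta>) + \<theta>\<^sub>0 * v\<^sub>0 / a * \<bar>wbar - wbar\<bar> < e"
    using assms by simp
  define y where "y n = avg n (\<lambda>i j. residual \<theta>\<^sub>0 n i j / v\<^sub>0)" for n
  have bound: "\<bar>residual_term n \<theta> - wbar * (\<theta>\<^sub>0 * v\<^sub>0) / \<theta>\<bar>
      \<le> C * (\<eta> * y n + avg n (gap n) / \<eta>) + \<theta>\<^sub>0 * v\<^sub>0 / a * \<bar>y n - wbar\<bar>"
    if \<theta>: "\<theta> \<in> {a..b}" for \<theta> n
  proof -
    have "\<bar>avg n (\<lambda>i j. residual \<theta> n i j - \<theta>\<^sub>0 * v\<^sub>0 / \<theta> * (residual \<theta>\<^sub>0 n i j / v\<^sub>0))\<bar>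
        \<le> avg n (\<lambda>i j. C * (\<eta> * (residual \<theta>\<^sub>0 n i j / v\<^sub>0) + 1 / \<eta> * gap n i j))"
    proof (rule avg_abs_le)
      fix i j assume "1 \<le> i" "i < j" "j \<le> n"
      then show "\<bar>residual \<theta> n i j - \<theta>\<^sub>0 * v\<^sub>0 / \<theta> * (residual \<theta>\<^sub>0 n i j / v\<^sub>0)\<bar>
        \<le> C * (\<eta> * (residual \<theta>\<^sub>0 n i j / v\<^sub>0) + 1 / \<eta> * gap n i j)"
        using C(2)[of \<theta> "gap n i j" "z (s n i)" "z (s n j)" \<eta>] \<theta> \<eta> gap_bounds[of i j n] z_bound[of i j n]
        by (simp add: residual_def)
    qed
    then have "\<bar>residual_term n \<theta> - \<theta>\<^sub>0 * v\<^sub>0 / \<theta> * y n\<bar> \<le> C * (\<eta> * y n + avg n (gap n) / \<eta>)"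
      unfolding avg_diff avg_cmult avg_add by (simp add: residual_term_def y_def)
    moreover have "\<bar>\<theta>\<^sub>0 * v\<^sub>0 / \<theta> * y n - wbar * (\<theta>\<^sub>0 * v\<^sub>0) / \<theta>\<bar> \<le> \<theta>\<^sub>0 * v\<^sub>0 / a * \<bar>y n - wbar\<bar>"
    proof -
      have "\<theta>\<^sub>0 * v\<^sub>0 / \<theta> * y n - wbar * (\<theta>\<^sub>0 * v\<^sub>0) / \<theta> = \<theta>\<^sub>0 * v\<^sub>0 / \<theta> * (y n - wbar)"
        by (simp add: algebra_simps diff_divide_distrib)
      then have "\<bar>\<theta>\<^sub>0 * v\<^sub>0 / \<theta> * y n - wbar * (\<theta>\<^sub>0 * v\<^sub>0) / \<theta>\<bar> = \<theta>\<^sub>0 * v\<^sub>0 / \<theta> * \<bar>y n - wbar\<bar>"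
        using rate_pos variance_pos assms \<theta> by (simp add: abs_mult)
      also have "\<dots> \<le> \<theta>\<^sub>0 * v\<^sub>0 / a * \<bar>y n - wbar\<bar>"
        using rate_pos variance_pos assms \<theta> by (intro mult_right_mono divide_left_mono) auto
      finally show ?thesis .
    qed
    moreover have "\<bar>p - r\<bar> \<le> d + d'" if "\<bar>p - q\<bar> \<le> d" "\<bar>q - r\<bar> \<le> d'" for p q r d d' :: real
      using that by linarith
    ultimately show ?thesis by blast
  qed
  have "(\<lambda>n. C * (\<eta> * y n + avg n (gap n) / \<eta>) + \<theta>\<^sub>0 * v\<^sub>0 / a * \<bar>y n - wbar\<bar>)
      \<longlonglongrightarrow> C * (\<eta> * wbar + 0 / \<eta>) + \<theta>\<^sub>0 * v\<^sub>0 / a * \<bar>wbar - wbar\<bar>"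
    unfolding y_def using \<eta> by (intro tendsto_intros innovations_tendsto gap_tendsto) auto
  from order_tendstoD(2)[OF this small] show ?thesis
  proof eventually_elim
    case (elim n)
    then show ?case using bound[of _ n] by (meson less_imp_le order.trans)
  qed
qed

text \<open>The rate ranges over all positive numbers here; this is what allows
  \<open>criterion_outside\<close> to treat rates near 0.\<close>

lemma log_term_diff_bound:
  assumes "0 < \<theta>"
  shows "\<bar>log_term n \<theta> - log_term n \<theta>\<^sub>0 - ln (\<theta> / \<theta>\<^sub>0) * total_weight n\<bar> \<le> (\<theta> + \<theta>\<^sub>0) * avg n (gap n)"
proof -
  have "\<bar>avg n (\<lambda>i j. ln (1 - exp (- 2 * \<theta> * gap n i j)) - ln (1 - exp (- 2 * \<theta>\<^sub>0 * gap n i j)) - ln (\<theta> / \<theta>\<^sub>0))\<bar>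
      \<le> avg n (\<lambda>i j. (\<theta> + \<theta>\<^sub>0) * gap n i j)"
  proof (rule avg_abs_le)
    fix i j assume "1 \<le> i" "i < j" "j \<le> n"
    then have D: "0 < gap n i j" by (rule gap_bounds)
    then show "\<bar>ln (1 - exp (- 2 * \<theta> * gap n i j)) - ln (1 - exp (- 2 * \<theta>\<^sub>0 * gap n i j)) - ln (\<theta> / \<theta>\<^sub>0)\<bar>
      \<le> (\<theta> + \<theta>\<^sub>0) * gap n i j"
      using ln_one_minus_exp_ratio[of "\<theta> * gap n i j" "\<theta>\<^sub>0 * gap n i j"] assms rate_pos
      by (simp add: distrib_right mult.assoc)
  qed
  then show ?thesis
    by (simp only: avg_diff avg_cmult avg_const log_term_def)
qed

lemma log_term_uniform:
  assumes "0 < a" "a \<le> b" "0 < e"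
  shows "\<forall>\<^sub>F n in sequentially. \<forall>\<theta>\<in>{a..b}. \<bar>log_term n \<theta> - log_term n \<theta>\<^sub>0 - wbar * ln (\<theta> / \<theta>\<^sub>0)\<bar> \<le> e"
proof -
  define R where "R = \<bar>ln (a / \<theta>\<^sub>0)\<bar> + \<bar>ln (b / \<theta>\<^sub>0)\<bar>"
  have bound: "\<bar>log_term n \<theta> - log_term n \<theta>\<^sub>0 - wbar * ln (\<theta> / \<theta>\<^sub>0)\<bar>
      \<le> (b + \<theta>\<^sub>0) * avg n (gap n) + R * \<bar>total_weight n - wbar\<bar>" if \<theta>: "\<theta> \<in> {a..b}" for \<theta> n
  proof -
    have "ln (a / \<theta>\<^sub>0) \<le> ln (\<theta> / \<theta>\<^sub>0)" "ln (\<theta> / \<theta>\<^sub>0) \<le> ln (b / \<theta>\<^sub>0)"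
      using \<theta> assms rate_pos by (auto intro!: ln_mono divide_right_mono)
    then have "\<bar>ln (\<theta> / \<theta>\<^sub>0)\<bar> \<le> R" by (simp add: R_def)
    then have "\<bar>ln (\<theta> / \<theta>\<^sub>0) * (total_weight n - wbar)\<bar> \<le> R * \<bar>total_weight n - wbar\<bar>"
      unfolding abs_mult by (intro mult_right_mono) auto
    moreover have "(\<theta> + \<theta>\<^sub>0) * avg n (gap n) \<le> (b + \<theta>\<^sub>0) * avg n (gap n)"
      using \<theta> by (intro mult_right_mono avg_gap_nonneg) auto
    moreover note log_term_diff_bound[of \<theta> n]
    ultimately show ?thesis
      using \<theta> assms by (simp add: algebra_simps)
  qed
  have "(\<lambda>n. (b + \<theta>\<^sub>0) * avg n (gap n) + R * \<bar>total_weight n - wbar\<bar>)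
      \<longlonglongrightarrow> (b + \<theta>\<^sub>0) * 0 + R * \<bar>wbar - wbar\<bar>"
    by (intro tendsto_intros total_weight_tendsto gap_tendsto)
  moreover have "(b + \<theta>\<^sub>0) * 0 + R * \<bar>wbar - wbar\<bar> < e" using assms by simp
  ultimately have "\<forall>\<^sub>F n in sequentially. (b + \<theta>\<^sub>0) * avg n (gap n) + R * \<bar>total_weight n - wbar\<bar> < e"
    by (rule order_tendstoD)
  then show ?thesis
  proof eventually_elim
    case (elim n)
    then show ?case using bound[of _ n] by (meson less_imp_le order.trans)
  qed
qed

end

section \<open>Existence of minimisers, convergence of the product, and exclusion of extreme
  rates\<close>

lemma log_plus_inverse_at_zero:
  fixes A B t :: real
  assumes "0 < A" "0 < B" "0 < t"
  shows "filterlim (\<lambda>x. A * ln (x / t) + B / x) at_top (at_right 0)"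
  using assms by real_asymp

context observed_path
begin

definition criterion :: "nat \<Rightarrow> real \<Rightarrow> real \<Rightarrow> real" where
  "criterion n \<theta> v = 2 * total_weight n * ln v + log_term n \<theta> + (marginal_term n + residual_term n \<theta>) / v"

lemma loglik_eq_criterion: "weighted_pair_loglik w s n z (\<theta>, v) = n * criterion n \<theta> v"
  by (simp add: loglik_decomposition criterion_def)

lemma arg_min_iff_criterion:
  assumes "0 < n"
  shows "is_arg_min (weighted_pair_loglik w s n z) (\<lambda>\<psi>. \<psi> \<in> J) (\<theta>, v)
    \<longleftrightarrow> (\<theta>, v) \<in> J \<and> (\<forall>\<theta>' v'. (\<theta>', v') \<in> J \<longrightarrow> criterion n \<theta> v \<le> criterion n \<theta>' v')"
  using assms by (auto simp: is_arg_min_def loglik_eq_criterion not_less)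

lemma continuous_on_criterion:
  "continuous_on ({0<..} \<times> {0<..}) (\<lambda>\<psi>. criterion n (fst \<psi>) (snd \<psi>))"
  and continuous_on_residual_term: "continuous_on {0<..} (residual_term n)"
proof -
  have gap: "0 < gap n i j" if "i \<in> {1..n - 1}" "j \<in> {i + 1..n}" for i j
    using that by (intro gap_bounds) auto
  have res: "continuous_on {0<..} (residual_term n)"
    unfolding residual_term_def avg_def residual_def normalized_residual_def divide_inverse
  proof (intro continuous_intros)
    fix i j assume "i \<in> {1..n - 1}" "j \<in> {i + 1..n}"
    from gap[OF this] show "\<forall>x\<in>{0<..}. 1 - exp (- 2 * x * gap n i j) \<noteq> 0" by auto
  qed
  have log: "continuous_on {0<..} (log_term n)"
    unfolding log_term_def avg_def divide_inverse
  proof (intro continuous_intros)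
    fix i j assume "i \<in> {1..n - 1}" "j \<in> {i + 1..n}"
    from gap[OF this] show "\<forall>x\<in>{0<..}. 1 - exp (- 2 * x * gap n i j) \<noteq> 0" by auto
  qed
  show "continuous_on {0<..} (residual_term n)" by fact
  show "continuous_on ({0<..} \<times> {0<..}) (\<lambda>\<psi>. criterion n (fst \<psi>) (snd \<psi>))"
    unfolding criterion_def
    by (intro continuous_intros continuous_on_compose2[OF res] continuous_on_compose2[OF log]) auto
qed

lemma exists_minimizer_rectangle:
  assumes "0 < a" "a \<le> b" "0 < c" "c \<le> d"
  obtains \<theta> v where "\<theta> \<in> {a..b}" "v \<in> {c..d}"
    "\<And>\<theta>' v'. \<theta>' \<in> {a..b} \<Longrightarrow> v' \<in> {c..d} \<Longrightarrow> criterion n \<theta> v \<le> criterion n \<theta>' v'"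
proof -
  have "\<exists>\<psi>\<in>{a..b} \<times> {c..d}. \<forall>\<psi>'\<in>{a..b} \<times> {c..d}. criterion n (fst \<psi>) (snd \<psi>) \<le> criterion n (fst \<psi>') (snd \<psi>')"
    by (rule continuous_attains_inf)
      (use assms in \<open>auto intro!: compact_Times continuous_on_subset[OF continuous_on_criterion]\<close>)
  then show ?thesis using that by fastforce
qed

text \<open>For each rate the optimal variance is the sum of marginal and residual term over twice
  the total weight. It lies between \<open>c\<close>, positive because the marginal term is, and
  \<open>d\<close>, taken at the largest residual term. Moving a variance into \<open>{c..d}\<close>
  never increases the criterion, so a minimiser on the rectangle is global.\<close>

lemma exists_minimizer_strip:
  assumes "0 < a" "a \<le> b" and m: "0 < total_weight n" and A: "0 < marginal_term n"
  obtains \<theta> v where "\<theta> \<in> {a..b}" "0 < v"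
    "\<And>\<theta>' v'. \<theta>' \<in> {a..b} \<Longrightarrow> 0 < v' \<Longrightarrow> criterion n \<theta> v \<le> criterion n \<theta>' v'"
proof -
  have "\<exists>\<theta>\<in>{a..b}. \<forall>\<theta>'\<in>{a..b}. residual_term n \<theta>' \<le> residual_term n \<theta>"
    by (rule continuous_attains_sup)
      (use assms in \<open>auto intro!: continuous_on_subset[OF continuous_on_residual_term]\<close>)
  then obtain \<theta>m where \<theta>m: "\<theta>m \<in> {a..b}" "\<And>\<theta>'. \<theta>' \<in> {a..b} \<Longrightarrow> residual_term n \<theta>' \<le> residual_term n \<theta>m"
    by blast
  define c where "c = marginal_term n / (2 * total_weight n)"
  define d where "d = (marginal_term n + residual_term n \<theta>m) / (2 * total_weight n)"
  have c: "0 < c" using m A by (simp add: c_def)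
  have cd: "c \<le> d"
    unfolding c_def d_def using m residual_term_nonneg[of \<theta>m n] \<theta>m(1) assms(1)
    by (intro divide_right_mono) auto
  obtain \<theta> v where min: "\<theta> \<in> {a..b}" "v \<in> {c..d}"
    "\<And>\<theta>' v'. \<theta>' \<in> {a..b} \<Longrightarrow> v' \<in> {c..d} \<Longrightarrow> criterion n \<theta> v \<le> criterion n \<theta>' v'"
    using exists_minimizer_rectangle[OF assms(1,2) c cd] by metis
  show ?thesis
  proof (rule that)
    show "\<theta> \<in> {a..b}" "0 < v" using min c by auto
    fix \<theta>' v' :: real assume \<theta>': "\<theta>' \<in> {a..b}" and v': "0 < v'"
    let ?q = "marginal_term n + residual_term n \<theta>'"
    have q: "2 * total_weight n * c \<le> ?q" "?q \<le> 2 * total_weight n * d"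
      using m residual_term_nonneg[of \<theta>' n] \<theta>' \<theta>m(2)[OF \<theta>'] assms(1) by (auto simp: c_def d_def)
    show "criterion n \<theta> v \<le> criterion n \<theta>' v'"
    proof -
      consider "v' < c" | "v' \<in> {c..d}" | "d < v'" by fastforce
      then show ?thesis
      proof cases
        case 1
        then have "criterion n \<theta>' c \<le> criterion n \<theta>' v'"
          using log_plus_inverse_antimono[OF m v' 1 q(1)] by (simp add: criterion_def)
        then show ?thesis using min(3)[OF \<theta>', of c] cd by simp
      next
        case 2
        then show ?thesis using min(3)[OF \<theta>'] by simp
      next
        case 3
        then have "criterion n \<theta>' d \<le> criterion n \<theta>' v'"
          using log_plus_inverse_mono[OF m _ 3 q(2)] c cd by (simp add: criterion_def)
        then show ?thesis using min(3)[OF \<theta>', of d] cd by simp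
      qed
    qed
  qed
qed

lemma eventually_total_weight_pos: "\<forall>\<^sub>F n in sequentially. 0 < total_weight n"
  using order_tendstoD(1)[OF total_weight_tendsto wbar_pos] .

text \<open>At equal variance the marginal terms cancel. Up to uniform errors the difference of the
  criteria is \<open>wbar * (x - 1 - ln x)\<close>, where \<open>x\<close> is the true product over
  the estimated one; this is nonnegative and vanishes only at 1.\<close>

lemma product_tendsto:
  assumes ab: "0 < a" "a \<le> b" and cd: "0 < c" "c \<le> d"
    and ev: "\<forall>\<^sub>F n in sequentially. \<theta> n \<in> {a..b} \<and> v n \<in> {c..d} \<and> \<theta>\<^sub>0 * v\<^sub>0 / v n \<in> {a..b}
      \<and> criterion n (\<theta> n) (v n) \<le> criterion n (\<theta>\<^sub>0 * v\<^sub>0 / v n) (v n)"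
  shows "(\<lambda>n. \<theta> n * v n) \<longlonglongrightarrow> \<theta>\<^sub>0 * v\<^sub>0"
proof -
  let ?\<kappa> = "\<theta>\<^sub>0 * v\<^sub>0"
  have kpos: "0 < ?\<kappa>" using rate_pos variance_pos by simp
  define x where "x n = ?\<kappa> / (\<theta> n * v n)" for n
  have "(\<lambda>n. sqrt (x n)) \<longlonglongrightarrow> 1"
  proof (rule tendstoI)
    fix r :: real assume r: "0 < r"
    \<comment> \<open>Two errors come from the log terms and two from the residual terms, the latter
      divided by a variance of at least \<open>c\<close>. Their total
      \<open>e * (2 + 2 / c)\<close>, divided by \<open>wbar\<close>, is then
      \<open>r\<^sup>2 / 2\<close>.\<close>
    define e where "e = r\<^sup>2 * wbar / (2 * (2 + 2 / c))"
    have den: "0 < 2 + 2 / c" using cd by (simp add: add_pos_pos)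
    have e: "0 < e" unfolding e_def using r wbar_pos den by simp
    have small: "e * (2 + 2 / c) / wbar < r\<^sup>2"
    proof -
      have "r\<^sup>2 * W / (2 * D) * D / W = r\<^sup>2 / 2" if "0 < D" "0 < W" for D W :: real
        using that by simp
      then have "e * (2 + 2 / c) / wbar = r\<^sup>2 / 2" using den wbar_pos unfolding e_def by blast
      also have "\<dots> < r\<^sup>2" using r by simp
      finally show ?thesis .
    qed
    show "\<forall>\<^sub>F n in sequentially. dist (sqrt (x n)) 1 < r"
      using ev residual_term_uniform[OF ab e] log_term_uniform[OF ab e]
    proof eventually_elim
      case (elim n)
      define t where "t = \<theta> n" define u where "u = v n"
      have tu: "t \<in> {a..b}" "u \<in> {c..d}" "?\<kappa> / u \<in> {a..b}" "criterion n t u \<le> criterion n (?\<kappa> / u) u"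
        using elim(1) by (auto simp: t_def u_def)
      have pos: "0 < t" "0 < u" using tu ab cd by auto
      have x: "x n = ?\<kappa> / (t * u)" "0 < x n" using pos kpos by (auto simp: x_def t_def u_def)
      have R: "wbar * ?\<kappa> / t - e \<le> residual_term n t" "residual_term n (?\<kappa> / u) \<le> wbar * u + e"
        using bspec[OF elim(2) tu(1)] bspec[OF elim(2) tu(3)] rate_pos variance_pos by (auto simp: abs_le_iff)
      have L: "log_term n \<theta>\<^sub>0 + wbar * ln (t / \<theta>\<^sub>0) - e \<le> log_term n t"
        "log_term n (?\<kappa> / u) \<le> log_term n \<theta>\<^sub>0 + wbar * ln (?\<kappa> / u / \<theta>\<^sub>0) + e"
        using bspec[OF elim(3) tu(1)] bspec[OF elim(3) tu(3)] by (auto simp: abs_le_iff)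
      have "log_term n t + residual_term n t / u \<le> log_term n (?\<kappa> / u) + residual_term n (?\<kappa> / u) / u"
        using tu(4) by (simp add: criterion_def add_divide_distrib)
      moreover have "(wbar * ?\<kappa> / t - e) / u \<le> residual_term n t / u"
        "residual_term n (?\<kappa> / u) / u \<le> (wbar * u + e) / u"
        using R pos by (auto intro: divide_right_mono)
      moreover have "(wbar * ?\<kappa> / t - e) / u = wbar * x n - e / u" "(wbar * u + e) / u = wbar + e / u"
        using pos by (simp_all add: x diff_divide_distrib add_divide_distrib)
      moreover have "wbar * ln (t / \<theta>\<^sub>0) = wbar * ln (?\<kappa> / u / \<theta>\<^sub>0) - wbar * ln (x n)"
        using pos rate_pos variance_pos by (simp add: x ln_div ln_mult algebra_simps)
      ultimately have "wbar * x n - wbar - wbar * ln (x n) \<le> 2 * e + 2 * (e / u)"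
        using L by linarith
      moreover have "e / u \<le> e / c" using tu cd e by (intro divide_left_mono) auto
      moreover have "wbar * (x n - 1 - ln (x n)) = wbar * x n - wbar - wbar * ln (x n)"
        by (simp add: algebra_simps)
      moreover have "2 * e + 2 * (e / c) = e * (2 + 2 / c)" by (simp add: algebra_simps)
      ultimately have "(x n - 1 - ln (x n)) * wbar \<le> e * (2 + 2 / c)"
        by (simp only: mult.commute[of _ wbar])
      then have "x n - 1 - ln (x n) \<le> e * (2 + 2 / c) / wbar"
        using wbar_pos by (simp only: pos_le_divide_eq)
      \<comment> \<open>A quantitative form of uniqueness of the minimum at 1: apply
        \<open>ln y \<le> y - 1\<close> to the square root of \<open>x n\<close>.\<close>
      moreover have "(sqrt (x n) - 1)\<^sup>2 \<le> x n - 1 - ln (x n)"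
      proof -
        have "ln (x n) = 2 * ln (sqrt (x n))" using x by (simp add: ln_sqrt)
        also have "\<dots> \<le> 2 * (sqrt (x n) - 1)" using x ln_le_minus_one[of "sqrt (x n)"] by simp
        finally show ?thesis using x by (simp add: power2_diff)
      qed
      ultimately have "(sqrt (x n) - 1)\<^sup>2 < r\<^sup>2" using small by linarith
      then have "\<bar>sqrt (x n) - 1\<bar>\<^sup>2 < r\<^sup>2" by (simp only: power2_abs)
      then have "\<bar>sqrt (x n) - 1\<bar> < r" using less_imp_le[OF r] by (rule power2_less_imp_less)
      then show ?case by (simp add: dist_real_def)
    qed
  qed
  then have "(\<lambda>n. ?\<kappa> / (sqrt (x n))\<^sup>2) \<longlonglongrightarrow> ?\<kappa> / 1\<^sup>2"
    by (intro tendsto_intros) auto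
  moreover have "\<forall>\<^sub>F n in sequentially. ?\<kappa> / (sqrt (x n))\<^sup>2 = \<theta> n * v n"
    using ev
  proof eventually_elim
    case (elim n)
    then have "0 < \<theta> n" "0 < v n" using ab cd by auto
    then show ?case using rate_pos variance_pos by (simp add: x_def)
  qed
  ultimately show ?thesis by (simp add: tendsto_cong)
qed

text \<open>Uniform down to rate 0, where \<open>residual_term_uniform\<close> is silent. Of the
  factor 1/4, one half is already in \<open>normalized_residual_lower\<close>; the other passes from
  a limit to an eventual bound.\<close>

lemma residual_term_small_rate:
  "\<forall>\<^sub>F n in sequentially. \<forall>\<theta>. 0 < \<theta> \<and> \<theta> \<le> \<theta>\<^sub>0 \<longrightarrow> \<theta>\<^sub>0 * v\<^sub>0 * exp (- \<theta>\<^sub>0) * wbar / 4 / \<theta> \<le> residual_term n \<theta>"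
proof -
  define p where "p = \<theta>\<^sub>0 * v\<^sub>0 * exp (- \<theta>\<^sub>0) / 2"
  define q where "q = B\<^sup>2 * \<theta>\<^sub>0\<^sup>2 * exp \<theta>\<^sub>0 / 2"
  have "0 < p" using rate_pos variance_pos by (simp add: p_def)
  have bound: "(p * avg n (\<lambda>i j. residual \<theta>\<^sub>0 n i j / v\<^sub>0) - q * avg n (gap n)) / \<theta> \<le> residual_term n \<theta>"
    if "0 < \<theta>" "\<theta> \<le> \<theta>\<^sub>0" for n \<theta>
  proof -
    have "avg n (\<lambda>i j. 1 / \<theta> * (p * (residual \<theta>\<^sub>0 n i j / v\<^sub>0) - q * gap n i j)) \<le> avg n (residual \<theta> n)"
    proof (rule avg_mono)
      fix i j assume "1 \<le> i" "i < j" "j \<le> n"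
      then show "1 / \<theta> * (p * (residual \<theta>\<^sub>0 n i j / v\<^sub>0) - q * gap n i j) \<le> residual \<theta> n i j"
        using normalized_residual_lower[OF that variance_pos, of "gap n i j" "z (s n i)" B "z (s n j)"]
          gap_bounds[of i j n] z_bound[of i j n]
        by (simp add: residual_def p_def q_def)
    qed
    then show ?thesis unfolding avg_cmult avg_diff residual_term_def by simp
  qed
  have "(\<lambda>n. p * avg n (\<lambda>i j. residual \<theta>\<^sub>0 n i j / v\<^sub>0) - q * avg n (gap n)) \<longlonglongrightarrow> p * wbar - q * 0"
    by (intro tendsto_intros innovations_tendsto gap_tendsto)
  moreover have "p * wbar / 2 < p * wbar - q * 0" using \<open>0 < p\<close> wbar_pos by simp
  ultimately have "\<forall>\<^sub>F n in sequentially. p * wbar / 2 < p * avg n (\<lambda>i j. residual \<theta>\<^sub>0 n i j / v\<^sub>0) - q * avg n (gap n)"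
    by (rule order_tendstoD)
  then show ?thesis
  proof eventually_elim
    case (elim n)
    have eq: "\<theta>\<^sub>0 * v\<^sub>0 * exp (- \<theta>\<^sub>0) * wbar / 4 = p * wbar / 2" by (simp add: p_def)
    show ?case unfolding eq
      using divide_right_mono[OF less_imp_le[OF elim]] bound[of _ n] by (meson less_imp_le order.trans)
  qed
qed

lemma log_term_mono:
  assumes "0 < a" "a \<le> b"
  shows "log_term n a \<le> log_term n b"
  unfolding log_term_def
proof (rule avg_mono)
  fix i j assume "1 \<le> i" "i < j" "j \<le> n"
  then have "0 < gap n i j" by (rule gap_bounds)
  then show "ln (1 - exp (- 2 * a * gap n i j)) \<le> ln (1 - exp (- 2 * b * gap n i j))"
    using assms by (intro ln_mono) auto
qed

text \<open>The comparison point on the curve of constant product has a criterion bounded uniformly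
  in \<open>v\<close>, apart from terms common to both sides. Above \<open>b\<close> the increasing
  log term alone exceeds this bound; below \<open>a\<close> the residual term, of order
  \<open>1 / \<theta>\<close>, outweighs the logarithm.\<close>

lemma criterion_outside:
  assumes cd: "0 < c" "c \<le> d"
  obtains a b where "0 < a" "a \<le> \<theta>\<^sub>0 * v\<^sub>0 / d" "\<theta>\<^sub>0 * v\<^sub>0 / c \<le> b"
    "\<forall>\<^sub>F n in sequentially. \<forall>\<theta> v. 0 < \<theta> \<longrightarrow> \<theta> \<notin> {a..b} \<longrightarrow> v \<in> {c..d}
      \<longrightarrow> criterion n (\<theta>\<^sub>0 * v\<^sub>0 / v) v < criterion n \<theta> v"
proof -
  let ?\<kappa> = "\<theta>\<^sub>0 * v\<^sub>0"
  have kpos: "0 < ?\<kappa>" using rate_pos variance_pos by simp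
  define l where "l = ln (?\<kappa> / c / \<theta>\<^sub>0)"
  \<comment> \<open>Solves \<open>2 * e + e / c = wbar\<close>, which turns the upper bound
    \<open>wbar * l + wbar + e + e / c\<close> into \<open>wbar * l + 2 * wbar - e\<close>.\<close>
  define e where "e = wbar / (2 + 1 / c)"
  have den: "0 < 2 + 1 / c" using cd by (simp add: add_pos_pos)
  then have e: "0 < e" using wbar_pos by (simp add: e_def)
  have "e * (2 + 1 / c) = wbar" using den by (simp add: e_def)
  then have e_eq: "2 * e + e / c = wbar" by (simp add: algebra_simps)
  \<comment> \<open>The factor \<open>exp 3\<close> raises the log term to
    \<open>wbar * (l + 3) - e\<close>, above the upper bound by the margin
    \<open>wbar\<close>.\<close>
  define b where "b = ?\<kappa> / c * exp 3"
  have b: "?\<kappa> / c \<le> b" "0 < b" using kpos cd mult_left_mono[of 1 "exp 3" "?\<kappa> / c"] by (auto simp: b_def)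
  have lb: "ln (b / \<theta>\<^sub>0) = l + 3"
    using kpos cd rate_pos variance_pos by (simp add: b_def l_def ln_mult ln_div)
  define C where "C = ?\<kappa> * exp (- \<theta>\<^sub>0) * wbar / 4 / d"
  have "0 < C" using kpos wbar_pos cd by (simp add: C_def)
  \<comment> \<open>For rates below the true one the logarithm is negative and is multiplied by
    \<open>total_weight n\<close>, which is eventually below \<open>2 * wbar\<close>; hence the
    doubled coefficient.\<close>
  have "filterlim (\<lambda>\<theta>. 2 * wbar * ln (\<theta> / \<theta>\<^sub>0) + C / \<theta>) at_top (at_right 0)"
    using wbar_pos rate_pos \<open>0 < C\<close> by (intro log_plus_inverse_at_zero) auto
  then have "\<forall>\<^sub>F \<theta> in at_right 0. wbar * l + 2 * wbar < 2 * wbar * ln (\<theta> / \<theta>\<^sub>0) + C / \<theta>"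
    by (simp add: filterlim_at_top_dense)
  then obtain a0 where a0: "0 < a0" "\<And>\<theta>. 0 < \<theta> \<Longrightarrow> \<theta> < a0 \<Longrightarrow> wbar * l + 2 * wbar < 2 * wbar * ln (\<theta> / \<theta>\<^sub>0) + C / \<theta>"
    unfolding eventually_at_right_field by blast
  define a where "a = min a0 (min \<theta>\<^sub>0 (?\<kappa> / d))"
  have a: "0 < a" "a \<le> a0" "a \<le> \<theta>\<^sub>0" "a \<le> ?\<kappa> / d"
    using a0 rate_pos kpos cd by (auto simp: a_def)
  have kdc: "0 < ?\<kappa> / d" "?\<kappa> / d \<le> ?\<kappa> / c"
    using kpos cd by (auto intro!: divide_left_mono)
  have "(\<lambda>n. 2 * \<theta>\<^sub>0 * avg n (gap n)) \<longlonglongrightarrow> 2 * \<theta>\<^sub>0 * 0"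
    by (intro tendsto_intros gap_tendsto)
  then have gap_small: "\<forall>\<^sub>F n in sequentially. 2 * \<theta>\<^sub>0 * avg n (gap n) < e"
    using e by (auto dest: order_tendstoD)
  have weight_le: "\<forall>\<^sub>F n in sequentially. total_weight n < 2 * wbar"
    using order_tendstoD(2)[OF total_weight_tendsto] wbar_pos by simp
  have "\<forall>\<^sub>F n in sequentially. \<forall>\<theta> v. 0 < \<theta> \<longrightarrow> \<theta> \<notin> {a..b} \<longrightarrow> v \<in> {c..d}
      \<longrightarrow> criterion n (?\<kappa> / v) v < criterion n \<theta> v"
    using gap_small weight_le residual_term_small_rate residual_term_uniform[OF kdc e] log_term_uniform[OF kdc e]
      log_term_uniform[OF b(2) order_refl e]
  proof eventually_elim
    case (elim n)
    show ?case
    proof (intro allI impI)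
      fix \<theta> v :: real assume \<theta>: "0 < \<theta>" "\<theta> \<notin> {a..b}" and v: "v \<in> {c..d}"
      have vpos: "0 < v" using v cd by simp
      have kv: "?\<kappa> / v \<in> {?\<kappa> / d..?\<kappa> / c}"
        using v cd kpos by (auto intro!: divide_left_mono)
      have "residual_term n (?\<kappa> / v) \<le> wbar * v + e"
        using bspec[OF elim(4) kv] rate_pos variance_pos by (auto simp: abs_le_iff)
      then have "residual_term n (?\<kappa> / v) / v \<le> (wbar * v + e) / v"
        using vpos by (intro divide_right_mono) auto
      also have "\<dots> = wbar + e / v" using vpos by (simp add: add_divide_distrib)
      also have "e / v \<le> e / c" using v cd e by (intro divide_left_mono) auto
      finally have R: "residual_term n (?\<kappa> / v) / v \<le> wbar + e / c" by simp
      have "ln (?\<kappa> / v / \<theta>\<^sub>0) \<le> l"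
        unfolding l_def using kv variance_pos vpos rate_pos by (intro ln_mono divide_right_mono) auto
      then have "wbar * ln (?\<kappa> / v / \<theta>\<^sub>0) \<le> wbar * l"
        using wbar_pos by (intro mult_left_mono) auto
      then have "log_term n (?\<kappa> / v) \<le> log_term n \<theta>\<^sub>0 + wbar * l + e"
        using bspec[OF elim(5) kv] by (auto simp: abs_le_iff)
      then have upper: "log_term n (?\<kappa> / v) + residual_term n (?\<kappa> / v) / v
          \<le> log_term n \<theta>\<^sub>0 + wbar * l + 2 * wbar - e"
        using R e_eq by linarith
      have "log_term n \<theta>\<^sub>0 + wbar * l + 2 * wbar - e < log_term n \<theta> + residual_term n \<theta> / v"
      proof (cases "b < \<theta>")
        case True
        have "log_term n \<theta>\<^sub>0 + wbar * ln (b / \<theta>\<^sub>0) - e \<le> log_term n b"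
          using elim(6) by (auto simp: abs_le_iff)
        also have "\<dots> \<le> log_term n \<theta>" using True b by (intro log_term_mono) auto
        finally have "log_term n \<theta>\<^sub>0 + wbar * (l + 3) - e \<le> log_term n \<theta>" unfolding lb .
        moreover have "0 \<le> residual_term n \<theta> / v" using residual_term_nonneg[OF \<theta>(1)] vpos by simp
        moreover have "wbar * (l + 3) = wbar * l + 3 * wbar" by (simp add: algebra_simps)
        ultimately show ?thesis using wbar_pos by linarith
      next
        case False
        then have "\<theta> < a" using \<theta> by auto
        then have \<theta>a: "\<theta> < a0" "\<theta> \<le> \<theta>\<^sub>0" using a by auto
        have "ln (\<theta> / \<theta>\<^sub>0) \<le> 0" using \<theta> \<theta>a rate_pos by simp
        then have "2 * wbar * ln (\<theta> / \<theta>\<^sub>0) \<le> ln (\<theta> / \<theta>\<^sub>0) * total_weight n"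
          using elim(2) mult_left_mono_neg[of "total_weight n" "2 * wbar" "ln (\<theta> / \<theta>\<^sub>0)"]
          by (simp add: mult.commute)
        moreover have "(\<theta> + \<theta>\<^sub>0) * avg n (gap n) \<le> 2 * \<theta>\<^sub>0 * avg n (gap n)"
          using \<theta>a by (intro mult_right_mono avg_gap_nonneg) auto
        ultimately have "log_term n \<theta>\<^sub>0 + 2 * wbar * ln (\<theta> / \<theta>\<^sub>0) - e \<le> log_term n \<theta>"
          using log_term_diff_bound[OF \<theta>(1), of n] elim(1) by (simp only: abs_le_iff) linarith
        moreover have "C / \<theta> \<le> residual_term n \<theta> / v"
        proof -
          have r: "?\<kappa> * exp (- \<theta>\<^sub>0) * wbar / 4 / \<theta> \<le> residual_term n \<theta>"
            using elim(3) \<theta> \<theta>a by blast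
          have "C / \<theta> = ?\<kappa> * exp (- \<theta>\<^sub>0) * wbar / 4 / \<theta> / d" by (simp add: C_def)
          also have "\<dots> \<le> residual_term n \<theta> / d"
            using r cd by (intro divide_right_mono) auto
          also have "\<dots> \<le> residual_term n \<theta> / v"
            using v vpos residual_term_nonneg[OF \<theta>(1)] by (intro divide_left_mono) auto
          finally show ?thesis .
        qed
        ultimately show ?thesis using a0(2)[OF \<theta>(1) \<theta>a(1)] by linarith
      qed
      with upper show "criterion n (?\<kappa> / v) v < criterion n \<theta> v"
        by (simp add: criterion_def add_divide_distrib)
    qed
  qed
  then show ?thesis using that a b by blast
qed

end

section \<open>Consequences for minimizers\<close>

context observed_path
begin

context
  fixes J :: "(real \<times> real) set" and est :: "nat \<Rightarrow> real \<times> real"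
  assumes selection: "\<And>n. \<exists>\<psi>. is_arg_min (weighted_pair_loglik w s n z) (\<lambda>\<psi>. \<psi> \<in> J) \<psi> \<Longrightarrow>
    is_arg_min (weighted_pair_loglik w s n z) (\<lambda>\<psi>. \<psi> \<in> J) (est n)"
begin

lemma estimator_minimizes:
  assumes "0 < n" and "(\<theta>, v) \<in> J" "\<And>\<theta>' v'. (\<theta>', v') \<in> J \<Longrightarrow> criterion n \<theta> v \<le> criterion n \<theta>' v'"
  shows "est n \<in> J" "\<And>\<theta>' v'. (\<theta>', v') \<in> J \<Longrightarrow> criterion n (fst (est n)) (snd (est n)) \<le> criterion n \<theta>' v'"
proof -
  have "is_arg_min (weighted_pair_loglik w s n z) (\<lambda>\<psi>. \<psi> \<in> J) (\<theta>, v)"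
    using assms by (subst arg_min_iff_criterion) auto
  then have "is_arg_min (weighted_pair_loglik w s n z) (\<lambda>\<psi>. \<psi> \<in> J) (fst (est n), snd (est n))"
    using selection by auto
  then show "est n \<in> J" "\<And>\<theta>' v'. (\<theta>', v') \<in> J \<Longrightarrow> criterion n (fst (est n)) (snd (est n)) \<le> criterion n \<theta>' v'"
    unfolding arg_min_iff_criterion[OF assms(1)] by auto
qed

lemma estimator_minimizes_rectangle:
  assumes "J = {a..b} \<times> {c..d}" "0 < a" "a \<le> b" "0 < c" "c \<le> d" "0 < n"
  shows "fst (est n) \<in> {a..b}" "snd (est n) \<in> {c..d}"
    "\<And>\<theta>' v'. \<theta>' \<in> {a..b} \<Longrightarrow> v' \<in> {c..d} \<Longrightarrow> criterion n (fst (est n)) (snd (est n)) \<le> criterion n \<theta>' v'"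
proof -
  obtain \<theta> v where min: "\<theta> \<in> {a..b}" "v \<in> {c..d}"
    "\<And>\<theta>' v'. \<theta>' \<in> {a..b} \<Longrightarrow> v' \<in> {c..d} \<Longrightarrow> criterion n \<theta> v \<le> criterion n \<theta>' v'"
    using exists_minimizer_rectangle[OF assms(2-5)] by metis
  have "est n \<in> J" and *: "(\<theta>', v') \<in> J \<Longrightarrow> criterion n (fst (est n)) (snd (est n)) \<le> criterion n \<theta>' v'" for \<theta>' v'
    using estimator_minimizes[OF assms(6), of \<theta> v] min by (auto simp: assms(1))
  then show "fst (est n) \<in> {a..b}" "snd (est n) \<in> {c..d}"
    unfolding assms(1) by (auto simp: mem_Times_iff)
  show "criterion n (fst (est n)) (snd (est n)) \<le> criterion n \<theta>' v'" if "\<theta>' \<in> {a..b}" "v' \<in> {c..d}" for \<theta>' v'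
    using * that by (simp add: assms(1))
qed

text \<open>The two inequalities say exactly that the curve of true product meets the rectangle at
  every variance level in \<open>{c..d}\<close>.\<close>

lemma rectangle_consistent:
  assumes J: "J = {a..b} \<times> {c..d}" and pos: "0 < a" "a \<le> b" "0 < c" "c \<le> d"
    and "a * d \<le> \<theta>\<^sub>0 * v\<^sub>0" "\<theta>\<^sub>0 * v\<^sub>0 \<le> b * c"
  shows "(\<lambda>n. fst (est n) * snd (est n)) \<longlonglongrightarrow> \<theta>\<^sub>0 * v\<^sub>0"
proof (rule product_tendsto[OF pos])
  have kv: "\<theta>\<^sub>0 * v\<^sub>0 / v \<in> {a..b}" if "v \<in> {c..d}" for v
  proof -
    have "a * v \<le> a * d" "b * c \<le> b * v" using that pos by (auto intro: mult_left_mono)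
    then have "a * v \<le> \<theta>\<^sub>0 * v\<^sub>0" "\<theta>\<^sub>0 * v\<^sub>0 \<le> b * v" using assms(6,7) by auto
    then show ?thesis using that pos by (simp add: le_divide_eq divide_le_eq)
  qed
  show "\<forall>\<^sub>F n in sequentially. fst (est n) \<in> {a..b} \<and> snd (est n) \<in> {c..d}
      \<and> \<theta>\<^sub>0 * v\<^sub>0 / snd (est n) \<in> {a..b}
      \<and> criterion n (fst (est n)) (snd (est n)) \<le> criterion n (\<theta>\<^sub>0 * v\<^sub>0 / snd (est n)) (snd (est n))"
    using eventually_gt_at_top[of 0]
  proof eventually_elim
    case (elim n)
    note est = estimator_minimizes_rectangle[OF J pos elim]
    show ?case using est(1,2) kv[OF est(2)] est(3)[OF kv[OF est(2)] est(2)] by simp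
  qed
qed

text \<open>\<open>criterion_outside\<close> acts twice: it makes a minimiser on the compact
  rectangle global, so that the estimator is bound to minimise, and it forces every minimiser into
  that rectangle.\<close>

lemma half_strip_consistent:
  assumes J: "J = {0<..} \<times> {c..d}" and cd: "0 < c" "c \<le> d"
  shows "(\<lambda>n. fst (est n) * snd (est n)) \<longlonglongrightarrow> \<theta>\<^sub>0 * v\<^sub>0"
proof -
  obtain a b where ab: "0 < a" "a \<le> \<theta>\<^sub>0 * v\<^sub>0 / d" "\<theta>\<^sub>0 * v\<^sub>0 / c \<le> b"
    and out: "\<forall>\<^sub>F n in sequentially. \<forall>\<theta> v. 0 < \<theta> \<longrightarrow> \<theta> \<notin> {a..b} \<longrightarrow> v \<in> {c..d}
      \<longrightarrow> criterion n (\<theta>\<^sub>0 * v\<^sub>0 / v) v < criterion n \<theta> v"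
    by (rule criterion_outside[OF cd])
  have kv: "\<theta>\<^sub>0 * v\<^sub>0 / v \<in> {a..b}" if "v \<in> {c..d}" for v
  proof -
    have "\<theta>\<^sub>0 * v\<^sub>0 / d \<le> \<theta>\<^sub>0 * v\<^sub>0 / v" "\<theta>\<^sub>0 * v\<^sub>0 / v \<le> \<theta>\<^sub>0 * v\<^sub>0 / c"
      using that cd rate_pos variance_pos by (auto intro!: divide_left_mono)
    then show ?thesis using ab by simp
  qed
  have "a \<le> b" using kv[of c] cd by simp
  note pos = ab(1) this cd
  show ?thesis
  proof (rule product_tendsto[OF pos])
    show "\<forall>\<^sub>F n in sequentially. fst (est n) \<in> {a..b} \<and> snd (est n) \<in> {c..d}
      \<and> \<theta>\<^sub>0 * v\<^sub>0 / snd (est n) \<in> {a..b}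
      \<and> criterion n (fst (est n)) (snd (est n)) \<le> criterion n (\<theta>\<^sub>0 * v\<^sub>0 / snd (est n)) (snd (est n))"
      using out eventually_gt_at_top[of 0]
    proof eventually_elim
      case (elim n)
      obtain \<theta> v where min: "\<theta> \<in> {a..b}" "v \<in> {c..d}"
        "\<And>\<theta>' v'. \<theta>' \<in> {a..b} \<Longrightarrow> v' \<in> {c..d} \<Longrightarrow> criterion n \<theta> v \<le> criterion n \<theta>' v'"
        using exists_minimizer_rectangle[OF pos] by metis
      have "(\<theta>, v) \<in> J" using min ab by (simp add: J)
      moreover have "criterion n \<theta> v \<le> criterion n \<theta>' v'" if "(\<theta>', v') \<in> J" for \<theta>' v'
      proof (cases "\<theta>' \<in> {a..b}")
        case False
        then have "criterion n (\<theta>\<^sub>0 * v\<^sub>0 / v') v' < criterion n \<theta>' v'"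
          using elim(1) that by (simp add: J)
        then show ?thesis using min(3)[OF kv, of v' v'] that by (simp add: J)
      qed (use min that J in simp)
      ultimately have est: "est n \<in> J"
        "\<And>\<theta>' v'. (\<theta>', v') \<in> J \<Longrightarrow> criterion n (fst (est n)) (snd (est n)) \<le> criterion n \<theta>' v'"
        using estimator_minimizes[OF elim(2)] by blast+
      then have v: "snd (est n) \<in> {c..d}" "0 < fst (est n)" by (auto simp: J mem_Times_iff)
      have "(\<theta>\<^sub>0 * v\<^sub>0 / snd (est n), snd (est n)) \<in> J"
        using kv[OF v(1)] v ab by (simp add: J)
      from est(2)[OF this]
      have le: "criterion n (fst (est n)) (snd (est n)) \<le> criterion n (\<theta>\<^sub>0 * v\<^sub>0 / snd (est n)) (snd (est n))" .
      moreover have "fst (est n) \<in> {a..b}"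
        using elim(1) v le by (meson not_less)
      ultimately show ?case using v kv by blast
    qed
  qed
qed

text \<open>With so large a marginal term the unconstrained optimal variance is at least
  \<open>d\<close> whatever the rate, so the estimate sits on the upper edge.\<close>

lemma rectangle_product_ge:
  assumes J: "J = {a..b} \<times> {c..d}" and pos: "0 < a" "a \<le> b" "0 < c" "c \<le> d"
    and n: "0 < n" "0 < total_weight n" and A: "2 * d * total_weight n \<le> marginal_term n"
  shows "a * d \<le> fst (est n) * snd (est n)"
proof -
  note est = estimator_minimizes_rectangle[OF J pos n(1)]
  have "snd (est n) = d"
  proof (rule ccontr)
    assume "snd (est n) \<noteq> d"
    then have lt: "snd (est n) < d" "0 < snd (est n)" using est(2) pos by auto
    have "2 * total_weight n * d \<le> marginal_term n + residual_term n (fst (est n))"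
      using A residual_term_nonneg[of "fst (est n)" n] est(1) pos by (simp add: algebra_simps)
    from log_plus_inverse_antimono[OF n(2) lt(2,1) this]
    have "criterion n (fst (est n)) d < criterion n (fst (est n)) (snd (est n))"
      by (simp add: criterion_def)
    then show False using est(3)[OF est(1), of d] pos by simp
  qed
  then show ?thesis using est(1) pos by (auto intro!: mult_right_mono)
qed

text \<open>The estimated variance is at most the larger of \<open>c\<close> and the unconstrained
  optimum \<open>u\<close>. Since \<open>t * residual_term n t\<close> is close to
  \<open>wbar\<close> times the true product, \<open>t * u\<close> is close to half that product
  plus the contribution of the small marginal term.\<close>

lemma rectangle_product_le:
  assumes J: "J = {a..b} \<times> {c..d}" and pos: "0 < a" "a \<le> b" "0 < c" "c \<le> d"
  shows "\<forall>\<^sub>F n in sequentially. marginal_term n \<le> \<theta>\<^sub>0 * v\<^sub>0 / (4 * b) * total_weight n \<longrightarrow>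
    fst (est n) * snd (est n) \<le> max (b * c) (7 / 8 * (\<theta>\<^sub>0 * v\<^sub>0))"
proof -
  let ?\<kappa> = "\<theta>\<^sub>0 * v\<^sub>0"
  have kpos: "0 < ?\<kappa>" using rate_pos variance_pos by simp
  \<comment> \<open>In units of the true product: the marginal term contributes 1/4 of
    \<open>total_weight n\<close>, the residual 5/4 of \<open>wbar\<close>, which is at most 3/2 of
    \<open>total_weight n\<close> by the bound 5/6 below. Half of 1/4 + 3/2 is 7/8.\<close>
  define e where "e = wbar * ?\<kappa> / (4 * b)"
  have e: "0 < e" using kpos wbar_pos pos by (simp add: e_def)
  have "5 / 6 * wbar < wbar" using wbar_pos by simp
  from order_tendstoD(1)[OF total_weight_tendsto this]
    residual_term_uniform[OF pos(1,2) e] eventually_gt_at_top[of 0]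
  show ?thesis
  proof eventually_elim
    case (elim n)
    show ?case
    proof
      assume A: "marginal_term n \<le> ?\<kappa> / (4 * b) * total_weight n"
      note est = estimator_minimizes_rectangle[OF J pos elim(3)]
      define t where "t = fst (est n)"
      define v where "v = snd (est n)"
      define u where "u = (marginal_term n + residual_term n t) / (2 * total_weight n)"
      have m: "0 < total_weight n" using elim(1) wbar_pos by simp
      have t: "t \<in> {a..b}" "0 < t" and v: "v \<in> {c..d}" using est pos by (auto simp: t_def v_def)
      have "v \<le> max c u"
      proof (rule ccontr)
        assume "\<not> v \<le> max c u"
        then have lt: "max c u < v" by (simp only: not_le)
        have "marginal_term n + residual_term n t = 2 * total_weight n * u"
          using m by (simp add: u_def)
        also have "\<dots> \<le> 2 * total_weight n * max c u" using m by (intro mult_left_mono) auto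
        finally have "criterion n t (max c u) < criterion n t v"
          using log_plus_inverse_mono[OF m _ lt] pos by (simp add: criterion_def)
        moreover have "max c u \<in> {c..d}" using lt v by auto
        ultimately show False using est(3)[OF est(1), of "max c u"] by (simp add: t_def v_def)
      qed
      then have "t * v \<le> t * max c u" using t by (intro mult_left_mono) auto
      also have "\<dots> = max (t * c) (t * u)" using t by (simp add: max_mult_distrib_left)
      also have "\<dots> \<le> max (b * c) (7 / 8 * ?\<kappa>)"
      proof (rule max.mono)
        show "t * c \<le> b * c" using t pos by (intro mult_right_mono) auto
        have "t * marginal_term n \<le> b * (?\<kappa> / (4 * b) * total_weight n)"
          using A t pos marginal_term_nonneg by (intro mult_mono) auto
        then have 1: "t * marginal_term n \<le> ?\<kappa> * total_weight n / 4" using pos by simp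
        have "residual_term n t \<le> wbar * ?\<kappa> / t + e"
          using bspec[OF elim(2) t(1)] by (auto simp: abs_le_iff)
        then have "t * residual_term n t \<le> t * (wbar * ?\<kappa> / t + e)" using t by (intro mult_left_mono) auto
        also have "\<dots> = wbar * ?\<kappa> + t * e" using t by (simp add: distrib_left)
        also have "t * e \<le> b * e" using t e by (intro mult_right_mono) auto
        also have "b * e = wbar * ?\<kappa> / 4" using pos by (simp add: e_def)
        finally have 2: "t * residual_term n t \<le> 5 / 4 * (wbar * ?\<kappa>)" by (simp add: ac_simps)
        have "5 / 6 * wbar * ?\<kappa> \<le> total_weight n * ?\<kappa>" using elim(1) kpos by (intro mult_right_mono) auto
        then have 3: "5 / 4 * (wbar * ?\<kappa>) \<le> 3 / 2 * (total_weight n * ?\<kappa>)" by (simp add: ac_simps)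
        have "t * u = (t * marginal_term n + t * residual_term n t) / (2 * total_weight n)"
          by (simp add: u_def distrib_left)
        also have "\<dots> \<le> (?\<kappa> * total_weight n / 4 + 3 / 2 * (total_weight n * ?\<kappa>)) / (2 * total_weight n)"
          using 1 order.trans[OF 2 3] m by (intro divide_right_mono add_mono) auto
        also have "\<dots> = 7 / 8 * ?\<kappa>" using m by (simp add: field_simps)
        finally show "t * u \<le> 7 / 8 * ?\<kappa>" .
      qed
      finally show "fst (est n) * snd (est n) \<le> max (b * c) (7 / 8 * ?\<kappa>)"
        by (simp add: t_def v_def)
    qed
  qed
qed

text \<open>Without a ceiling on the variance, the optimum is at least the marginal term over twice
  the total weight, so a large marginal term drives the product beyond any bound.\<close>

lemma strip_product_ge:
  assumes J: "J = {a..b} \<times> {0<..}" and pos: "0 < a" "a \<le> b"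
    and n: "0 < n" "0 < total_weight n"
    and A: "0 < marginal_term n" "2 * C / a * total_weight n \<le> marginal_term n"
  shows "C \<le> fst (est n) * snd (est n)"
proof -
  obtain \<theta> v where min: "\<theta> \<in> {a..b}" "0 < v"
    "\<And>\<theta>' v'. \<theta>' \<in> {a..b} \<Longrightarrow> 0 < v' \<Longrightarrow> criterion n \<theta> v \<le> criterion n \<theta>' v'"
    using exists_minimizer_strip[OF pos n(2) A(1)] by metis
  have "est n \<in> J" and est: "(\<theta>', v') \<in> J \<Longrightarrow> criterion n (fst (est n)) (snd (est n)) \<le> criterion n \<theta>' v'" for \<theta>' v'
    using estimator_minimizes[OF n(1), of \<theta> v] min by (auto simp: J)
  then have t: "fst (est n) \<in> {a..b}" "0 < fst (est n)" and v: "0 < snd (est n)"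
    using pos by (auto simp: J mem_Times_iff)
  define u where "u = (marginal_term n + residual_term n (fst (est n))) / (2 * total_weight n)"
  have u: "marginal_term n / (2 * total_weight n) \<le> u"
    unfolding u_def using n residual_term_nonneg[OF t(2), of n] by (intro divide_right_mono) auto
  have "u \<le> snd (est n)"
  proof (rule ccontr)
    assume "\<not> u \<le> snd (est n)"
    then have lt: "snd (est n) < u" by simp
    have "2 * total_weight n * u \<le> marginal_term n + residual_term n (fst (est n))"
      using n by (simp add: u_def)
    from log_plus_inverse_antimono[OF n(2) v lt this]
    have "criterion n (fst (est n)) u < criterion n (fst (est n)) (snd (est n))"
      by (simp add: criterion_def)
    moreover have "(fst (est n), u) \<in> J" using t v lt by (simp add: J)
    ultimately show False using est by fastforce
  qed
  moreover have "C / a \<le> marginal_term n / (2 * total_weight n)"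
    using A(2) n by (simp add: le_divide_eq mult.commute mult.left_commute)
  ultimately have "C / a \<le> snd (est n)" using u by linarith
  then have "C \<le> a * snd (est n)" using pos by (simp add: divide_le_eq mult.commute)
  also have "\<dots> \<le> fst (est n) * snd (est n)" using t v by (intro mult_right_mono) auto
  finally show ?thesis .
qed

end

end

section \<open>Quadratic forms of the process take large and small values\<close>

text \<open>Separability of the continuous functions on [0,1] in the supremum norm: the
  approximating step functions are coded by the countable type
  \<open>nat \<times> rat list\<close>.\<close>

lemma uniformly_close_step_function:
  fixes f :: "real \<Rightarrow> real"
  assumes "continuous_on {0..1} f" "0 < e"
  obtains m :: nat and qs :: "rat list"
  where "\<And>t::real. t \<in> {0..1} \<Longrightarrow> \<bar>f t - of_rat (qs ! nat \<lfloor>m * t\<rfloor>)\<bar> \<le> e"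
proof -
  have "uniformly_continuous_on {0..1} f"
    using assms(1) compact_uniformly_continuous by blast
  then obtain \<delta> where \<delta>: "0 < \<delta>"
    "\<And>x y. x \<in> {0..1} \<Longrightarrow> y \<in> {0..1} \<Longrightarrow> dist y x < \<delta> \<Longrightarrow> dist (f y) (f x) < e / 2"
    unfolding uniformly_continuous_on_def using assms(2) by (meson half_gt_zero)
  obtain m :: nat where m: "0 < m" "1 / m < \<delta>"
    using \<delta>(1) by (metis nat_approx_posE less_trans zero_less_Suc)
  have "\<exists>q::rat. \<bar>f (k / m) - of_rat q\<bar> < e / 2" for k :: nat
  proof -
    obtain r where "r \<in> \<rat>" and r: "f (k / m) - e / 2 < r" "r < f (k / m) + e / 2"
      using Rats_dense_in_real[of "f (k / m) - e / 2" "f (k / m) + e / 2"] assms(2) by auto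
    then obtain q where "r = of_rat q" by (auto elim: Rats_cases)
    moreover have "\<bar>f (k / m) - r\<bar> < e / 2" using r by linarith
    ultimately show ?thesis by blast
  qed
  then obtain q :: "nat \<Rightarrow> rat" where q: "\<And>k. \<bar>f (k / m) - of_rat (q k)\<bar> < e / 2"
    by metis
  show ?thesis
  \<comment> \<open>There are \<open>Suc m\<close> entries because the time 1 has index
    \<open>m\<close>.\<close>
  proof (rule that[where m = m and qs = "map q [0..<Suc m]"])
    fix t :: real assume t: "t \<in> {0..1}"
    define k where "k = nat \<lfloor>m * t\<rfloor>"
    have k: "real k \<le> m * t" "m * t < real k + 1"
      using t m unfolding k_def by (simp_all add: of_nat_nat)
    have "real m * t \<le> real m * 1" using t by (intro mult_left_mono) auto
    then have "k \<le> m" using k by linarith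
    have km: "k / m \<in> {0..1}" using \<open>k \<le> m\<close> m by (simp add: divide_le_eq)
    have "k / m \<le> t" "t \<le> (real k + 1) / m"
      using k m by (simp_all add: divide_le_eq le_divide_eq mult.commute)
    then have "\<bar>t - k / m\<bar> \<le> 1 / m"
      by (simp add: add_divide_distrib)
    then have "dist t (k / m) < \<delta>" using m by (simp add: dist_real_def)
    then have "\<bar>f t - f (k / m)\<bar> < e / 2"
      using \<delta>(2)[OF km t] by (simp add: dist_real_def)
    then have "\<bar>f t - of_rat (q k)\<bar> \<le> e" using q[of k] by linarith
    moreover have "map q [0..<Suc m] ! k = q k"
      using \<open>k \<le> m\<close> by (simp del: upt_Suc)
    ultimately show "\<bar>f t - of_rat (map q [0..<Suc m] ! nat \<lfloor>m * t\<rfloor>)\<bar> \<le> e"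
      unfolding k_def[symmetric] by metis
  qed
qed

context ornstein_uhlenbeck
begin

lemma combination_iexp:
  fixes x :: "'i \<Rightarrow> real"
  assumes "finite I" and "x ` I \<subseteq> {0..1}"
  shows "(CLINT \<omega>|M. iexp (t * (\<Sum>i\<in>I. c i * Z (x i) \<omega>)))
    = complex_of_real (exp (- t\<^sup>2 * expectation (\<lambda>\<omega>. (\<Sum>i\<in>I. c i * Z (x i) \<omega>)\<^sup>2) / 2))"
proof -
  have eq: "(\<Sum>i\<in>I. (t * c i) * Z (x i) \<omega>) = t * (\<Sum>i\<in>I. c i * Z (x i) \<omega>)" for \<omega>
    by (simp add: sum_distrib_left mult.assoc)
  from centered_gaussian_rv_char[OF centered_combination(1,2)[OF assms, of "\<lambda>i. t * c i"]]
  show ?thesis unfolding eq by (simp add: power_mult_distrib)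
qed

text \<open>By convexity the weighted mean of squares dominates the square of the weighted mean. The
  latter is that of a Gaussian variable with variance at least
  \<open>v\<^sub>0 * exp (- \<theta>\<^sub>0)\<close>, because times in [0,1] are at most 1
  apart.\<close>

lemma quadratic_form_large:
  fixes x :: "'i \<Rightarrow> real"
  assumes I: "finite I" "x ` I \<subseteq> {0..1}" and q: "\<And>i. i \<in> I \<Longrightarrow> 0 \<le> q i" "(\<Sum>i\<in>I. q i) = 1"
    and C: "0 \<le> C"
  shows "measure std_normal_distribution {sqrt C / sqrt (v\<^sub>0 * exp (- \<theta>\<^sub>0))<..}
    \<le> prob {\<omega> \<in> space M. C < (\<Sum>i\<in>I. q i * (Z (x i) \<omega>)\<^sup>2)}"
proof -
  note comb = centered_combination[OF I, of q]
  have [measurable]: "i \<in> I \<Longrightarrow> Z (x i) \<in> borel_measurable M" for i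
    using I by (intro measurable_Z) auto
  have "v\<^sub>0 * exp (- \<theta>\<^sub>0) = (\<Sum>i\<in>I. \<Sum>j\<in>I. q i * q j * (v\<^sub>0 * exp (- \<theta>\<^sub>0)))"
    using q(2) by (simp add: sum_distrib_right[symmetric] sum_product[symmetric])
  also have "\<dots> \<le> (\<Sum>i\<in>I. \<Sum>j\<in>I. q i * q j * (v\<^sub>0 * exp (- \<theta>\<^sub>0 * \<bar>x i - x j\<bar>)))"
  proof (intro sum_mono mult_left_mono)
    fix i j assume "i \<in> I" "j \<in> I"
    then have "x i \<in> {0..1}" "x j \<in> {0..1}" using I by auto
    then have "\<bar>x i - x j\<bar> \<le> 1" by auto
    then have "\<theta>\<^sub>0 * \<bar>x i - x j\<bar> \<le> \<theta>\<^sub>0 * 1" using rate_pos by (intro mult_left_mono) auto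
    then show "exp (- \<theta>\<^sub>0) \<le> exp (- \<theta>\<^sub>0 * \<bar>x i - x j\<bar>)" by simp
  qed (use q variance_pos in auto)
  finally have var: "v\<^sub>0 * exp (- \<theta>\<^sub>0) \<le> expectation (\<lambda>\<omega>. (\<Sum>i\<in>I. q i * Z (x i) \<omega>)\<^sup>2)"
    unfolding comb(3) .
  have "measure std_normal_distribution {sqrt C / sqrt (v\<^sub>0 * exp (- \<theta>\<^sub>0))<..}
      \<le> prob {\<omega> \<in> space M. sqrt C < \<bar>\<Sum>i\<in>I. q i * Z (x i) \<omega>\<bar>}"
    using C variance_pos by (intro centered_gaussian_rv_tail_ge comb var) auto
  also have "\<dots> \<le> prob {\<omega> \<in> space M. C < (\<Sum>i\<in>I. q i * (Z (x i) \<omega>)\<^sup>2)}"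
  proof (rule finite_measure_mono)
    have "C < (\<Sum>i\<in>I. q i * (z i)\<^sup>2)" if "sqrt C < \<bar>\<Sum>i\<in>I. q i * z i\<bar>" for z :: "'i \<Rightarrow> real"
    proof -
      define m where "m = (\<Sum>i\<in>I. q i * z i)"
      have "0 \<le> (\<Sum>i\<in>I. q i * (z i - m)\<^sup>2)"
        using q by (intro sum_nonneg mult_nonneg_nonneg) auto
      also have "\<dots> = (\<Sum>i\<in>I. q i * (z i)\<^sup>2 - 2 * m * (q i * z i) + m\<^sup>2 * q i)"
        by (simp add: power2_diff algebra_simps)
      also have "\<dots> = (\<Sum>i\<in>I. q i * (z i)\<^sup>2) - 2 * m * (\<Sum>i\<in>I. q i * z i) + m\<^sup>2 * (\<Sum>i\<in>I. q i)"
        by (simp add: sum.distrib sum_subtractf sum_distrib_left)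
      also have "\<dots> = (\<Sum>i\<in>I. q i * (z i)\<^sup>2) - m\<^sup>2"
        using q(2) by (simp add: m_def power2_eq_square)
      finally have "m\<^sup>2 \<le> (\<Sum>i\<in>I. q i * (z i)\<^sup>2)" by simp
      moreover have "(sqrt C)\<^sup>2 < \<bar>m\<bar>\<^sup>2"
        using that C unfolding m_def by (intro power_strict_mono) auto
      ultimately show ?thesis using C by simp
    qed
    then show "{\<omega> \<in> space M. sqrt C < \<bar>\<Sum>i\<in>I. q i * Z (x i) \<omega>\<bar>}
      \<subseteq> {\<omega> \<in> space M. C < (\<Sum>i\<in>I. q i * (Z (x i) \<omega>)\<^sup>2)}" by auto
  qed measurable
  finally show ?thesis .
qed

text \<open>Countably many balls around step functions cover almost all paths, so one of them has
  positive probability. Two paths in it differ by at most the diameter.\<close>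

lemma exists_path_ball:
  assumes "0 < e"
  obtains E where "E \<in> sets M" "0 < prob E"
    "\<And>\<omega> \<omega>' (t::real). \<omega> \<in> E \<Longrightarrow> \<omega>' \<in> E \<Longrightarrow> t \<in> {0..1} \<Longrightarrow> \<bar>Z t \<omega> - Z t \<omega>'\<bar> \<le> e"
proof -
  have "AE \<omega> in M. continuous_on {0..1} (\<lambda>t. Z t \<omega>)"
    using ou by (simp add: ou_process_def)
  then obtain N where N: "N \<in> null_sets M" "\<And>\<omega>. \<omega> \<in> space M - N \<Longrightarrow> continuous_on {0..1} (\<lambda>t. Z t \<omega>)"
    by (auto elim!: AE_E3)
  obtain T where T: "countable T" "T \<subseteq> {0..1}" and dense: "{0..1} \<subseteq> closure (T :: real set)"
    using separable[of "{0..1 :: real}"] by metis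
  then have dense: "closure T = {0..1}"
    using closure_minimal[OF T(2)] by auto
  \<comment> \<open>Testing closeness only at the countable dense set \<open>T\<close> keeps
    \<open>F p\<close> measurable. Continuity off the null set \<open>N\<close> later extends the
    bound on differences of paths to all times.\<close>
  define F where "F p = {\<omega> \<in> space M. \<forall>t\<in>T. \<bar>Z t \<omega> - of_rat (snd p ! nat \<lfloor>real (fst p) * t\<rfloor>)\<bar> \<le> e / 2}"
    for p :: "nat \<times> rat list"
  have F [measurable]: "F p \<in> sets M" for p
  proof -
    have [measurable]: "t \<in> T \<Longrightarrow> Z t \<in> borel_measurable M" for t
      using T by (intro measurable_Z) auto
    show ?thesis unfolding F_def using T(1) by measurable
  qed
  have cover: "space M - N \<subseteq> (\<Union>p. F p)"
  proof
    fix \<omega> assume \<omega>: "\<omega> \<in> space M - N"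
    obtain m qs where "\<And>t::real. t \<in> {0..1} \<Longrightarrow> \<bar>Z t \<omega> - of_rat (qs ! nat \<lfloor>real m * t\<rfloor>)\<bar> \<le> e / 2"
      by (rule uniformly_close_step_function[OF N(2)[OF \<omega>], of "e / 2"]) (use assms in auto)
    then have "\<omega> \<in> F (m, qs)" using \<omega> T by (auto simp: F_def)
    then show "\<omega> \<in> (\<Union>p. F p)" by blast
  qed
  have "\<exists>p. 0 < prob (F p)"
  proof (rule ccontr)
    assume "\<not> (\<exists>p. 0 < prob (F p))"
    then have "F p \<in> null_sets M" for p
      using F[of p] by (cases p) (auto simp: null_sets_def emeasure_eq_measure zero_less_measure_iff)
    then have "(\<Union>p. F p) \<union> N \<in> null_sets M"
      using N(1) by (intro null_sets.Un null_sets_UN') auto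
    then have "prob ((\<Union>p. F p) \<union> N) = 0" by (simp add: measure_eq_0_null_sets)
    moreover have "prob (space M) \<le> prob ((\<Union>p. F p) \<union> N)"
      using cover N(1) by (intro finite_measure_mono) auto
    ultimately show False by (simp add: prob_space)
  qed
  then obtain p where p: "0 < prob (F p)" by blast
  show ?thesis
  proof (rule that[of "F p - N"])
    show "F p - N \<in> sets M" using N(1) by auto
    show "0 < prob (F p - N)" using p N(1) by (simp add: measure_Diff_null_set)
    fix \<omega> \<omega>' t assume \<omega>: "\<omega> \<in> F p - N" "\<omega>' \<in> F p - N" and t: "t \<in> {0..1::real}"
    have "continuous_on (closure T) (\<lambda>t. \<bar>Z t \<omega> - Z t \<omega>'\<bar>)"
      unfolding dense using \<omega> by (intro continuous_intros N(2)) (auto simp: F_def)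
    then show "\<bar>Z t \<omega> - Z t \<omega>'\<bar> \<le> e"
    proof (rule continuous_le_on_closure)
      show "t \<in> closure T" using t by (simp add: dense)
      fix u assume "u \<in> T"
      then have "\<bar>Z u \<omega> - of_rat (snd p ! nat \<lfloor>real (fst p) * u\<rfloor>)\<bar> \<le> e / 2"
        "\<bar>Z u \<omega>' - of_rat (snd p ! nat \<lfloor>real (fst p) * u\<rfloor>)\<bar> \<le> e / 2"
        using \<omega> by (auto simp: F_def)
      then show "\<bar>Z u \<omega> - Z u \<omega>'\<bar> \<le> e" by linarith
    qed
  qed
qed

text \<open>If \<open>Z'\<close> is an independent copy of \<open>Z\<close>, then \<open>(Z - Z') / \<surd>2\<close> has the characteristic function
  of \<open>Z\<close>, and it is uniformly small as soon as both paths lie in a common small ball.\<close>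

lemma quadratic_form_small:
  assumes "0 < e"
  obtains p where "0 < p" "\<And>I (x :: nat \<Rightarrow> real) q. finite I \<Longrightarrow> x ` I \<subseteq> {0..1} \<Longrightarrow> (\<And>i. i \<in> I \<Longrightarrow> 0 \<le> q i) \<Longrightarrow>
    (\<Sum>i\<in>I. q i) = 1 \<Longrightarrow> p \<le> prob {\<omega> \<in> space M. (\<Sum>i\<in>I. q i * (Z (x i) \<omega>)\<^sup>2) \<le> e}"
proof -
  obtain E where E: "E \<in> sets M" "0 < prob E"
    "\<And>\<omega> \<omega>' (t::real). \<omega> \<in> E \<Longrightarrow> \<omega>' \<in> E \<Longrightarrow> t \<in> {0..1} \<Longrightarrow> \<bar>Z t \<omega> - Z t \<omega>'\<bar> \<le> sqrt e"
    using exists_path_ball[of "sqrt e"] assms by auto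
  \<comment> \<open>With \<open>l\<close> such that \<open>exp (- l * e / 4) = r\<close>: on
    \<open>E \<times> E\<close> the symmetrised form is at most \<open>e / 2\<close>, so its Laplace
    transform at \<open>l\<close> is at least \<open>r * (prob E)\<^sup>2\<close>, that is
    \<open>2 * r\<^sup>2\<close>. The original form has the same transform, and where it exceeds
    \<open>e\<close> it contributes at most \<open>r\<^sup>2\<close>. The other
    \<open>r\<^sup>2\<close> bounds the wanted probability.\<close>
  define r where "r = (prob E)\<^sup>2 / 2"
  have "(prob E)\<^sup>2 \<le> 1" by (simp add: power_le_one)
  then have r: "0 < r" "r < 1" using E(2) by (auto simp: r_def)
  define l where "l = - ln r * 4 / e"
  have l: "0 < l" unfolding l_def using r assms by (intro divide_pos_pos mult_pos_pos) auto
  have el: "exp (- l * e / 4) = r" using r assms by (simp add: l_def)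
  show ?thesis
  proof (rule that[of "r\<^sup>2"])
    show "0 < r\<^sup>2" using r by simp
    fix I :: "nat set" and x q :: "nat \<Rightarrow> real"
    assume I: "finite I" "x ` I \<subseteq> {0..1}" and q: "\<And>i. i \<in> I \<Longrightarrow> (0::real) \<le> q i" "(\<Sum>i\<in>I. q i) = 1"
    note laplace_M = laplace_sum_squares
    note finite_M = integrable_const_bound emeasure_eq_measure prob_space
    have times_E: "measure (M \<Otimes>\<^sub>M M) (E \<times> E) = prob E * prob E"
      using emeasure_pair_measure_Times[OF E(1) E(1)]
      by (simp add: measure_def enn2real_mult)
    interpret pair_prob_space M M ..
    have xi: "x i \<in> {0..1}" if "i \<in> I" for i using that I by auto
    have [measurable]: "i \<in> I \<Longrightarrow> Z (x i) \<in> borel_measurable M" for i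
      using xi by (intro measurable_Z) auto
    \<comment> \<open>Absorbs \<open>l\<close> and the weights, so that
      \<open>l * A \<omega>\<close> is a plain sum of squares as in
      \<open>laplace_sum_squares\<close>.\<close>
    define h where "h i = sqrt (l * q i)" for i
    have h2: "(h i)\<^sup>2 = l * q i" if "i \<in> I" for i using l q(1)[OF that] by (simp add: h_def)
    define S where "S g \<omega> = (\<Sum>i\<in>I. (g i * h i) * Z (x i) \<omega>)" for g \<omega>
    define V where "V g = (\<integral>\<omega>. (S g \<omega>)\<^sup>2 \<partial>M)" for g
    have S_meas [measurable]: "S g \<in> borel_measurable M" for g unfolding S_def by measurable
    have char: "(CLINT \<omega>|M. iexp (t * S g \<omega>)) = complex_of_real (exp (- t\<^sup>2 * V g / 2))" for t g
      unfolding S_def V_def by (rule combination_iexp[OF I])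
    define A where "A \<omega> = (\<Sum>i\<in>I. q i * (Z (x i) \<omega>)\<^sup>2)" for \<omega>
    define A' where "A' \<omega> = (\<Sum>i\<in>I. q i * ((Z (x i) (fst \<omega>) - Z (x i) (snd \<omega>)) / sqrt 2)\<^sup>2)" for \<omega>
    have A_meas [measurable]: "A \<in> borel_measurable M" unfolding A_def by measurable
    have A'_meas [measurable]: "A' \<in> borel_measurable (M \<Otimes>\<^sub>M M)" unfolding A'_def by measurable
    have A0: "0 \<le> A \<omega>" for \<omega> unfolding A_def using q by (intro sum_nonneg) auto
    have A'0: "0 \<le> A' \<omega>" for \<omega> unfolding A'_def using q by (intro sum_nonneg) auto
    have "(\<integral>\<omega>. exp (- (\<Sum>i\<in>I. (h i * Z (x i) \<omega>)\<^sup>2) / 2) \<partial>M) = (\<integral>g. exp (- V g / 2) \<partial>std_normal_vector I)"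
      by (rule laplace_M[OF I(1)])
        (use char[of 1] in \<open>simp_all add: S_def mult.assoc\<close>)
    moreover have "(\<Sum>i\<in>I. (h i * Z (x i) \<omega>)\<^sup>2) = l * A \<omega>" for \<omega>
      unfolding A_def sum_distrib_left by (intro sum.cong refl) (simp add: power_mult_distrib h2)
    ultimately have 1: "(\<integral>\<omega>. exp (- (l * A \<omega>) / 2) \<partial>M) = (\<integral>g. exp (- V g / 2) \<partial>std_normal_vector I)"
      by simp
    have "(\<integral>\<omega>. exp (- (\<Sum>i\<in>I. (h i * ((Z (x i) (fst \<omega>) - Z (x i) (snd \<omega>)) / sqrt 2))\<^sup>2) / 2) \<partial>(M \<Otimes>\<^sub>M M))
        = (\<integral>g. exp (- V g / 2) \<partial>std_normal_vector I)"
    proof (rule P.laplace_sum_squares[OF I(1)])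
      show "(CLINT \<omega>|M \<Otimes>\<^sub>M M. iexp (\<Sum>i\<in>I. g i * (h i * ((Z (x i) (fst \<omega>) - Z (x i) (snd \<omega>)) / sqrt 2))))
        = complex_of_real (exp (- V g / 2))" for g
      proof -
        have eq: "(\<Sum>i\<in>I. g i * (h i * ((Z (x i) (fst \<omega>) - Z (x i) (snd \<omega>)) / sqrt 2)))
          = (1 / sqrt 2) * S g (fst \<omega>) + (- 1 / sqrt 2) * S g (snd \<omega>)" for \<omega> :: "'a \<times> 'a"
          unfolding S_def sum_distrib_left sum.distrib[symmetric]
          by (intro sum.cong refl) (simp add: field_simps)
        have int: "integrable (M \<Otimes>\<^sub>M M) (\<lambda>\<omega>. iexp ((1 / sqrt 2) * S g (fst \<omega>) + (- 1 / sqrt 2) * S g (snd \<omega>)))"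
          by (rule P.integrable_iexp) auto
        have "(CLINT \<omega>|M \<Otimes>\<^sub>M M. iexp ((1 / sqrt 2) * S g (fst \<omega>) + (- 1 / sqrt 2) * S g (snd \<omega>)))
            = (CLINT a|M. CLINT b|M. iexp ((1 / sqrt 2) * S g a) * iexp ((- 1 / sqrt 2) * S g b))"
          unfolding integral_fst'[OF int, symmetric] by (simp only: fst_conv snd_conv of_real_add distrib_left exp_add)
        also have "\<dots> = (CLINT a|M. iexp ((1 / sqrt 2) * S g a)) * (CLINT b|M. iexp ((- 1 / sqrt 2) * S g b))"
          by (simp only: integral_mult_right_zero integral_mult_left_zero)
        also have "\<dots> = complex_of_real (exp (- V g / 2))"
          unfolding char by (simp add: power_divide exp_add[symmetric] of_real_mult[symmetric] del: of_real_mult of_real_exp)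
        finally show ?thesis unfolding eq .
      qed
    qed measurable
    moreover have "(\<Sum>i\<in>I. (h i * ((Z (x i) (fst \<omega>) - Z (x i) (snd \<omega>)) / sqrt 2))\<^sup>2) = l * A' \<omega>" for \<omega>
      unfolding A'_def sum_distrib_left by (intro sum.cong refl) (simp only: power_mult_distrib h2 mult.assoc)
    ultimately have "(\<integral>\<omega>. exp (- (l * A' \<omega>) / 2) \<partial>(M \<Otimes>\<^sub>M M)) = (\<integral>\<omega>. exp (- (l * A \<omega>) / 2) \<partial>M)"
      using 1 by simp
    moreover have "r * (measure M E)\<^sup>2 \<le> (\<integral>\<omega>. exp (- (l * A' \<omega>) / 2) \<partial>(M \<Otimes>\<^sub>M M))"
    proof -
      have "r * (measure M E)\<^sup>2 = (\<integral>\<omega>. r * indicator (E \<times> E) \<omega> \<partial>(M \<Otimes>\<^sub>M M))"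
        using E(1) times_E by (simp add: power2_eq_square)
      also have "\<dots> \<le> (\<integral>\<omega>. exp (- (l * A' \<omega>) / 2) \<partial>(M \<Otimes>\<^sub>M M))"
      proof (rule integral_mono)
        show "integrable (M \<Otimes>\<^sub>M M) (\<lambda>\<omega>. exp (- (l * A' \<omega>) / 2))"
          by (rule P.integrable_const_bound[where B=1]) (use l A'0 in auto)
        show "integrable (M \<Otimes>\<^sub>M M) (\<lambda>\<omega>. r * indicator (E \<times> E) \<omega>)"
          using E(1) by (intro integrable_mult_right integrable_real_indicator) (auto simp: P.emeasure_eq_measure)
        fix \<omega>
        show "r * indicator (E \<times> E) \<omega> \<le> exp (- (l * A' \<omega>) / 2)"
        proof (cases "\<omega> \<in> E \<times> E")
          case True
          have "A' \<omega> \<le> (\<Sum>i\<in>I. q i * (e / 2))"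
            unfolding A'_def
          proof (intro sum_mono mult_left_mono q(1))
            fix i assume "i \<in> I"
            then have "\<bar>Z (x i) (fst \<omega>) - Z (x i) (snd \<omega>)\<bar> \<le> \<bar>sqrt e\<bar>"
              using E(3)[of "fst \<omega>" "snd \<omega>" "x i"] True xi assms by (auto simp: mem_Times_iff)
            then have "(Z (x i) (fst \<omega>) - Z (x i) (snd \<omega>))\<^sup>2 \<le> (sqrt e)\<^sup>2"
              by (simp only: abs_le_square_iff)
            then show "((Z (x i) (fst \<omega>) - Z (x i) (snd \<omega>)) / sqrt 2)\<^sup>2 \<le> e / 2"
              using assms by (simp add: power_divide)
          qed
          also have "\<dots> = e / 2" by (simp only: sum_distrib_right[symmetric] q(2) mult_1_left)
          finally have "l * A' \<omega> \<le> l * (e / 2)" using l by (intro mult_left_mono) auto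
          then have "exp (- l * e / 4) \<le> exp (- (l * A' \<omega>) / 2)" by simp
          then show ?thesis using True unfolding el by simp
        qed simp
      qed
      finally show ?thesis .
    qed
    moreover have "(\<integral>\<omega>. exp (- (l * A \<omega>) / 2) \<partial>M) \<le> measure M {\<omega> \<in> space M. A \<omega> \<le> e} + r\<^sup>2"
    proof -
      have "(\<integral>\<omega>. exp (- (l * A \<omega>) / 2) \<partial>M) \<le> (\<integral>\<omega>. indicator {\<omega> \<in> space M. A \<omega> \<le> e} \<omega> + r\<^sup>2 \<partial>M)"
      proof (rule integral_mono)
        show "integrable M (\<lambda>\<omega>. exp (- (l * A \<omega>) / 2))"
          by (rule finite_M(1)[where B=1]) (use l A0 in auto)
        fix \<omega> assume \<omega>: "\<omega> \<in> space M"
        show "exp (- (l * A \<omega>) / 2) \<le> indicator {\<omega> \<in> space M. A \<omega> \<le> e} \<omega> + r\<^sup>2"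
        proof (cases "A \<omega> \<le> e")
          case True
          have "exp (- (l * A \<omega>) / 2) \<le> 1" using l A0 by simp
          then show ?thesis using True \<omega> by (simp add: add_increasing2)
        next
          case False
          then have "l * e \<le> l * A \<omega>" using l by (intro mult_left_mono) auto
          then have "exp (- (l * A \<omega>) / 2) \<le> exp (2 * (- l * e / 4))" by (simp add: mult.commute)
          also have "\<dots> = r\<^sup>2" unfolding el[symmetric] by (simp add: power2_eq_square exp_add[symmetric])
          finally show ?thesis using False by simp
        qed
      qed (auto simp: finite_M)
      also have "\<dots> = measure M {\<omega> \<in> space M. A \<omega> \<le> e} + r\<^sup>2"
        by (subst Bochner_Integration.integral_add) (auto simp: finite_M)
      finally show ?thesis .
    qed
    ultimately have "r * (measure M E)\<^sup>2 \<le> measure M {\<omega> \<in> space M. A \<omega> \<le> e} + r\<^sup>2" by linarith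
    moreover have "(measure M E)\<^sup>2 = 2 * r" by (simp add: r_def)
    ultimately show "r\<^sup>2 \<le> measure M {\<omega> \<in> space M. (\<Sum>i\<in>I. q i * (Z (x i) \<omega>)\<^sup>2) \<le> e}"
      by (simp add: A_def power2_eq_square)
  qed
qed

end

section \<open>The main theorem\<close>

text \<open>The fraction of the total weight carried by the pairs with left point \<open>i\<close>.
  It writes the marginal term as \<open>total_weight n\<close> times a mean of squares under
  probability weights, the form covered by the uniform bounds.\<close>

definition lag_share :: "(nat \<Rightarrow> real) \<Rightarrow> nat \<Rightarrow> nat \<Rightarrow> real" where
  "lag_share w n i = (\<Sum>j = i + 1..n. w (j - i)) / (\<Sum>i = 1..n - 1. \<Sum>j = i + 1..n. w (j - i))"

lemma lag_share_nonneg: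
  assumes "\<And>k. 1 \<le> k \<Longrightarrow> 0 \<le> w k"
  shows "0 \<le> lag_share w n i"
  unfolding lag_share_def using assms by (intro divide_nonneg_nonneg sum_nonneg) auto

lemma sum_lag_share:
  assumes "\<And>k. 1 \<le> k \<Longrightarrow> 0 \<le> w k" "\<And>k. K < k \<Longrightarrow> w k = 0" "1 \<le> k" "0 < w k" "k < n"
  shows "(\<Sum>i = 1..n - 1. lag_share w n i) = 1"
proof -
  have "k \<le> K" using assms(2)[of k] assms(4) by (cases "K < k") auto
  have "(\<Sum>i = 1..n - 1. \<Sum>j = i + 1..n. w (j - i)) = (\<Sum>k = 1..K. w k * (\<Sum>i = 1..n - k. 1))"
    using sum_pairs_by_lag[where w = w and n = n and K = K and F = "\<lambda>_ _. 1"] assms(2) by simp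
  also have "0 < \<dots>"
    using assms \<open>k \<le> K\<close> by (intro sum_pos2[of _ k]) auto
  finally show ?thesis
    unfolding lag_share_def sum_divide_distrib[symmetric] by simp
qed

lemma (in observed_path) marginal_term_eq:
  assumes "0 < total_weight n"
  shows "marginal_term n = total_weight n * (\<Sum>i = 1..n - 1. lag_share w n i * (z (s n i))\<^sup>2)"
proof -
  define W where "W = (\<Sum>i = 1..n - 1. \<Sum>j = i + 1..n. w (j - i))"
  have tw: "total_weight n = W / n" by (simp add: total_weight_def avg_def W_def)
  have "W \<noteq> 0" using assms tw by auto
  define u where "u i = (\<Sum>j = i + 1..n. w (j - i))" for i
  have "marginal_term n = (\<Sum>i = 1..n - 1. u i * (z (s n i))\<^sup>2) / n"
    by (simp add: marginal_term_def avg_def sum_distrib_right u_def)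
  also have "\<dots> = W / n * (\<Sum>i = 1..n - 1. u i / W * (z (s n i))\<^sup>2)"
    using \<open>W \<noteq> 0\<close> by (simp add: sum_distrib_left sum_divide_distrib)
  finally show ?thesis unfolding tw lag_share_def W_def u_def .
qed

lemma (in ornstein_uhlenbeck) AE_observed_path:
  assumes "observation_points s" "\<And>k. 1 \<le> k \<Longrightarrow> 0 \<le> w k" "\<And>k. K < k \<Longrightarrow> w k = 0" "0 < (\<Sum>k = 1..K. w k)"
  shows "AE \<omega> in M. \<exists>B. observed_path \<theta>\<^sub>0 v\<^sub>0 s w K (\<lambda>t. Z t \<omega>) B"
proof -
  have "AE \<omega> in M. continuous_on {0..1} (\<lambda>t. Z t \<omega>)"
    using ou by (simp add: ou_process_def)
  moreover have "AE \<omega> in M. \<forall>k. (\<lambda>n. ((\<Sum>i = 1..n - Suc k. (innovation \<theta>\<^sub>0 v\<^sub>0 (\<lambda>t. Z t \<omega>) (s n i) (s n (i + Suc k)))\<^sup>2)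
    - real (n - Suc k)) / n) \<longlonglongrightarrow> 0"
    unfolding AE_all_countable by (intro allI innovations_strong_law assms) simp
  ultimately show ?thesis
  proof eventually_elim
    case (elim \<omega>)
    have "compact ((\<lambda>t. Z t \<omega>) ` {0..1})"
      using elim(1) by (intro compact_continuous_image) auto
    then obtain B where "\<forall>y\<in>(\<lambda>t. Z t \<omega>) ` {0..1}. norm y \<le> B"
      using compact_imp_bounded bounded_iff by metis
    then have "\<bar>Z t \<omega>\<bar> \<le> B" if "t \<in> {0..1}" for t
      using that by auto
    moreover have "(\<lambda>n. ((\<Sum>i = 1..n - k. (innovation \<theta>\<^sub>0 v\<^sub>0 (\<lambda>t. Z t \<omega>) (s n i) (s n (i + k)))\<^sup>2)
      - real (n - k)) / n) \<longlonglongrightarrow> 0" if "1 \<le> k" for k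
      using elim(2)[rule_format, of "k - 1"] that by simp
    ultimately have "observed_path \<theta>\<^sub>0 v\<^sub>0 s w K (\<lambda>t. Z t \<omega>) B"
      using assms rate_pos variance_pos by unfold_locales auto
    then show ?case ..
  qed
qed

text \<open>The threshold in \<open>away\<close> depends on the outcome. By dominated convergence
  the part \<open>D n\<close> of \<open>E n\<close> on which \<open>X n\<close> is near
  \<open>x\<close> still has vanishing probability; convergence in probability would make the rest
  of \<open>E n\<close> vanish as well.\<close>

lemma (in prob_space) not_conv_in_prob:
  assumes X [measurable]: "\<And>n. X n \<in> borel_measurable M" and E [measurable]: "\<And>n. E n \<in> sets M"
    and p: "0 < p" "\<forall>\<^sub>F n in sequentially. p \<le> prob (E n)" and "0 < \<delta>"
    and away: "AE \<omega> in M. \<forall>\<^sub>F n in sequentially. \<omega> \<in> E n \<longrightarrow> \<delta> \<le> \<bar>X n \<omega> - x\<bar>"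
  shows "\<not> conv_in_prob M X x"
proof
  assume conv: "conv_in_prob M X x"
  define D where "D n = {\<omega> \<in> E n. \<bar>X n \<omega> - x\<bar> \<le> \<delta> / 2}" for n
  have D_eq: "D n = E n \<inter> {\<omega> \<in> space M. \<bar>X n \<omega> - x\<bar> \<le> \<delta> / 2}" for n
    using sets.sets_into_space[OF E, of n] by (auto simp: D_def)
  have D [measurable]: "D n \<in> sets M" for n unfolding D_eq by measurable
  have "(\<lambda>n. \<integral>\<omega>. indicator (D n) \<omega> \<partial>M) \<longlonglongrightarrow> (\<integral>\<omega>. (0::real) \<partial>M)"
  proof (rule integral_dominated_convergence[where w = "\<lambda>_. 1"])
    show "AE \<omega> in M. (\<lambda>n. indicator (D n) \<omega>) \<longlonglongrightarrow> (0::real)"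
      using away
    proof eventually_elim
      case (elim \<omega>)
      then have "\<forall>\<^sub>F n in sequentially. indicator (D n) \<omega> = (0::real)"
        by eventually_elim (use \<open>0 < \<delta>\<close> in \<open>auto simp: D_def indicator_def\<close>)
      then show ?case by (rule tendsto_eventually)
    qed
  qed auto
  then have "(\<lambda>n. prob (D n)) \<longlonglongrightarrow> 0"
    by simp
  moreover have "(\<lambda>n. prob {\<omega> \<in> space M. \<delta> / 2 < \<bar>X n \<omega> - x\<bar>}) \<longlonglongrightarrow> 0"
    using conv[unfolded conv_in_prob_def, rule_format, of "\<delta> / 2"] \<open>0 < \<delta>\<close> by simp
  ultimately have "(\<lambda>n. prob (D n) + prob {\<omega> \<in> space M. \<delta> / 2 < \<bar>X n \<omega> - x\<bar>}) \<longlonglongrightarrow> 0 + 0"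
    by (rule tendsto_add)
  then have "\<forall>\<^sub>F n in sequentially. prob (D n) + prob {\<omega> \<in> space M. \<delta> / 2 < \<bar>X n \<omega> - x\<bar>} < p"
    using p(1) by (auto dest: order_tendstoD)
  with p(2) have "\<forall>\<^sub>F n in sequentially. False"
  proof eventually_elim
    case (elim n)
    have "prob (E n) \<le> prob (D n \<union> {\<omega> \<in> space M. \<delta> / 2 < \<bar>X n \<omega> - x\<bar>})"
      using sets.sets_into_space[OF E, of n] by (intro finite_measure_mono) (auto simp: D_def)
    also have "\<dots> \<le> prob (D n) + prob {\<omega> \<in> space M. \<delta> / 2 < \<bar>X n \<omega> - x\<bar>}"
      by (intro measure_Un_le) measurable
    finally show ?case using elim by simp
  qed
  then show False by simp
qed

lemma max_lag_finite:
  assumes "max_lag w < \<infinity>"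
  obtains K where "\<And>k. K < k \<Longrightarrow> w k = 0"
proof -
  obtain K where K: "max_lag w = enat K" using assms by (cases "max_lag w") auto
  have "w k = 0" if "K < k" for k
  proof (rule ccontr)
    assume "w k \<noteq> 0"
    then have "enat k \<le> max_lag w"
      unfolding max_lag_def using that by (intro Sup_upper) (auto intro!: exI[of _ k])
    then show False using that K by simp
  qed
  then show ?thesis using that by blast
qed

theorem theorem1:
  fixes M :: "'w measure"
    and Z :: "real \<Rightarrow> 'w \<Rightarrow> real"
    and \<theta>\<^sub>0 v\<^sub>0 a b c d :: real
    and s :: "nat \<Rightarrow> nat \<Rightarrow> real"
    and w :: "nat \<Rightarrow> real"
    and J :: "(real \<times> real) set"
    and est :: "nat \<Rightarrow> 'w \<Rightarrow> real \<times> real"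
  assumes "prob_space M"
    and "0 < \<theta>\<^sub>0" and "0 < v\<^sub>0"
    and "ou_process M \<theta>\<^sub>0 v\<^sub>0 Z"
    and "observation_points s"
    and "\<forall>k\<ge>1. 0 \<le> w k" and "\<exists>k\<ge>1. w k \<noteq> 0"
    and "max_lag w < \<infinity>"
    and "J \<subseteq> {0<..} \<times> {0<..}"
    and "\<exists>(\<theta>, v)\<in>J. \<theta> * v = \<theta>\<^sub>0 * v\<^sub>0"
    and "0 < a" and "a \<le> b" and "0 < c" and "c \<le> d"
    and "pairwise_mle M Z w s J est"
  shows "(J = {a..b} \<times> {c..d} \<and> (a * d > \<theta>\<^sub>0 * v\<^sub>0 \<or> b * c < \<theta>\<^sub>0 * v\<^sub>0) \<longrightarrow>
            \<not> conv_in_prob M (\<lambda>n \<omega>. fst (est n \<omega>) * snd (est n \<omega>)) (\<theta>\<^sub>0 * v\<^sub>0)) \<and>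
         (J = {a..b} \<times> {c..d} \<and> a * d \<le> \<theta>\<^sub>0 * v\<^sub>0 \<and> b * c \<ge> \<theta>\<^sub>0 * v\<^sub>0 \<longrightarrow>
            conv_almost_surely M (\<lambda>n \<omega>. fst (est n \<omega>) * snd (est n \<omega>)) (\<theta>\<^sub>0 * v\<^sub>0)) \<and>
         (J = {a..b} \<times> {0<..} \<longrightarrow>
            \<not> conv_in_prob M (\<lambda>n \<omega>. fst (est n \<omega>) * snd (est n \<omega>)) (\<theta>\<^sub>0 * v\<^sub>0)) \<and>
         (J = {0<..} \<times> {c..d} \<longrightarrow>
            conv_almost_surely M (\<lambda>n \<omega>. fst (est n \<omega>) * snd (est n \<omega>)) (\<theta>\<^sub>0 * v\<^sub>0))"
proof -
  let ?\<kappa> = "\<theta>\<^sub>0 * v\<^sub>0"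
  let ?X = "\<lambda>n \<omega>. fst (est n \<omega>) * snd (est n \<omega>)"
  interpret ornstein_uhlenbeck M \<theta>\<^sub>0 v\<^sub>0 Z
    using assms(1-4) by (simp add: ornstein_uhlenbeck_def ornstein_uhlenbeck_axioms_def)
  have kpos: "0 < ?\<kappa>" using assms(2,3) by simp
  note ab = \<open>0 < a\<close> \<open>a \<le> b\<close> and cd = \<open>0 < c\<close> \<open>c \<le> d\<close>
  obtain K where K: "\<And>k. K < k \<Longrightarrow> w k = 0" using max_lag_finite[OF assms(8)] by metis
  have wnn: "\<And>k. 1 \<le> k \<Longrightarrow> 0 \<le> w k" using assms(6) by blast
  obtain k where k: "1 \<le> k" "0 < w k" using assms(7) wnn by (metis less_le)
  have "k \<le> K" using K[of k] k(2) by (cases "K < k") auto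
  then have wsum: "0 < (\<Sum>k = 1..K. w k)" using k wnn by (intro sum_pos2[of _ k]) auto
  have X_meas: "?X n \<in> borel_measurable M" for n
  proof -
    have "est n \<in> borel_measurable M" using assms(15) by (simp add: pairwise_mle_def)
    moreover have "(\<lambda>\<psi>::real \<times> real. fst \<psi> * snd \<psi>) \<in> borel_measurable borel"
      by (intro borel_measurable_continuous_onI continuous_intros)
    ultimately show ?thesis by (rule measurable_compose)
  qed
  define sel where "sel \<omega> \<longleftrightarrow> (\<forall>n. (\<exists>\<psi>. is_arg_min (weighted_pair_loglik w s n (\<lambda>t. Z t \<omega>)) (\<lambda>\<psi>. \<psi> \<in> J) \<psi>) \<longrightarrow>
          is_arg_min (weighted_pair_loglik w s n (\<lambda>t. Z t \<omega>)) (\<lambda>\<psi>. \<psi> \<in> J) (est n \<omega>))" for \<omega>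
  have "AE \<omega> in M. sel \<omega>"
    unfolding sel_def AE_all_countable using assms(15) by (simp add: pairwise_mle_def)
  moreover have "AE \<omega> in M. \<exists>B. observed_path \<theta>\<^sub>0 v\<^sub>0 s w K (\<lambda>t. Z t \<omega>) B"
    by (rule AE_observed_path) (use assms(5) wnn K wsum in auto)
  ultimately have good: "AE \<omega> in M. (\<exists>B. observed_path \<theta>\<^sub>0 v\<^sub>0 s w K (\<lambda>t. Z t \<omega>) B) \<and> sel \<omega>"
    by eventually_elim simp
  have share: "0 \<le> lag_share w n i" for n i
    using wnn by (intro lag_share_nonneg)
  have share_sum: "(\<Sum>i = 1..n - 1. lag_share w n i) = 1" if "k < n" for n
    by (rule sum_lag_share[where K = K and k = k]) (use wnn K k that in auto)
  define A where "A n \<omega> = (\<Sum>i = 1..n - 1. lag_share w n i * (Z (s n i) \<omega>)\<^sup>2)" for n \<omega>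
  have pts: "s n ` {1..n - 1} \<subseteq> {0..1}" for n
  proof -
    have "s n ` {1..n} \<subseteq> {0..1}" using assms(5) unfolding observation_points_def by blast
    then show ?thesis by (auto simp: image_subset_iff)
  qed
  have A_meas [measurable]: "A n \<in> borel_measurable M" for n
  proof -
    have [measurable]: "i \<in> {1..n - 1} \<Longrightarrow> Z (s n i) \<in> borel_measurable M" for i
      using pts[of n] by (intro measurable_Z) (auto simp: image_subset_iff)
    show ?thesis unfolding A_def by measurable
  qed
  \<comment> \<open>The bound involves neither the points nor the shares, so one \<open>p\<close>
    serves all \<open>n > k\<close>. From there on a pair of lag \<open>k\<close> has positive
    weight, and the shares add up to 1.\<close>
  have large: "\<exists>p>0. \<forall>\<^sub>F n in sequentially. p \<le> prob {\<omega> \<in> space M. C < A n \<omega>}" if "0 \<le> C" for C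
  proof (intro exI conjI)
    show "0 < measure std_normal_distribution {sqrt C / sqrt (v\<^sub>0 * exp (- \<theta>\<^sub>0))<..}"
      by (rule std_normal_distribution_greaterThan_pos)
    show "\<forall>\<^sub>F n in sequentially. measure std_normal_distribution {sqrt C / sqrt (v\<^sub>0 * exp (- \<theta>\<^sub>0))<..}
      \<le> prob {\<omega> \<in> space M. C < A n \<omega>}"
      using eventually_gt_at_top[of k]
    proof eventually_elim
      case (elim n)
      show ?case unfolding A_def
        by (intro quadratic_form_large pts share share_sum[OF elim] that) simp_all
    qed
  qed
  have small: "\<exists>p>0. \<forall>\<^sub>F n in sequentially. p \<le> prob {\<omega> \<in> space M. A n \<omega> \<le> e}" if "0 < e" for e
  proof (rule quadratic_form_small[OF that])
    fix p assume p: "0 < p" "\<And>I (x :: nat \<Rightarrow> real) q. finite I \<Longrightarrow> x ` I \<subseteq> {0..1} \<Longrightarrow> (\<And>i. i \<in> I \<Longrightarrow> 0 \<le> q i) \<Longrightarrow>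
      (\<Sum>i\<in>I. q i) = 1 \<Longrightarrow> p \<le> prob {\<omega> \<in> space M. (\<Sum>i\<in>I. q i * (Z (x i) \<omega>)\<^sup>2) \<le> e}"
    have "\<forall>\<^sub>F n in sequentially. p \<le> prob {\<omega> \<in> space M. A n \<omega> \<le> e}"
      using eventually_gt_at_top[of k]
    proof eventually_elim
      case (elim n)
      show ?case unfolding A_def
        by (intro p(2) pts share share_sum[OF elim]) simp_all
    qed
    with p(1) show ?thesis by blast
  qed
  have i_large: "\<not> conv_in_prob M ?X ?\<kappa>" if J: "J = {a..b} \<times> {c..d}" and ad: "a * d > ?\<kappa>"
  proof -
    obtain p where p: "0 < p" "\<forall>\<^sub>F n in sequentially. p \<le> prob {\<omega> \<in> space M. 2 * d < A n \<omega>}"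
      using large[of "2 * d"] cd by auto
    show ?thesis
    proof (rule not_conv_in_prob[OF X_meas _ p])
      show "0 < a * d - ?\<kappa>" using ad by simp
      show "AE \<omega> in M. \<forall>\<^sub>F n in sequentially. \<omega> \<in> {\<omega> \<in> space M. 2 * d < A n \<omega>} \<longrightarrow> a * d - ?\<kappa> \<le> \<bar>?X n \<omega> - ?\<kappa>\<bar>"
        using good
      proof eventually_elim
        case (elim \<omega>)
        then obtain B where "observed_path \<theta>\<^sub>0 v\<^sub>0 s w K (\<lambda>t. Z t \<omega>) B" and sel: "sel \<omega>" by blast
        then interpret path: observed_path \<theta>\<^sub>0 v\<^sub>0 s w K "\<lambda>t. Z t \<omega>" B by simp
        show ?case using path.eventually_total_weight_pos eventually_gt_at_top[of 0]
        proof eventually_elim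
          case (elim n)
          show ?case
          proof
            assume "\<omega> \<in> {\<omega> \<in> space M. 2 * d < A n \<omega>}"
            then have "path.total_weight n * (2 * d) \<le> path.total_weight n * A n \<omega>"
              using elim by (intro mult_left_mono) auto
            then have "2 * d * path.total_weight n \<le> path.marginal_term n"
              unfolding path.marginal_term_eq[OF elim(1)] A_def by (simp add: mult.commute)
            then have "a * d \<le> ?X n \<omega>"
              using path.rectangle_product_ge[of J "\<lambda>n. est n \<omega>", OF _ J ab cd elim(2,1)] sel
              unfolding sel_def by blast
            then show "a * d - ?\<kappa> \<le> \<bar>?X n \<omega> - ?\<kappa>\<bar>" by linarith
          qed
        qed
      qed
    qed measurable
  qed
  have i_small: "\<not> conv_in_prob M ?X ?\<kappa>" if J: "J = {a..b} \<times> {c..d}" and bc: "b * c < ?\<kappa>"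
  proof -
    have bpos: "0 < b" using ab by simp
    obtain p where p: "0 < p" "\<forall>\<^sub>F n in sequentially. p \<le> prob {\<omega> \<in> space M. A n \<omega> \<le> ?\<kappa> / (4 * b)}"
      using small[of "?\<kappa> / (4 * b)"] kpos bpos by auto
    show ?thesis
    proof (rule not_conv_in_prob[OF X_meas _ p])
      show "0 < ?\<kappa> - max (b * c) (7 / 8 * ?\<kappa>)" using bc kpos by simp
      show "AE \<omega> in M. \<forall>\<^sub>F n in sequentially. \<omega> \<in> {\<omega> \<in> space M. A n \<omega> \<le> ?\<kappa> / (4 * b)}
        \<longrightarrow> ?\<kappa> - max (b * c) (7 / 8 * ?\<kappa>) \<le> \<bar>?X n \<omega> - ?\<kappa>\<bar>"
        using good
      proof eventually_elim
        case (elim \<omega>)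
        then obtain B where "observed_path \<theta>\<^sub>0 v\<^sub>0 s w K (\<lambda>t. Z t \<omega>) B" and sel: "sel \<omega>" by blast
        then interpret path: observed_path \<theta>\<^sub>0 v\<^sub>0 s w K "\<lambda>t. Z t \<omega>" B by simp
        have "\<forall>\<^sub>F n in sequentially. path.marginal_term n \<le> ?\<kappa> / (4 * b) * path.total_weight n \<longrightarrow>
            ?X n \<omega> \<le> max (b * c) (7 / 8 * ?\<kappa>)"
          using path.rectangle_product_le[of J "\<lambda>n. est n \<omega>", OF _ J ab cd] sel unfolding sel_def by blast
        with path.eventually_total_weight_pos show ?case
        proof eventually_elim
          case (elim n)
          show ?case
          proof
            assume "\<omega> \<in> {\<omega> \<in> space M. A n \<omega> \<le> ?\<kappa> / (4 * b)}"
            then have "path.total_weight n * A n \<omega> \<le> path.total_weight n * (?\<kappa> / (4 * b))"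
              using elim by (intro mult_left_mono) auto
            then have "path.marginal_term n \<le> ?\<kappa> / (4 * b) * path.total_weight n"
              unfolding path.marginal_term_eq[OF elim(1)] A_def by (simp add: mult.commute)
            then have "?X n \<omega> \<le> max (b * c) (7 / 8 * ?\<kappa>)" using elim(2) by blast
            then show "?\<kappa> - max (b * c) (7 / 8 * ?\<kappa>) \<le> \<bar>?X n \<omega> - ?\<kappa>\<bar>" by linarith
          qed
        qed
      qed
    qed measurable
  qed
  have iii: "\<not> conv_in_prob M ?X ?\<kappa>" if J: "J = {a..b} \<times> {0<..}"
  proof -
    \<comment> \<open>Puts the product above the true one by at least 1, through the bound
      \<open>a\<close> times the marginal term over twice the total weight.\<close>
    define C where "C = 2 * (?\<kappa> + 1) / a"
    have "0 < C" using kpos ab by (simp add: C_def)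
    then obtain p where p: "0 < p" "\<forall>\<^sub>F n in sequentially. p \<le> prob {\<omega> \<in> space M. C < A n \<omega>}"
      using large[of C] by auto
    show ?thesis
    proof (rule not_conv_in_prob[OF X_meas _ p])
      show "(0::real) < 1" by simp
      show "AE \<omega> in M. \<forall>\<^sub>F n in sequentially. \<omega> \<in> {\<omega> \<in> space M. C < A n \<omega>} \<longrightarrow> 1 \<le> \<bar>?X n \<omega> - ?\<kappa>\<bar>"
        using good
      proof eventually_elim
        case (elim \<omega>)
        then obtain B where "observed_path \<theta>\<^sub>0 v\<^sub>0 s w K (\<lambda>t. Z t \<omega>) B" and sel: "sel \<omega>" by blast
        then interpret path: observed_path \<theta>\<^sub>0 v\<^sub>0 s w K "\<lambda>t. Z t \<omega>" B by simp
        show ?case using path.eventually_total_weight_pos eventually_gt_at_top[of 0]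
        proof eventually_elim
          case (elim n)
          show ?case
          proof
            assume C: "\<omega> \<in> {\<omega> \<in> space M. C < A n \<omega>}"
            then have "path.total_weight n * C \<le> path.total_weight n * A n \<omega>"
              using elim by (intro mult_left_mono) auto
            then have "2 * (?\<kappa> + 1) / a * path.total_weight n \<le> path.marginal_term n"
              unfolding path.marginal_term_eq[OF elim(1)] A_def C_def[symmetric] by (simp add: mult.commute)
            moreover have "0 < path.marginal_term n"
              unfolding path.marginal_term_eq[OF elim(1)] A_def[symmetric]
              using C \<open>0 < C\<close> elim(1) by (intro mult_pos_pos) auto
            ultimately have "?\<kappa> + 1 \<le> ?X n \<omega>"
              using path.strip_product_ge[of J "\<lambda>n. est n \<omega>", OF _ J ab elim(2,1)] sel
              unfolding sel_def by blast
            then show "1 \<le> \<bar>?X n \<omega> - ?\<kappa>\<bar>" by linarith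
          qed
        qed
      qed
    qed measurable
  qed
  have ii: "conv_almost_surely M ?X ?\<kappa>" if J: "J = {a..b} \<times> {c..d}" and "a * d \<le> ?\<kappa>" "?\<kappa> \<le> b * c"
    unfolding conv_almost_surely_def using good
  proof eventually_elim
    case (elim \<omega>)
    then obtain B where "observed_path \<theta>\<^sub>0 v\<^sub>0 s w K (\<lambda>t. Z t \<omega>) B" and sel: "sel \<omega>" by blast
    then interpret path: observed_path \<theta>\<^sub>0 v\<^sub>0 s w K "\<lambda>t. Z t \<omega>" B by simp
    show ?case
      using path.rectangle_consistent[of J "\<lambda>n. est n \<omega>", OF _ J ab cd that(2,3)] sel
      unfolding sel_def by blast
  qed
  have iv: "conv_almost_surely M ?X ?\<kappa>" if J: "J = {0<..} \<times> {c..d}"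
    unfolding conv_almost_surely_def using good
  proof eventually_elim
    case (elim \<omega>)
    then obtain B where "observed_path \<theta>\<^sub>0 v\<^sub>0 s w K (\<lambda>t. Z t \<omega>) B" and sel: "sel \<omega>" by blast
    then interpret path: observed_path \<theta>\<^sub>0 v\<^sub>0 s w K "\<lambda>t. Z t \<omega>" B by simp
    show ?case
      using path.half_strip_consistent[of J "\<lambda>n. est n \<omega>", OF _ J cd] sel
      unfolding sel_def by blast
  qed
  show ?thesis using i_large i_small ii iii iv by blast
qed

end
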